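(* Assume Baumgartner's Axiom $\mathsf{BA}$. Let $K$ be a separable compact line of weight $\omega_1$. Fix an $\omega_1$-dense set $B \subset (0,1)$ and let $L_0 = I_B$ and $L_1 = I_B \oplus I$. Then for each $i \in \{0,1\}$, $C_p(K)$ is linearly homeomorphic to $C_p(L_i)$ if and only if $\dim(K) = i$.
   Context: A compact line is a linearly ordered set whose order topology is compact, regarded as a topological space. $I=[0,1]$. For $A \subset I$, $I_A = (I\times\{0\})\cup(A\times\{1\})$ with the order topology of the lexicographic order. $\oplus$ is topological disjoint union. $C_p(X)$ is the space of continuous real-valued functions on $X$ with the topology of pointwise convergence. $\dim$ is covering dimension. A subset $A$ of a space $X$ is $\omega_1$-dense in $X$ if $|A\cap U|=\omega_1$ for every nonempty open $U\subset X$; here $B$ is $\omega_1$-dense in $(0,1)$. $\mathsf{BA}$ is the statement: every two $\omega_1$-dense subsets of the real line $\mathbb{R}$ are order isomorphic. *)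

theory Defs
  imports "HOL-Analysis.Analysis"
begin

unbundle cardinal_syntax

abbreviation omega1 :: "nat set rel" where
  "omega1 \<equiv> cardSuc natLeq"

definition base_of_topology :: "'a topology \<Rightarrow> 'a set set \<Rightarrow> bool" where
  "base_of_topology X \<B> \<longleftrightarrow>
     (\<forall>V\<in>\<B>. openin X V) \<and>
     (\<forall>U x. openin X U \<and> x \<in> U \<longrightarrow> (\<exists>V\<in>\<B>. x \<in> V \<and> V \<subseteq> U))"

definition has_weight :: "'a topology \<Rightarrow> 'c rel \<Rightarrow> bool" where
  "has_weight X \<kappa> \<longleftrightarrow>
     (\<exists>\<B>. base_of_topology X \<B> \<and> |\<B>| =o \<kappa>) \<and>
     (\<forall>\<B>. base_of_topology X \<B> \<longrightarrow> \<kappa> \<le>o |\<B>| )"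

definition omega1_dense_in :: "'a topology \<Rightarrow> 'a set \<Rightarrow> bool" where
  "omega1_dense_in X A \<longleftrightarrow>
     A \<subseteq> topspace X \<and> (\<forall>U. openin X U \<and> U \<noteq> {} \<longrightarrow> |A \<inter> U| =o omega1)"

definition baumgartner_axiom :: bool where
  "baumgartner_axiom \<longleftrightarrow>
     (\<forall>A B :: real set. omega1_dense_in euclidean A \<and> omega1_dense_in euclidean B \<longrightarrow>
        (\<exists>f :: real \<Rightarrow> real. strict_mono_on A f \<and> f ` A = B))"

text \<open>
  A line is a carrier \<open>K\<close> with a reflexive linear order \<open>r\<close>, given as a relation. The carrier
  itself is put into the subbase because the rays do not cover a one-point line.
\<close>

definition order_topology :: "'a set \<Rightarrow> 'a rel \<Rightarrow> 'a topology" where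
  "order_topology K r = topology_generated_by
     (insert K ((\<lambda>a. {x \<in> K. (x, a) \<in> r \<and> x \<noteq> a}) ` K \<union>
                (\<lambda>a. {x \<in> K. (a, x) \<in> r \<and> x \<noteq> a}) ` K))"

lemma topspace_order_topology [simp]: "topspace (order_topology K r) = K"
  by (auto simp: order_topology_def)

definition compact_line :: "'a set \<Rightarrow> 'a rel \<Rightarrow> bool" where
  "compact_line K r \<longleftrightarrow> linear_order_on K r \<and> compact_space (order_topology K r)"

definition split_interval_carrier :: "real set \<Rightarrow> (real \<times> nat) set" where
  "split_interval_carrier A = {0..1} \<times> {0} \<union> A \<times> {1}"

definition split_interval_order :: "real set \<Rightarrow> (real \<times> nat) rel" where
  "split_interval_order A =
     Restr ({(s, t). s < t} <*lex*> {(i, j). i \<le> j}) (split_interval_carrier A)"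

definition split_interval :: "real set \<Rightarrow> (real \<times> nat) topology" where
  "split_interval A = order_topology (split_interval_carrier A) (split_interval_order A)"

lemma linear_order_on_split_interval:
  "linear_order_on (split_interval_carrier A) (split_interval_order A)"
  unfolding order_on_defs split_interval_order_def
  by (auto simp: refl_on_def total_on_def intro!: transI antisymI)

text \<open>
  The binary disjoint union of two topologies whose points have different types, in analogy
  with the indexed \<^const>\<open>sum_topology\<close>.
\<close>

definition disjoint_sum_topology :: "'a topology \<Rightarrow> 'b topology \<Rightarrow> ('a + 'b) topology"
    (infixr \<open>\<oplus>\<^sub>t\<close> 65) where
  "X \<oplus>\<^sub>t Y = topology (\<lambda>U. openin X (Inl -` U) \<and> openin Y (Inr -` U))"

lemma openin_disjoint_sum_topology:
  "openin (X \<oplus>\<^sub>t Y) U \<longleftrightarrow> openin X (Inl -` U) \<and> openin Y (Inr -` U)"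
proof -
  have "istopology (\<lambda>U. openin X (Inl -` U) \<and> openin Y (Inr -` U))"
    by (auto simp: istopology_def vimage_Union)
  then show ?thesis
    by (simp add: disjoint_sum_topology_def)
qed

lemma topspace_disjoint_sum_topology [simp]:
  "topspace (X \<oplus>\<^sub>t Y) = topspace X <+> topspace Y"
proof
  show "topspace (X \<oplus>\<^sub>t Y) \<subseteq> topspace X <+> topspace Y"
  proof
    fix z assume "z \<in> topspace (X \<oplus>\<^sub>t Y)"
    then obtain U where "openin (X \<oplus>\<^sub>t Y) U" "z \<in> U"
      by (auto simp: topspace_def)
    then show "z \<in> topspace X <+> topspace Y"
      by (cases z) (auto simp: openin_disjoint_sum_topology dest!: openin_subset)
  qed
  have "Inl -` (topspace X <+> topspace Y) = topspace X"
    and "Inr -` (topspace X <+> topspace Y) = topspace Y"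
    by auto
  then have "openin (X \<oplus>\<^sub>t Y) (topspace X <+> topspace Y)"
    by (simp add: openin_disjoint_sum_topology)
  then show "topspace X <+> topspace Y \<subseteq> topspace (X \<oplus>\<^sub>t Y)"
    by (rule openin_subset)
qed

text \<open>
  Functions on \<open>X\<close> are represented extensionally (\<^const>\<open>undefined\<close> outside \<^term>\<open>topspace X\<close>),
  since that is how the points of \<^const>\<open>product_topology\<close> are represented; hence the restricted
  abstractions in the vector space operations of \<open>linear_homeomorphism\<close>.
\<close>

definition Cp :: "'a topology \<Rightarrow> ('a \<Rightarrow> real) topology" where
  "Cp X = subtopology (product_topology (\<lambda>_. euclideanreal) (topspace X))
            {f. continuous_map X euclideanreal f}"

lemma topspace_Cp:
  "topspace (Cp X) = {f \<in> extensional (topspace X). continuous_map X euclideanreal f}"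
  by (auto simp: Cp_def PiE_def)

definition linear_homeomorphism ::
    "'a topology \<Rightarrow> 'b topology \<Rightarrow> (('a \<Rightarrow> real) \<Rightarrow> 'b \<Rightarrow> real) \<Rightarrow> bool" where
  "linear_homeomorphism X Y T \<longleftrightarrow>
     homeomorphic_map (Cp X) (Cp Y) T \<and>
     (\<forall>f\<in>topspace (Cp X). \<forall>g\<in>topspace (Cp X).
        T (\<lambda>x\<in>topspace X. f x + g x) = (\<lambda>y\<in>topspace Y. T f y + T g y)) \<and>
     (\<forall>c. \<forall>f\<in>topspace (Cp X).
        T (\<lambda>x\<in>topspace X. c * f x) = (\<lambda>y\<in>topspace Y. c * T f y))"

definition Cp_linearly_homeomorphic :: "'a topology \<Rightarrow> 'b topology \<Rightarrow> bool" where
  "Cp_linearly_homeomorphic X Y \<longleftrightarrow> (\<exists>T. linear_homeomorphism X Y T)"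

text \<open>
  Covering dimension via finite open covers, as usual for normal spaces. The dimension is an
  integer so that the empty space has dimension \<open>-1\<close>.
\<close>

definition covering_dim_le :: "'a topology \<Rightarrow> int \<Rightarrow> bool" where
  "covering_dim_le X n \<longleftrightarrow> -1 \<le> n \<and>
     (\<forall>\<U>. finite \<U> \<and> (\<forall>U\<in>\<U>. openin X U) \<and> \<Union>\<U> = topspace X \<longrightarrow>
       (\<exists>\<V>. finite \<V> \<and> (\<forall>V\<in>\<V>. openin X V) \<and> \<Union>\<V> = topspace X \<and>
            (\<forall>V\<in>\<V>. \<exists>U\<in>\<U>. V \<subseteq> U) \<and>
            (\<forall>x\<in>topspace X. int (card {V \<in> \<V>. x \<in> V}) \<le> n + 1)))"

definition has_covering_dim :: "'a topology \<Rightarrow> int \<Rightarrow> bool" where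
  "has_covering_dim X n \<longleftrightarrow> covering_dim_le X n \<and> \<not> covering_dim_le X (n - 1)"

end

theory Submission
  imports Defs "HOL-Library.Countable_Set_Type"
begin

text \<open>
  A separable compact line \<open>K\<close> is a compact set \<open>F\<close> of reals in which the points of some set \<open>A\<close> are
  doubled: countably many monotone functions separate all pairs of points except for the two sides
  of some jumps (\<open>separable_compact_line_representation\<close>). Weight \<open>omega1\<close> means that \<open>A\<close> has exactly
  \<open>omega1\<close> elements. The representation can be chosen so that intervals contained in \<open>F\<close> come from
  connected parts of \<open>K\<close>; then the dimension is \<open>0\<close> if \<open>F\<close> has empty interior and \<open>1\<close> otherwise.

  Isomorphisms between function spaces are built from finite combinations of evaluations. The
  basic one is \<open>split_C_fill_gaps\<close>: restriction to a closed subset has linear interpolation across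
  the gaps as a right inverse, so the functions on \<open>F\<close> are the functions on the subset together with
  a null sequence of functions on the gaps.

  In dimension zero, filling all gaps of \<open>F\<close> with copies of a split interval produces another split
  interval, and Baumgartner's axiom says that there is only one (\<open>split_interval_unique\<close>). So the
  functions on \<open>K\<close> are a factor of those on the split interval, with a complement \<open>Z\<close> that
  satisfies \<open>Z \<otimes>\<^sub>f Z \<simeq> Z\<close>. In the other direction, a Cantor function that is constant on the intervals
  with only countably many points of \<open>A\<close> collapses \<open>K\<close> to a split interval, and this map has a section
  (\<open>split_interval_is_factor\<close>). Pelczynski's decomposition argument finishes this case
  (\<open>zero_dim_iso_split_interval\<close>).

  In dimension one, removing the interior of \<open>F\<close> leaves the zero-dimensional case and a null sequence
  of functions on intervals, and the latter can be exchanged for the functions on one interval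
  (\<open>one_dim_iso_split_interval_sum\<close>).

  It remains to see that a space with an arc on which some real function is injective and a totally
  separated space are never equivalent (\<open>no_arc\<close>). A linear homeomorphism would turn the
  evaluations along the arc into functionals with finite supports. By Baire's theorem these
  supports are constant along a part of the arc, but no finite set can support infinitely many
  independent functionals.
\<close>

section \<open>Spaces of functions up to finitely determined isomorphism\<close>

text \<open>
  The continuous linear functionals on a function space with the topology of pointwise
  convergence are the finite combinations of evaluations. Working with these combinations
  directly keeps topology out of the construction of isomorphisms.
\<close>

definition fin_functional :: "('a \<Rightarrow> real) set \<Rightarrow> (('a \<Rightarrow> real) \<Rightarrow> real) \<Rightarrow> bool" where
  "fin_functional V \<phi> \<longleftrightarrow> (\<exists>P c. finite P \<and> (\<forall>f\<in>V. \<phi> f = (\<Sum>x\<in>P. c x * f x)))"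

definition fin_operator ::
    "('a \<Rightarrow> real) set \<Rightarrow> ('b \<Rightarrow> real) set \<Rightarrow> (('a \<Rightarrow> real) \<Rightarrow> 'b \<Rightarrow> real) \<Rightarrow> bool" where
  "fin_operator V W T \<longleftrightarrow> (\<forall>f\<in>V. T f \<in> W) \<and> (\<forall>y. fin_functional V (\<lambda>f. T f y))"

definition fin_iso :: "('a \<Rightarrow> real) set \<Rightarrow> ('b \<Rightarrow> real) set \<Rightarrow> bool" (infix \<open>\<simeq>\<close> 50) where
  "V \<simeq> W \<longleftrightarrow> (\<exists>T S. fin_operator V W T \<and> fin_operator W V S \<and>
                     (\<forall>f\<in>V. S (T f) = f) \<and> (\<forall>g\<in>W. T (S g) = g))"

lemma fin_functional_eval [simp, intro]: "fin_functional V (\<lambda>f. f x)"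
  unfolding fin_functional_def by (intro exI[of _ "{x}"] exI[of _ "\<lambda>_. 1"]) auto

lemma fin_functional_0 [simp, intro]: "fin_functional V (\<lambda>f. 0)"
  unfolding fin_functional_def by (intro exI[of _ "{}"]) auto

lemma fin_functional_scale [intro]:
  assumes "fin_functional V \<phi>"
  shows "fin_functional V (\<lambda>f. k * \<phi> f)"
proof -
  obtain P c where P: "finite P" "\<forall>f\<in>V. \<phi> f = (\<Sum>x\<in>P. c x * f x)"
    using assms unfolding fin_functional_def by blast
  have "\<forall>f\<in>V. k * \<phi> f = (\<Sum>x\<in>P. (k * c x) * f x)"
    using P by (simp add: sum_distrib_left mult.assoc)
  then show ?thesis
    unfolding fin_functional_def using P by (intro exI[of _ P] exI[of _ "\<lambda>x. k * c x"]) simp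
qed

lemma fin_functional_divide [intro]: "fin_functional V \<phi> \<Longrightarrow> fin_functional V (\<lambda>f. \<phi> f / k)"
  using fin_functional_scale[of V \<phi> "1 / k"] by simp

lemma fin_functional_add [intro]:
  assumes "fin_functional V \<phi>" "fin_functional V \<psi>"
  shows "fin_functional V (\<lambda>f. \<phi> f + \<psi> f)"
proof -
  obtain P c where P: "finite P" "\<forall>f\<in>V. \<phi> f = (\<Sum>x\<in>P. c x * f x)"
    using assms unfolding fin_functional_def by blast
  obtain Q d where Q: "finite Q" "\<forall>f\<in>V. \<psi> f = (\<Sum>x\<in>Q. d x * f x)"
    using assms unfolding fin_functional_def by blast
  define c' where "c' x = (if x \<in> P then c x else 0)" for x
  define d' where "d' x = (if x \<in> Q then d x else 0)" for x
  have "\<phi> f + \<psi> f = (\<Sum>x\<in>P \<union> Q. (c' x + d' x) * f x)" if "f \<in> V" for f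
  proof -
    have "\<phi> f = (\<Sum>x\<in>P \<union> Q. c' x * f x)"
      using P Q that by (subst sum.mono_neutral_right[of _ P]) (auto simp: c'_def)
    moreover have "\<psi> f = (\<Sum>x\<in>P \<union> Q. d' x * f x)"
      using P Q that by (subst sum.mono_neutral_right[of _ Q]) (auto simp: d'_def)
    ultimately show ?thesis
      by (simp add: sum.distrib distrib_right)
  qed
  then show ?thesis
    unfolding fin_functional_def using P Q
    by (intro exI[of _ "P \<union> Q"] exI[of _ "\<lambda>x. c' x + d' x"]) auto
qed

lemma fin_functional_diff [intro]:
  assumes "fin_functional V \<phi>" "fin_functional V \<psi>"
  shows "fin_functional V (\<lambda>f. \<phi> f - \<psi> f)"
  using fin_functional_add[OF assms(1) fin_functional_scale[OF assms(2), of "-1"]] by simp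

lemma fin_functional_if [intro]:
  assumes "b \<Longrightarrow> fin_functional V \<phi>" "\<not> b \<Longrightarrow> fin_functional V \<psi>"
  shows "fin_functional V (\<lambda>f. if b then \<phi> f else \<psi> f)"
  using assms by (cases b) auto

lemma fin_functional_sum:
  assumes "finite P" "\<And>x. x \<in> P \<Longrightarrow> fin_functional V (\<phi> x)"
  shows "fin_functional V (\<lambda>f. \<Sum>x\<in>P. \<phi> x f)"
  using assms by (induction P rule: finite_induct) (auto intro!: fin_functional_add)

lemma fin_functional_compose:
  assumes "fin_operator V W T" "fin_functional W \<phi>"
  shows "fin_functional V (\<lambda>f. \<phi> (T f))"
proof -
  obtain P c where P: "finite P" "\<forall>f\<in>W. \<phi> f = (\<Sum>x\<in>P. c x * f x)"
    using assms unfolding fin_functional_def by blast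
  have "fin_functional V (\<lambda>f. \<Sum>x\<in>P. c x * T f x)"
    using assms P by (intro fin_functional_sum fin_functional_scale) (auto simp: fin_operator_def)
  then show ?thesis
    using P assms(1) by (auto simp: fin_functional_def fin_operator_def)
qed

lemma fin_operatorI:
  "(\<And>f. f \<in> V \<Longrightarrow> T f \<in> W) \<Longrightarrow> (\<And>y. fin_functional V (\<lambda>f. T f y)) \<Longrightarrow> fin_operator V W T"
  by (simp add: fin_operator_def)

lemma fin_operator_compose:
  assumes "fin_operator U V T" "fin_operator V W S"
  shows "fin_operator U W (\<lambda>f. S (T f))"
proof (rule fin_operatorI)
  show "fin_functional U (\<lambda>f. S (T f) y)" for y
    using fin_functional_compose[OF assms(1), of "\<lambda>g. S g y"] assms(2)
    by (auto simp: fin_operator_def)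
qed (use assms in \<open>auto simp: fin_operator_def\<close>)

lemma fin_isoI:
  assumes "\<And>f. f \<in> V \<Longrightarrow> T f \<in> W" "\<And>y. fin_functional V (\<lambda>f. T f y)"
    and "\<And>g. g \<in> W \<Longrightarrow> S g \<in> V" "\<And>x. fin_functional W (\<lambda>g. S g x)"
    and "\<And>f. f \<in> V \<Longrightarrow> S (T f) = f" "\<And>g. g \<in> W \<Longrightarrow> T (S g) = g"
  shows "V \<simeq> W"
  unfolding fin_iso_def using assms by (intro exI[of _ T] exI[of _ S]) (auto simp: fin_operator_def)

lemma fin_isoE:
  assumes "V \<simeq> W"
  obtains T S where "fin_operator V W T" "fin_operator W V S"
    "\<And>f. f \<in> V \<Longrightarrow> S (T f) = f" "\<And>g. g \<in> W \<Longrightarrow> T (S g) = g"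
  using assms unfolding fin_iso_def by blast

lemma fin_iso_refl: "V \<simeq> V"
  by (rule fin_isoI[where T="\<lambda>f. f" and S="\<lambda>f. f"]) auto

lemma fin_iso_sym: "V \<simeq> W \<Longrightarrow> W \<simeq> V"
  unfolding fin_iso_def by blast

lemma fin_iso_trans [trans]:
  assumes "U \<simeq> V" "V \<simeq> W"
  shows "U \<simeq> W"
proof -
  obtain T S where 1: "fin_operator U V T" "fin_operator V U S"
    "\<And>f. f \<in> U \<Longrightarrow> S (T f) = f" "\<And>g. g \<in> V \<Longrightarrow> T (S g) = g"
    using fin_isoE[OF assms(1)] by blast
  obtain T' S' where 2: "fin_operator V W T'" "fin_operator W V S'"
    "\<And>f. f \<in> V \<Longrightarrow> S' (T' f) = f" "\<And>g. g \<in> W \<Longrightarrow> T' (S' g) = g"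
    using fin_isoE[OF assms(2)] by blast
  have "fin_operator U W (\<lambda>f. T' (T f))" "fin_operator W U (\<lambda>f. S (S' f))"
    using 1 2 by (auto intro: fin_operator_compose)
  moreover have "\<forall>f\<in>U. S (S' (T' (T f))) = f" "\<forall>g\<in>W. T' (T (S (S' g))) = g"
    using 1 2 by (auto simp: fin_operator_def)
  ultimately show ?thesis
    unfolding fin_iso_def
    by (intro exI[of _ "\<lambda>f. T' (T f)"] exI[of _ "\<lambda>f. S (S' f)"]) auto
qed

subsection \<open>Products\<close>

definition prod_space :: "('a \<Rightarrow> real) set \<Rightarrow> ('b \<Rightarrow> real) set \<Rightarrow> ('a + 'b \<Rightarrow> real) set"
    (infixr \<open>\<otimes>\<^sub>f\<close> 65) where
  "V \<otimes>\<^sub>f W = {h. (\<lambda>x. h (Inl x)) \<in> V \<and> (\<lambda>y. h (Inr y)) \<in> W}"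

lemma prod_space_iff: "h \<in> V \<otimes>\<^sub>f W \<longleftrightarrow> (\<lambda>x. h (Inl x)) \<in> V \<and> (\<lambda>y. h (Inr y)) \<in> W"
  by (simp add: prod_space_def)

lemma fin_operator_Inl: "fin_operator (V \<otimes>\<^sub>f W) V (\<lambda>h x. h (Inl x))"
  and fin_operator_Inr: "fin_operator (V \<otimes>\<^sub>f W) W (\<lambda>h x. h (Inr x))"
  by (auto simp: fin_operator_def prod_space_iff)

lemma fin_functional_case_sum:
  assumes "\<And>x. fin_functional V (\<lambda>f. T f x)" "\<And>y. fin_functional V (\<lambda>f. S f y)"
  shows "fin_functional V (\<lambda>f. case z of Inl x \<Rightarrow> T f x | Inr y \<Rightarrow> S f y)"
  using assms by (cases z) auto

lemma fin_iso_prod_cong: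
  assumes "V \<simeq> V'" "W \<simeq> W'"
  shows "V \<otimes>\<^sub>f W \<simeq> V' \<otimes>\<^sub>f W'"
proof -
  obtain T S where 1: "fin_operator V V' T" "fin_operator V' V S"
    "\<And>f. f \<in> V \<Longrightarrow> S (T f) = f" "\<And>g. g \<in> V' \<Longrightarrow> T (S g) = g"
    using fin_isoE[OF assms(1)] by blast
  obtain T' S' where 2: "fin_operator W W' T'" "fin_operator W' W S'"
    "\<And>f. f \<in> W \<Longrightarrow> S' (T' f) = f" "\<And>g. g \<in> W' \<Longrightarrow> T' (S' g) = g"
    using fin_isoE[OF assms(2)] by blast
  show ?thesis
  proof (rule fin_isoI[where
        T="\<lambda>h z. case z of Inl x \<Rightarrow> T (\<lambda>x. h (Inl x)) x | Inr y \<Rightarrow> T' (\<lambda>y. h (Inr y)) y" and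
        S="\<lambda>h z. case z of Inl x \<Rightarrow> S (\<lambda>x. h (Inl x)) x | Inr y \<Rightarrow> S' (\<lambda>y. h (Inr y)) y"])
    show "fin_functional (V \<otimes>\<^sub>f W)
      (\<lambda>h. case z of Inl x \<Rightarrow> T (\<lambda>x. h (Inl x)) x | Inr y \<Rightarrow> T' (\<lambda>y. h (Inr y)) y)" for z
    proof (rule fin_functional_case_sum)
      show "fin_functional (V \<otimes>\<^sub>f W) (\<lambda>h. T (\<lambda>x. h (Inl x)) x)" for x
        by (rule fin_functional_compose[OF fin_operator_Inl]) (use 1 in \<open>simp add: fin_operator_def\<close>)
      show "fin_functional (V \<otimes>\<^sub>f W) (\<lambda>h. T' (\<lambda>x. h (Inr x)) x)" for x
        by (rule fin_functional_compose[OF fin_operator_Inr]) (use 2 in \<open>simp add: fin_operator_def\<close>)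
    qed
    show "fin_functional (V' \<otimes>\<^sub>f W')
      (\<lambda>h. case z of Inl x \<Rightarrow> S (\<lambda>x. h (Inl x)) x | Inr y \<Rightarrow> S' (\<lambda>y. h (Inr y)) y)" for z
    proof (rule fin_functional_case_sum)
      show "fin_functional (V' \<otimes>\<^sub>f W') (\<lambda>h. S (\<lambda>x. h (Inl x)) x)" for x
        by (rule fin_functional_compose[OF fin_operator_Inl]) (use 1 in \<open>simp add: fin_operator_def\<close>)
      show "fin_functional (V' \<otimes>\<^sub>f W') (\<lambda>h. S' (\<lambda>x. h (Inr x)) x)" for x
        by (rule fin_functional_compose[OF fin_operator_Inr]) (use 2 in \<open>simp add: fin_operator_def\<close>)
    qed
  qed (use 1 2 in \<open>auto simp: fin_operator_def prod_space_iff fun_eq_iff split: sum.splits\<close>)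
qed

lemma fin_iso_prod_comm: "V \<otimes>\<^sub>f W \<simeq> W \<otimes>\<^sub>f V"
  by (rule fin_isoI[where T="\<lambda>h z. case z of Inl x \<Rightarrow> h (Inr x) | Inr x \<Rightarrow> h (Inl x)" and
        S="\<lambda>h z. case z of Inl x \<Rightarrow> h (Inr x) | Inr x \<Rightarrow> h (Inl x)"])
     (auto intro!: fin_functional_case_sum simp: prod_space_iff fun_eq_iff split: sum.splits)

lemma fin_iso_prod_assoc: "(U \<otimes>\<^sub>f V) \<otimes>\<^sub>f W \<simeq> U \<otimes>\<^sub>f (V \<otimes>\<^sub>f W)"
  by (rule fin_isoI[where
        T="\<lambda>h z. case z of Inl x \<Rightarrow> h (Inl (Inl x)) | Inr y \<Rightarrow>
             (case y of Inl x \<Rightarrow> h (Inl (Inr x)) | Inr x \<Rightarrow> h (Inr x))" and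
        S="\<lambda>h z. case z of Inr x \<Rightarrow> h (Inr (Inr x)) | Inl y \<Rightarrow>
             (case y of Inl x \<Rightarrow> h (Inl x) | Inr x \<Rightarrow> h (Inr (Inl x)))"])
     (auto intro!: fin_functional_case_sum simp: prod_space_iff fun_eq_iff split: sum.splits)

text \<open>The composition of \<open>R\<close> and \<open>E\<close> is a projection, whose kernel is that of \<open>R\<close>.\<close>

lemma fin_iso_complement:
  fixes V :: "('a \<Rightarrow> real) set" and W :: "('b \<Rightarrow> real) set"
  assumes R: "fin_operator V W R" and E: "fin_operator W V E"
    and RE: "\<And>g. g \<in> W \<Longrightarrow> R (E g) = g"
    and add: "\<And>f g. f \<in> V \<Longrightarrow> g \<in> V \<Longrightarrow> (\<lambda>x. f x + g x) \<in> V"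
    and diff: "\<And>f g. f \<in> V \<Longrightarrow> g \<in> V \<Longrightarrow> (\<lambda>x. f x - g x) \<in> V"
  shows "V \<simeq> W \<otimes>\<^sub>f {f \<in> V. R f = (\<lambda>_. 0)}"
proof -
  have R_add: "R (\<lambda>x. f x + g x) = (\<lambda>y. R f y + R g y)" if "f \<in> V" "g \<in> V" for f g
  proof
    fix y
    obtain P c where P: "\<forall>f\<in>V. R f y = (\<Sum>x\<in>P. c x * f x)"
      using R unfolding fin_operator_def fin_functional_def by blast
    then show "R (\<lambda>x. f x + g x) y = R f y + R g y"
      using that add by (simp add: sum.distrib distrib_left)
  qed
  have R_diff: "R (\<lambda>x. f x - g x) = (\<lambda>y. R f y - R g y)" if "f \<in> V" "g \<in> V" for f g
  proof
    fix y
    obtain P c where P: "\<forall>f\<in>V. R f y = (\<Sum>x\<in>P. c x * f x)"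
      using R unfolding fin_operator_def fin_functional_def by blast
    then show "R (\<lambda>x. f x - g x) y = R f y - R g y"
      using that diff by (simp add: sum_subtractf right_diff_distrib)
  qed
  have ER: "fin_operator V V (\<lambda>f. E (R f))"
    using R E by (rule fin_operator_compose)
  show ?thesis
  proof (rule fin_isoI[where
        T="\<lambda>f z. case z of Inl y \<Rightarrow> R f y | Inr x \<Rightarrow> f x - E (R f) x" and
        S="\<lambda>h x. E (\<lambda>y. h (Inl y)) x + h (Inr x)"])
    fix f assume f: "f \<in> V"
    then show "(\<lambda>z. case z of Inl y \<Rightarrow> R f y | Inr x \<Rightarrow> f x - E (R f) x)
                 \<in> W \<otimes>\<^sub>f {f \<in> V. R f = (\<lambda>_. 0)}"
      using R E ER RE diff by (auto simp: prod_space_iff fin_operator_def R_diff)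
  next
    fix z
    show "fin_functional V (\<lambda>f. case z of Inl y \<Rightarrow> R f y | Inr x \<Rightarrow> f x - E (R f) x)"
      using R ER by (intro fin_functional_case_sum fin_functional_diff) (auto simp: fin_operator_def)
  next
    fix h assume "h \<in> W \<otimes>\<^sub>f {f \<in> V. R f = (\<lambda>_. 0)}"
    then have h: "(\<lambda>y. h (Inl y)) \<in> W" "(\<lambda>x. h (Inr x)) \<in> V" "R (\<lambda>x. h (Inr x)) = (\<lambda>_. 0)"
      by (auto simp: prod_space_iff)
    have EV: "E (\<lambda>y. h (Inl y)) \<in> V"
      using h E by (auto simp: fin_operator_def)
    then show "(\<lambda>x. E (\<lambda>y. h (Inl y)) x + h (Inr x)) \<in> V"
      using h add[of "E (\<lambda>y. h (Inl y))" "\<lambda>x. h (Inr x)"] by auto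
    have Req: "R (\<lambda>x. E (\<lambda>y. h (Inl y)) x + h (Inr x)) = (\<lambda>y. h (Inl y))"
      using R_add[OF EV h(2)] RE[OF h(1)] h(3) by simp
    show "(\<lambda>z. case z of Inl y \<Rightarrow> R (\<lambda>x. E (\<lambda>y. h (Inl y)) x + h (Inr x)) y
        | Inr x \<Rightarrow> E (\<lambda>y. h (Inl y)) x + h (Inr x) - E (R (\<lambda>x. E (\<lambda>y. h (Inl y)) x + h (Inr x))) x) = h"
      unfolding Req by (auto simp: fun_eq_iff split: sum.splits)
  next
    fix x
    show "fin_functional (W \<otimes>\<^sub>f {f \<in> V. R f = (\<lambda>_. 0)}) (\<lambda>h. E (\<lambda>y. h (Inl y)) x + h (Inr x))"
      using E by (intro fin_functional_add fin_functional_eval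
            fin_functional_compose[OF fin_operator_Inl, where \<phi>="\<lambda>g. E g x"])
         (auto simp: fin_operator_def)
  qed (auto simp: fun_eq_iff)
qed

subsection \<open>Sums of null sequences\<close>

text \<open>
  Functions on countably many pieces whose supremum norms on the pieces tend to \<open>0\<close>: what
  continuous functions look like on the gaps of a closed subset on which they vanish.
\<close>

definition c0_sum :: "'i set \<Rightarrow> ('a \<Rightarrow> real) set \<Rightarrow> ('i \<times> 'a \<Rightarrow> real) set" where
  "c0_sum N W = {h. (\<forall>i\<in>N. (\<lambda>x. h (i, x)) \<in> W) \<and> (\<forall>i x. i \<notin> N \<longrightarrow> h (i, x) = 0) \<and>
                    (\<forall>\<epsilon>>0. finite {i \<in> N. \<exists>x. \<epsilon> < \<bar>h (i, x)\<bar>})}"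

lemma c0_sumI:
  assumes "\<And>i. i \<in> N \<Longrightarrow> (\<lambda>x. h (i, x)) \<in> W" "\<And>i x. i \<notin> N \<Longrightarrow> h (i, x) = 0"
    "\<And>\<epsilon>. 0 < \<epsilon> \<Longrightarrow> finite {i \<in> N. \<exists>x. \<epsilon> < \<bar>h (i, x)\<bar>}"
  shows "h \<in> c0_sum N W"
  using assms by (simp add: c0_sum_def)

lemma c0_sumD:
  assumes "h \<in> c0_sum N W"
  shows "\<And>i. i \<in> N \<Longrightarrow> (\<lambda>x. h (i, x)) \<in> W" "\<And>i x. i \<notin> N \<Longrightarrow> h (i, x) = 0"
    "\<And>\<epsilon>. 0 < \<epsilon> \<Longrightarrow> finite {i \<in> N. \<exists>x. \<epsilon> < \<bar>h (i, x)\<bar>}"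
  using assms by (auto simp: c0_sum_def)

lemma c0_sum_reindex_aux:
  assumes p: "bij_betw p N M" and h: "h \<in> c0_sum M W"
  shows "(\<lambda>(i, x). if i \<in> N then h (p i, x) else 0) \<in> c0_sum N W"
proof (rule c0_sumI)
  fix \<epsilon> :: real assume "0 < \<epsilon>"
  have "{i \<in> N. \<exists>x. \<epsilon> < \<bar>case (i, x) of (i, x) \<Rightarrow> if i \<in> N then h (p i, x) else 0\<bar>}
      \<subseteq> {i \<in> N. p i \<in> {j \<in> M. \<exists>x. \<epsilon> < \<bar>h (j, x)\<bar>}}"
    using p by (auto simp: bij_betw_def)
  moreover have "finite {i \<in> N. p i \<in> {j \<in> M. \<exists>x. \<epsilon> < \<bar>h (j, x)\<bar>}}"
    using p c0_sumD(3)[OF h \<open>0 < \<epsilon>\<close>]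
    by (intro finite_inverse_image_gen) (auto simp: bij_betw_def inj_on_def)
  ultimately show "finite {i \<in> N. \<exists>x. \<epsilon> < \<bar>case (i, x) of (i, x) \<Rightarrow> if i \<in> N then h (p i, x) else 0\<bar>}"
    using finite_subset by blast
qed (use p c0_sumD(1)[OF h] in \<open>auto simp: bij_betw_def\<close>)

lemma c0_sum_reindex:
  assumes p: "bij_betw p N M"
  shows "c0_sum N W \<simeq> c0_sum M W"
proof (rule fin_isoI[where
      T="\<lambda>h (j, x). if j \<in> M then h (inv_into N p j, x) else 0" and
      S="\<lambda>h (i, x). if i \<in> N then h (p i, x) else 0"])
  show "(\<lambda>(j, x). if j \<in> M then h (inv_into N p j, x) else 0) \<in> c0_sum M W" if "h \<in> c0_sum N W" for h
    using c0_sum_reindex_aux[OF bij_betw_inv_into[OF p] that] .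
  show "(\<lambda>(i, x). if i \<in> N then h (p i, x) else 0) \<in> c0_sum N W" if "h \<in> c0_sum M W" for h
    using c0_sum_reindex_aux[OF p that] .
  show "(\<lambda>(i, x). if i \<in> N then (\<lambda>(j, x). if j \<in> M then f (inv_into N p j, x) else 0) (p i, x) else 0) = f"
    if "f \<in> c0_sum N W" for f
    using p that by (auto simp: fun_eq_iff c0_sum_def bij_betw_def)
  show "(\<lambda>(j, x). if j \<in> M then (\<lambda>(i, x). if i \<in> N then g (p i, x) else 0) (inv_into N p j, x) else 0) = g"
    if "g \<in> c0_sum M W" for g
    using p that by (auto simp: fun_eq_iff c0_sum_def bij_betw_def inv_into_into f_inv_into_f)
qed (auto simp: split_beta)

lemma c0_sum_Plus: "c0_sum N W \<otimes>\<^sub>f c0_sum M W \<simeq> c0_sum (N <+> M) W"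
proof (rule fin_isoI[where
      T="\<lambda>h (k, x). case k of Inl i \<Rightarrow> h (Inl (i, x)) | Inr j \<Rightarrow> h (Inr (j, x))" and
      S="\<lambda>h z. case z of Inl (i, x) \<Rightarrow> h (Inl i, x) | Inr (j, x) \<Rightarrow> h (Inr j, x)"])
  fix h assume "h \<in> c0_sum N W \<otimes>\<^sub>f c0_sum M W"
  then have h: "(\<lambda>x. h (Inl x)) \<in> c0_sum N W" "(\<lambda>x. h (Inr x)) \<in> c0_sum M W"
    by (auto simp: prod_space_iff)
  let ?k = "\<lambda>(k, x). case k of Inl i \<Rightarrow> h (Inl (i, x)) | Inr j \<Rightarrow> h (Inr (j, x))"
  show "?k \<in> c0_sum (N <+> M) W"
  proof (rule c0_sumI)
    fix \<epsilon> :: real assume "0 < \<epsilon>"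
    have "{i \<in> N <+> M. \<exists>x. \<epsilon> < \<bar>?k (i, x)\<bar>} =
       Inl ` {i \<in> N. \<exists>x. \<epsilon> < \<bar>h (Inl (i, x))\<bar>} \<union> Inr ` {i \<in> M. \<exists>x. \<epsilon> < \<bar>h (Inr (i, x))\<bar>}"
      by (force simp: image_iff)
    then show "finite {i \<in> N <+> M. \<exists>x. \<epsilon> < \<bar>?k (i, x)\<bar>}"
      using c0_sumD(3)[OF h(1) \<open>0 < \<epsilon>\<close>] c0_sumD(3)[OF h(2) \<open>0 < \<epsilon>\<close>] by simp
  qed (use c0_sumD(1,2)[OF h(1)] c0_sumD(1,2)[OF h(2)] in \<open>(fastforce split: sum.splits)+\<close>)
next
  fix h assume h: "h \<in> c0_sum (N <+> M) W"
  have "finite {i \<in> N. \<exists>x. \<epsilon> < \<bar>h (Inl i, x)\<bar>}" "finite {i \<in> M. \<exists>x. \<epsilon> < \<bar>h (Inr i, x)\<bar>}"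
    if "0 < \<epsilon>" for \<epsilon>
  proof -
    have "finite (Inl -` {k \<in> N <+> M. \<exists>x. \<epsilon> < \<bar>h (k, x)\<bar>})"
      "finite (Inr -` {k \<in> N <+> M. \<exists>x. \<epsilon> < \<bar>h (k, x)\<bar>})"
      using c0_sumD(3)[OF h that] by (simp_all only: finite_vimageI inj_Inl inj_Inr)
    then show "finite {i \<in> N. \<exists>x. \<epsilon> < \<bar>h (Inl i, x)\<bar>}" "finite {i \<in> M. \<exists>x. \<epsilon> < \<bar>h (Inr i, x)\<bar>}"
      by (auto elim!: rev_finite_subset)
  qed
  then show "(\<lambda>z. case z of Inl (i, x) \<Rightarrow> h (Inl i, x) | Inr (j, x) \<Rightarrow> h (Inr j, x))
      \<in> c0_sum N W \<otimes>\<^sub>f c0_sum M W"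
    using c0_sumD(1)[OF h] by (auto simp: prod_space_iff intro!: c0_sumI c0_sumD(2)[OF h])
qed (auto simp: fun_eq_iff split_beta intro!: fin_functional_case_sum split: sum.splits)

lemma c0_sum_absorb: "c0_sum (UNIV :: nat set) W \<otimes>\<^sub>f c0_sum (UNIV :: nat set) W \<simeq> c0_sum (UNIV :: nat set) W"
proof -
  have "bij_betw sum_encode (UNIV <+> UNIV) UNIV"
    using bij_sum_encode by simp
  then show ?thesis
    using fin_iso_trans[OF c0_sum_Plus c0_sum_reindex] by blast
qed

section \<open>Compact sets of reals with split points\<close>

text \<open>
  \<open>split_C F A\<close> stands for the continuous functions on the line obtained from \<open>F\<close> by replacing
  each point of \<open>A\<close> by two adjacent points. Every point \<open>t\<close> of \<open>F\<close> carries a left copy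
  \<open>(t, False)\<close> and a right copy \<open>(t, True)\<close>, on which the functions agree unless \<open>t \<in> A\<close>; this
  redundancy makes the description symmetric under reversal of the order.
\<close>

definition split_C :: "real set \<Rightarrow> real set \<Rightarrow> (real \<times> bool \<Rightarrow> real) set" where
  "split_C F A = {f. (\<forall>t b. t \<notin> F \<longrightarrow> f (t, b) = 0) \<and>
     (\<forall>t\<in>F - A. f (t, False) = f (t, True)) \<and>
     (\<forall>t\<in>F. \<forall>\<epsilon>>0. \<exists>\<delta>>0. \<forall>s\<in>F. \<forall>b. t - \<delta> < s \<and> s < t \<longrightarrow> \<bar>f (s, b) - f (t, False)\<bar> < \<epsilon>) \<and>
     (\<forall>t\<in>F. \<forall>\<epsilon>>0. \<exists>\<delta>>0. \<forall>s\<in>F. \<forall>b. t < s \<and> s < t + \<delta> \<longrightarrow> \<bar>f (s, b) - f (t, True)\<bar> < \<epsilon>)}"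

lemma split_CI:
  assumes "\<And>t b. t \<notin> F \<Longrightarrow> f (t, b) = 0" "\<And>t. t \<in> F \<Longrightarrow> t \<notin> A \<Longrightarrow> f (t, False) = f (t, True)"
    "\<And>t \<epsilon>. t \<in> F \<Longrightarrow> 0 < \<epsilon> \<Longrightarrow> \<exists>\<delta>>0. \<forall>s\<in>F. \<forall>b. t - \<delta> < s \<and> s < t \<longrightarrow> \<bar>f (s, b) - f (t, False)\<bar> < \<epsilon>"
    "\<And>t \<epsilon>. t \<in> F \<Longrightarrow> 0 < \<epsilon> \<Longrightarrow> \<exists>\<delta>>0. \<forall>s\<in>F. \<forall>b. t < s \<and> s < t + \<delta> \<longrightarrow> \<bar>f (s, b) - f (t, True)\<bar> < \<epsilon>"
  shows "f \<in> split_C F A"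
  using assms by (simp add: split_C_def)

lemma split_C_0: "f \<in> split_C F A \<Longrightarrow> t \<notin> F \<Longrightarrow> f (t, b) = 0"
  and split_C_eq: "f \<in> split_C F A \<Longrightarrow> t \<in> F \<Longrightarrow> t \<notin> A \<Longrightarrow> f (t, b) = f (t, b')"
  by (cases b; cases b'; auto simp: split_C_def)+

lemma split_C_left:
  assumes "f \<in> split_C F A" "t \<in> F" "0 < \<epsilon>"
  obtains \<delta> where "0 < \<delta>"
    "\<And>s b. s \<in> F \<Longrightarrow> t - \<delta> < s \<Longrightarrow> s < t \<Longrightarrow> \<bar>f (s, b) - f (t, False)\<bar> < \<epsilon>"
proof -
  have "\<exists>\<delta>>0. \<forall>s\<in>F. \<forall>b. t - \<delta> < s \<and> s < t \<longrightarrow> \<bar>f (s, b) - f (t, False)\<bar> < \<epsilon>"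
    using assms by (simp add: split_C_def)
  then show ?thesis using that by blast
qed

lemma split_C_right:
  assumes "f \<in> split_C F A" "t \<in> F" "0 < \<epsilon>"
  obtains \<delta> where "0 < \<delta>"
    "\<And>s b. s \<in> F \<Longrightarrow> t < s \<Longrightarrow> s < t + \<delta> \<Longrightarrow> \<bar>f (s, b) - f (t, True)\<bar> < \<epsilon>"
proof -
  have "\<exists>\<delta>>0. \<forall>s\<in>F. \<forall>b. t < s \<and> s < t + \<delta> \<longrightarrow> \<bar>f (s, b) - f (t, True)\<bar> < \<epsilon>"
    using assms by (simp add: split_C_def)
  then show ?thesis using that by blast
qed

lemma split_C_linear:
  assumes f: "f \<in> split_C F A" and g: "g \<in> split_C F A"
  shows "(\<lambda>x. f x + c * g x) \<in> split_C F A"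
proof (rule split_CI)
  fix t \<epsilon> :: real assume t: "t \<in> F" and \<epsilon>: "0 < \<epsilon>"
  define \<eta> where "\<eta> = \<epsilon> / 2 / (1 + \<bar>c\<bar>)"
  have \<eta>: "0 < \<eta>" "\<bar>c\<bar> * \<eta> < \<epsilon> / 2"
    using \<epsilon> by (auto simp: \<eta>_def field_simps)
  have est: "\<bar>a' + c * b' - (a + c * b)\<bar> < \<epsilon>" if "\<bar>a' - a\<bar> < \<epsilon> / 2" "\<bar>b' - b\<bar> < \<eta>" for a a' b b'
  proof -
    have "\<bar>a' + c * b' - (a + c * b)\<bar> = \<bar>(a' - a) + c * (b' - b)\<bar>"
      by (simp add: algebra_simps)
    also have "\<dots> \<le> \<bar>a' - a\<bar> + \<bar>c\<bar> * \<bar>b' - b\<bar>"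
      by (metis abs_mult abs_triangle_ineq)
    also have "\<bar>c\<bar> * \<bar>b' - b\<bar> \<le> \<bar>c\<bar> * \<eta>"
      using that by (intro mult_left_mono) auto
    finally show ?thesis using that \<eta> by linarith
  qed
  have \<epsilon>2: "0 < \<epsilon> / 2" using \<epsilon> by simp
  obtain d1 where d1: "0 < d1"
    "\<And>s b. s \<in> F \<Longrightarrow> t - d1 < s \<Longrightarrow> s < t \<Longrightarrow> \<bar>f (s, b) - f (t, False)\<bar> < \<epsilon> / 2"
    using split_C_left[OF f t \<epsilon>2] by blast
  obtain d2 where d2: "0 < d2"
    "\<And>s b. s \<in> F \<Longrightarrow> t - d2 < s \<Longrightarrow> s < t \<Longrightarrow> \<bar>g (s, b) - g (t, False)\<bar> < \<eta>"
    using split_C_left[OF g t \<eta>(1)] by blast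
  show "\<exists>\<delta>>0. \<forall>s\<in>F. \<forall>b. t - \<delta> < s \<and> s < t \<longrightarrow>
      \<bar>f (s, b) + c * g (s, b) - (f (t, False) + c * g (t, False))\<bar> < \<epsilon>"
    using d1 d2 by (intro exI[of _ "min d1 d2"]) (auto intro!: est)
  obtain e1 where e1: "0 < e1"
    "\<And>s b. s \<in> F \<Longrightarrow> t < s \<Longrightarrow> s < t + e1 \<Longrightarrow> \<bar>f (s, b) - f (t, True)\<bar> < \<epsilon> / 2"
    using split_C_right[OF f t \<epsilon>2] by blast
  obtain e2 where e2: "0 < e2"
    "\<And>s b. s \<in> F \<Longrightarrow> t < s \<Longrightarrow> s < t + e2 \<Longrightarrow> \<bar>g (s, b) - g (t, True)\<bar> < \<eta>"
    using split_C_right[OF g t \<eta>(1)] by blast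
  show "\<exists>\<delta>>0. \<forall>s\<in>F. \<forall>b. t < s \<and> s < t + \<delta> \<longrightarrow>
      \<bar>f (s, b) + c * g (s, b) - (f (t, True) + c * g (t, True))\<bar> < \<epsilon>"
    using e1 e2 by (intro exI[of _ "min e1 e2"]) (auto intro!: est)
qed (use f g in \<open>auto simp: split_C_0 split_C_eq[of _ F A _ False True]\<close>)

lemma split_C_add: "f \<in> split_C F A \<Longrightarrow> g \<in> split_C F A \<Longrightarrow> (\<lambda>x. f x + g x) \<in> split_C F A"
  using split_C_linear[of f F A g 1] by simp

lemma split_C_diff: "f \<in> split_C F A \<Longrightarrow> g \<in> split_C F A \<Longrightarrow> (\<lambda>x. f x - g x) \<in> split_C F A"
  using split_C_linear[of f F A g "-1"] by simp

lemma split_C_continuous: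
  assumes "continuous_on F \<phi>"
  shows "(\<lambda>(t, b). if t \<in> F then \<phi> t else 0) \<in> split_C F A"
proof (rule split_CI)
  fix t \<epsilon> :: real assume t: "t \<in> F" and \<epsilon>: "0 < \<epsilon>"
  obtain d where d: "0 < d" "\<And>s. s \<in> F \<Longrightarrow> \<bar>s - t\<bar> < d \<Longrightarrow> \<bar>\<phi> s - \<phi> t\<bar> < \<epsilon>"
    using assms t \<epsilon> unfolding continuous_on_iff dist_real_def by blast
  show "\<exists>\<delta>>0. \<forall>s\<in>F. \<forall>b. t - \<delta> < s \<and> s < t \<longrightarrow> \<bar>(case (s, b) of (t, b) \<Rightarrow> if t \<in> F then \<phi> t else 0)
        - (case (t, False) of (t, b) \<Rightarrow> if t \<in> F then \<phi> t else 0)\<bar> < \<epsilon>"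
    using d t by (intro exI[of _ d]) auto
  show "\<exists>\<delta>>0. \<forall>s\<in>F. \<forall>b. t < s \<and> s < t + \<delta> \<longrightarrow> \<bar>(case (s, b) of (t, b) \<Rightarrow> if t \<in> F then \<phi> t else 0)
        - (case (t, True) of (t, b) \<Rightarrow> if t \<in> F then \<phi> t else 0)\<bar> < \<epsilon>"
    using d t by (intro exI[of _ d]) auto
qed auto

subsection \<open>Composition with monotone maps\<close>

text \<open>
  Monotone continuous maps between two such lines. Approaching a point from one side, the image
  either is already there or approaches it from the same side through other reals.
\<close>

definition split_map ::
    "real set \<Rightarrow> real set \<Rightarrow> real set \<Rightarrow> real set \<Rightarrow> (real \<times> bool \<Rightarrow> real \<times> bool) \<Rightarrow> bool" where
  "split_map F A F' A' \<kappa> \<longleftrightarrow>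
     (\<forall>t\<in>F. \<forall>b. fst (\<kappa> (t, b)) \<in> F') \<and>
     (\<forall>t\<in>F - A. \<kappa> (t, False) = \<kappa> (t, True) \<or>
        fst (\<kappa> (t, False)) = fst (\<kappa> (t, True)) \<and> fst (\<kappa> (t, False)) \<notin> A') \<and>
     (\<forall>t\<in>F. \<forall>\<eta>>0. \<exists>\<delta>>0. \<forall>s\<in>F. \<forall>b. t - \<delta> < s \<and> s < t \<longrightarrow>
        \<kappa> (s, b) = \<kappa> (t, False) \<or> (\<not> snd (\<kappa> (t, False)) \<and>
          fst (\<kappa> (t, False)) - \<eta> < fst (\<kappa> (s, b)) \<and> fst (\<kappa> (s, b)) < fst (\<kappa> (t, False)))) \<and>
     (\<forall>t\<in>F. \<forall>\<eta>>0. \<exists>\<delta>>0. \<forall>s\<in>F. \<forall>b. t < s \<and> s < t + \<delta> \<longrightarrow>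
        \<kappa> (s, b) = \<kappa> (t, True) \<or> (snd (\<kappa> (t, True)) \<and>
          fst (\<kappa> (t, True)) < fst (\<kappa> (s, b)) \<and> fst (\<kappa> (s, b)) < fst (\<kappa> (t, True)) + \<eta>))"

definition pullback :: "real set \<Rightarrow> (real \<times> bool \<Rightarrow> real \<times> bool) \<Rightarrow> (real \<times> bool \<Rightarrow> real) \<Rightarrow> real \<times> bool \<Rightarrow> real"
  where "pullback F \<kappa> f = (\<lambda>x. if fst x \<in> F then f (\<kappa> x) else 0)"

lemma split_map_left:
  assumes "split_map F A F' A' \<kappa>" "t \<in> F" "0 < \<eta>"
  shows "\<exists>\<delta>>0. \<forall>s\<in>F. \<forall>b. t - \<delta> < s \<and> s < t \<longrightarrow>
        \<kappa> (s, b) = \<kappa> (t, False) \<or> (\<not> snd (\<kappa> (t, False)) \<and>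
          fst (\<kappa> (t, False)) - \<eta> < fst (\<kappa> (s, b)) \<and> fst (\<kappa> (s, b)) < fst (\<kappa> (t, False)))"
  using assms by (simp add: split_map_def)

lemma split_map_right:
  assumes "split_map F A F' A' \<kappa>" "t \<in> F" "0 < \<eta>"
  shows "\<exists>\<delta>>0. \<forall>s\<in>F. \<forall>b. t < s \<and> s < t + \<delta> \<longrightarrow>
        \<kappa> (s, b) = \<kappa> (t, True) \<or> (snd (\<kappa> (t, True)) \<and>
          fst (\<kappa> (t, True)) < fst (\<kappa> (s, b)) \<and> fst (\<kappa> (s, b)) < fst (\<kappa> (t, True)) + \<eta>)"
  using assms by (simp add: split_map_def)

lemma pullback_in_split_C:
  assumes \<kappa>: "split_map F A F' A' \<kappa>" and f: "f \<in> split_C F' A'"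
  shows "pullback F \<kappa> f \<in> split_C F A"
proof (rule split_CI)
  fix t assume t: "t \<in> F" "t \<notin> A"
  then have in': "fst (\<kappa> (t, False)) \<in> F'"
    and "\<kappa> (t, False) = \<kappa> (t, True) \<or>
        fst (\<kappa> (t, False)) = fst (\<kappa> (t, True)) \<and> fst (\<kappa> (t, False)) \<notin> A'"
    using \<kappa> unfolding split_map_def by blast+
  then show "pullback F \<kappa> f (t, False) = pullback F \<kappa> f (t, True)"
    using split_C_eq[OF f in'] t by (auto simp: pullback_def) (metis prod.collapse)
next
  fix t \<epsilon> :: real assume t: "t \<in> F" and \<epsilon>: "0 < \<epsilon>"
  have in': "fst (\<kappa> (t, b)) \<in> F'" if "t \<in> F" for b t
    using \<kappa> that unfolding split_map_def by blast
  obtain \<eta> where \<eta>: "0 < \<eta>" "\<And>s b. s \<in> F' \<Longrightarrow> fst (\<kappa> (t, False)) - \<eta> < s \<Longrightarrow> s < fst (\<kappa> (t, False)) \<Longrightarrow>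
      \<bar>f (s, b) - f (fst (\<kappa> (t, False)), False)\<bar> < \<epsilon>"
    using split_C_left[OF f in'[OF t] \<epsilon>] by blast
  obtain \<delta> where \<delta>: "0 < \<delta>" "\<forall>s\<in>F. \<forall>b. t - \<delta> < s \<and> s < t \<longrightarrow>
        \<kappa> (s, b) = \<kappa> (t, False) \<or> (\<not> snd (\<kappa> (t, False)) \<and>
          fst (\<kappa> (t, False)) - \<eta> < fst (\<kappa> (s, b)) \<and> fst (\<kappa> (s, b)) < fst (\<kappa> (t, False)))"
    using split_map_left[OF \<kappa> t \<eta>(1)] by blast
  have "\<bar>f (\<kappa> (s, b)) - f (\<kappa> (t, False))\<bar> < \<epsilon>" if s: "s \<in> F" "t - \<delta> < s" "s < t" for s b
  proof -
    consider "\<kappa> (s, b) = \<kappa> (t, False)" | "\<not> snd (\<kappa> (t, False))"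
        "fst (\<kappa> (t, False)) - \<eta> < fst (\<kappa> (s, b))" "fst (\<kappa> (s, b)) < fst (\<kappa> (t, False))"
      using \<delta>(2) s by blast
    then show ?thesis
    proof cases
      case 2
      then have "\<kappa> (t, False) = (fst (\<kappa> (t, False)), False)"
        by (metis prod.collapse)
      then show ?thesis
        using \<eta>(2)[OF in'[OF s(1)] 2(2,3), of "snd (\<kappa> (s, b))"] by simp
    qed (use \<epsilon> in simp)
  qed
  then show "\<exists>\<delta>>0. \<forall>s\<in>F. \<forall>b. t - \<delta> < s \<and> s < t \<longrightarrow> \<bar>pullback F \<kappa> f (s, b) - pullback F \<kappa> f (t, False)\<bar> < \<epsilon>"
    using \<delta>(1) t by (intro exI[of _ \<delta>]) (auto simp: pullback_def)
next
  fix t \<epsilon> :: real assume t: "t \<in> F" and \<epsilon>: "0 < \<epsilon>"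
  have in': "fst (\<kappa> (t, b)) \<in> F'" if "t \<in> F" for b t
    using \<kappa> that unfolding split_map_def by blast
  obtain \<eta> where \<eta>: "0 < \<eta>" "\<And>s b. s \<in> F' \<Longrightarrow> fst (\<kappa> (t, True)) < s \<Longrightarrow> s < fst (\<kappa> (t, True)) + \<eta> \<Longrightarrow>
      \<bar>f (s, b) - f (fst (\<kappa> (t, True)), True)\<bar> < \<epsilon>"
    using split_C_right[OF f in'[OF t] \<epsilon>] by blast
  obtain \<delta> where \<delta>: "0 < \<delta>" "\<forall>s\<in>F. \<forall>b. t < s \<and> s < t + \<delta> \<longrightarrow>
        \<kappa> (s, b) = \<kappa> (t, True) \<or> (snd (\<kappa> (t, True)) \<and>
          fst (\<kappa> (t, True)) < fst (\<kappa> (s, b)) \<and> fst (\<kappa> (s, b)) < fst (\<kappa> (t, True)) + \<eta>)"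
    using split_map_right[OF \<kappa> t \<eta>(1)] by blast
  have "\<bar>f (\<kappa> (s, b)) - f (\<kappa> (t, True))\<bar> < \<epsilon>" if s: "s \<in> F" "t < s" "s < t + \<delta>" for s b
  proof -
    consider "\<kappa> (s, b) = \<kappa> (t, True)" | "snd (\<kappa> (t, True))"
        "fst (\<kappa> (t, True)) < fst (\<kappa> (s, b))" "fst (\<kappa> (s, b)) < fst (\<kappa> (t, True)) + \<eta>"
      using \<delta>(2) s by blast
    then show ?thesis
    proof cases
      case 2
      then have "\<kappa> (t, True) = (fst (\<kappa> (t, True)), True)"
        by (metis prod.collapse)
      then show ?thesis
        using \<eta>(2)[OF in'[OF s(1)] 2(2,3), of "snd (\<kappa> (s, b))"] by simp
    qed (use \<epsilon> in simp)
  qed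
  then show "\<exists>\<delta>>0. \<forall>s\<in>F. \<forall>b. t < s \<and> s < t + \<delta> \<longrightarrow> \<bar>pullback F \<kappa> f (s, b) - pullback F \<kappa> f (t, True)\<bar> < \<epsilon>"
    using \<delta>(1) t by (intro exI[of _ \<delta>]) (auto simp: pullback_def)
qed (auto simp: pullback_def)

lemma fin_operator_pullback:
  assumes "split_map F A F' A' \<kappa>"
  shows "fin_operator (split_C F' A') (split_C F A) (pullback F \<kappa>)"
  using pullback_in_split_C[OF assms] by (auto simp: fin_operator_def) (auto simp: pullback_def)

lemma split_map_strict_mono:
  assumes "strict_mono_on F \<phi>" "continuous_on F \<phi>" "\<phi> ` F \<subseteq> F'"
    and "\<And>t. t \<in> F \<Longrightarrow> t \<notin> A \<Longrightarrow> \<phi> t \<notin> A'"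
  shows "split_map F A F' A' (\<lambda>(t, b). (\<phi> t, b))"
proof -
  have "\<exists>d>0. \<forall>s\<in>F. \<bar>s - t\<bar> < d \<longrightarrow> \<bar>\<phi> s - \<phi> t\<bar> < \<eta>" if "t \<in> F" "0 < \<eta>" for t \<eta>
    using assms(2) that unfolding continuous_on_iff dist_real_def by blast
  then have *: "\<exists>d>0. \<forall>s\<in>F. t - d < s \<and> s < t \<longrightarrow> \<phi> t - \<eta> < \<phi> s \<and> \<phi> s < \<phi> t"
    "\<exists>d>0. \<forall>s\<in>F. t < s \<and> s < t + d \<longrightarrow> \<phi> t < \<phi> s \<and> \<phi> s < \<phi> t + \<eta>" if "t \<in> F" "0 < \<eta>" for t \<eta>
    using that assms(1) unfolding strict_mono_on_def
    by (smt (verit, ccfv_threshold))+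
  show ?thesis
    unfolding split_map_def
  proof (intro conjI ballI allI impI)
    fix t \<eta> :: real assume "t \<in> F" "0 < \<eta>"
    from *(1)[OF this] obtain d where "d > 0" "\<forall>s\<in>F. t - d < s \<and> s < t \<longrightarrow> \<phi> t - \<eta> < \<phi> s \<and> \<phi> s < \<phi> t" by blast
    then show "\<exists>\<delta>>0. \<forall>s\<in>F. \<forall>b. t - \<delta> < s \<and> s < t \<longrightarrow>
        (case (s, b) of (t, b) \<Rightarrow> (\<phi> t, b)) = (case (t, False) of (t, b) \<Rightarrow> (\<phi> t, b)) \<or>
        \<not> snd (case (t, False) of (t, b) \<Rightarrow> (\<phi> t, b)) \<and>
        fst (case (t, False) of (t, b) \<Rightarrow> (\<phi> t, b)) - \<eta> < fst (case (s, b) of (t, b) \<Rightarrow> (\<phi> t, b)) \<and>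
        fst (case (s, b) of (t, b) \<Rightarrow> (\<phi> t, b)) < fst (case (t, False) of (t, b) \<Rightarrow> (\<phi> t, b))"
      by (intro exI[of _ d]) simp
  next
    fix t \<eta> :: real assume "t \<in> F" "0 < \<eta>"
    from *(2)[OF this] obtain d where "d > 0" "\<forall>s\<in>F. t < s \<and> s < t + d \<longrightarrow> \<phi> t < \<phi> s \<and> \<phi> s < \<phi> t + \<eta>" by blast
    then show "\<exists>\<delta>>0. \<forall>s\<in>F. \<forall>b. t < s \<and> s < t + \<delta> \<longrightarrow>
        (case (s, b) of (t, b) \<Rightarrow> (\<phi> t, b)) = (case (t, True) of (t, b) \<Rightarrow> (\<phi> t, b)) \<or>
        snd (case (t, True) of (t, b) \<Rightarrow> (\<phi> t, b)) \<and>
        fst (case (t, True) of (t, b) \<Rightarrow> (\<phi> t, b)) < fst (case (s, b) of (t, b) \<Rightarrow> (\<phi> t, b)) \<and>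
        fst (case (s, b) of (t, b) \<Rightarrow> (\<phi> t, b)) < fst (case (t, True) of (t, b) \<Rightarrow> (\<phi> t, b)) + \<eta>"
      by (intro exI[of _ d]) simp
  qed (use assms(3,4) in auto)
qed

lemma split_map_restrict:
  assumes "F' \<subseteq> F" "A \<inter> F' \<subseteq> A'"
  shows "split_map F' A' F A (\<lambda>x. x)"
proof -
  have "split_map F' A' F A (\<lambda>(t, b). (t, b))"
    using assms by (intro split_map_strict_mono) (auto simp: strict_mono_on_def)
  then show ?thesis by (simp add: id_def)
qed

lemma split_C_reparam:
  assumes F: "compact F" and \<phi>: "strict_mono_on F \<phi>" "continuous_on F \<phi>" and "A \<subseteq> F"
  shows "split_C (\<phi> ` F) (\<phi> ` A) \<simeq> split_C F A"
proof -
  define \<psi> where "\<psi> = the_inv_into F \<phi>"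
  have inj: "inj_on \<phi> F"
    using \<phi>(1) by (rule strict_mono_on_imp_inj_on)
  have \<psi>: "\<psi> (\<phi> t) = t" if "t \<in> F" for t
    using inj that by (simp add: \<psi>_def the_inv_into_f_f)
  have "continuous_on (\<phi> ` F) \<psi>"
    using F \<phi>(2) \<psi> by (intro continuous_on_inv) auto
  moreover have "strict_mono_on (\<phi> ` F) \<psi>"
    using \<phi>(1) \<psi> unfolding strict_mono_on_def
    by (metis (no_types, opaque_lifting) imageE linorder_less_linear not_less_iff_gr_or_eq)
  ultimately have \<kappa>': "split_map (\<phi> ` F) (\<phi> ` A) F A (\<lambda>(t, b). (\<psi> t, b))"
    using \<psi> by (intro split_map_strict_mono) auto
  have \<kappa>: "split_map F A (\<phi> ` F) (\<phi> ` A) (\<lambda>(t, b). (\<phi> t, b))"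
    using \<phi> inj \<open>A \<subseteq> F\<close> by (intro split_map_strict_mono) (auto simp: inj_on_def)
  show ?thesis
  proof (rule fin_isoI)
    show "pullback F (\<lambda>(t, b). (\<phi> t, b)) f \<in> split_C F A" if "f \<in> split_C (\<phi> ` F) (\<phi> ` A)" for f
      using pullback_in_split_C[OF \<kappa> that] .
    show "pullback (\<phi> ` F) (\<lambda>(t, b). (\<psi> t, b)) f \<in> split_C (\<phi> ` F) (\<phi> ` A)" if "f \<in> split_C F A" for f
      using pullback_in_split_C[OF \<kappa>' that] .
  qed (use \<psi> in \<open>auto simp: pullback_def fun_eq_iff split_C_0\<close>)
qed

lemma split_C_disjoint_union:
  assumes F1: "\<And>x. x \<in> F1 \<Longrightarrow> x < c" and F2: "\<And>x. x \<in> F2 \<Longrightarrow> c < x"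
  shows "split_C (F1 \<union> F2) A \<simeq> split_C F1 A \<otimes>\<^sub>f split_C F2 A"
proof (rule fin_isoI[where
      T="\<lambda>f z. case z of Inl x \<Rightarrow> pullback F1 (\<lambda>x. x) f x | Inr x \<Rightarrow> pullback F2 (\<lambda>x. x) f x" and
      S="\<lambda>h x. if fst x < c then h (Inl x) else h (Inr x)"])
  fix f assume f: "f \<in> split_C (F1 \<union> F2) A"
  have "split_map F1 A (F1 \<union> F2) A (\<lambda>x. x)" "split_map F2 A (F1 \<union> F2) A (\<lambda>x. x)"
    by (auto intro: split_map_restrict)
  from this[THEN pullback_in_split_C, OF f]
  show "(\<lambda>z. case z of Inl x \<Rightarrow> pullback F1 (\<lambda>x. x) f x | Inr x \<Rightarrow> pullback F2 (\<lambda>x. x) f x)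
      \<in> split_C F1 A \<otimes>\<^sub>f split_C F2 A"
    by (simp add: prod_space_iff)
  show "(\<lambda>x. if fst x < c then case Inl x of Inl x \<Rightarrow> pullback F1 (\<lambda>x. x) f x | Inr x \<Rightarrow> pullback F2 (\<lambda>x. x) f x
      else case Inr x of Inl x \<Rightarrow> pullback F1 (\<lambda>x. x) f x | Inr x \<Rightarrow> pullback F2 (\<lambda>x. x) f x) = f"
    using f F1 F2 by (force simp: fun_eq_iff pullback_def split_C_0)
next
  fix h assume "h \<in> split_C F1 A \<otimes>\<^sub>f split_C F2 A"
  then have h: "(\<lambda>x. h (Inl x)) \<in> split_C F1 A" "(\<lambda>x. h (Inr x)) \<in> split_C F2 A"
    by (auto simp: prod_space_iff)
  show "(\<lambda>z. case z of
        Inl x \<Rightarrow> pullback F1 (\<lambda>x. x) (\<lambda>x. if fst x < c then h (Inl x) else h (Inr x)) x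
      | Inr x \<Rightarrow> pullback F2 (\<lambda>x. x) (\<lambda>x. if fst x < c then h (Inl x) else h (Inr x)) x) = h"
    using F1 F2 split_C_0[OF h(1)] split_C_0[OF h(2)]
    by (fastforce simp: fun_eq_iff pullback_def split: sum.splits)
  show "(\<lambda>x. if fst x < c then h (Inl x) else h (Inr x)) \<in> split_C (F1 \<union> F2) A"
  proof (rule split_CI)
    fix t \<epsilon> :: real assume t: "t \<in> F1 \<union> F2" and \<epsilon>: "0 < \<epsilon>"
    show "\<exists>\<delta>>0. \<forall>s\<in>F1 \<union> F2. \<forall>b. t - \<delta> < s \<and> s < t \<longrightarrow>
      \<bar>(if fst (s, b) < c then h (Inl (s, b)) else h (Inr (s, b)))
        - (if fst (t, False) < c then h (Inl (t, False)) else h (Inr (t, False)))\<bar> < \<epsilon>"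
    proof (cases "t < c")
      case True
      then have "t \<in> F1" using t F2 by force
      from split_C_left[OF h(1) this \<epsilon>] obtain d where "0 < d"
        "\<And>s b. s \<in> F1 \<Longrightarrow> t - d < s \<Longrightarrow> s < t \<Longrightarrow> \<bar>h (Inl (s, b)) - h (Inl (t, False))\<bar> < \<epsilon>" by blast
      then show ?thesis using True F2 by (intro exI[of _ d]) force
    next
      case False
      then have t2: "t \<in> F2" using t F1 by force
      from split_C_left[OF h(2) this \<epsilon>] obtain d where "0 < d"
        "\<And>s b. s \<in> F2 \<Longrightarrow> t - d < s \<Longrightarrow> s < t \<Longrightarrow> \<bar>h (Inr (s, b)) - h (Inr (t, False))\<bar> < \<epsilon>" by blast
      then show ?thesis using F2[OF t2] F1 F2 by (intro exI[of _ "min d (t - c)"]) force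
    qed
    show "\<exists>\<delta>>0. \<forall>s\<in>F1 \<union> F2. \<forall>b. t < s \<and> s < t + \<delta> \<longrightarrow>
      \<bar>(if fst (s, b) < c then h (Inl (s, b)) else h (Inr (s, b)))
        - (if fst (t, True) < c then h (Inl (t, True)) else h (Inr (t, True)))\<bar> < \<epsilon>"
    proof (cases "t < c")
      case True
      then have t1: "t \<in> F1" using t F2 by force
      from split_C_right[OF h(1) this \<epsilon>] obtain d where "0 < d"
        "\<And>s b. s \<in> F1 \<Longrightarrow> t < s \<Longrightarrow> s < t + d \<Longrightarrow> \<bar>h (Inl (s, b)) - h (Inl (t, True))\<bar> < \<epsilon>" by blast
      then show ?thesis using F1[OF t1] F1 F2 by (intro exI[of _ "min d (c - t)"]) force
    next
      case False
      then have "t \<in> F2" using t F1 by force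
      from split_C_right[OF h(2) this \<epsilon>] obtain d where "0 < d"
        "\<And>s b. s \<in> F2 \<Longrightarrow> t < s \<Longrightarrow> s < t + d \<Longrightarrow> \<bar>h (Inr (s, b)) - h (Inr (t, True))\<bar> < \<epsilon>" by blast
      then show ?thesis using False F1 by (intro exI[of _ d]) force
    qed
  next
    fix t assume t: "t \<in> F1 \<union> F2" "t \<notin> A"
    then show "(if fst (t, False) < c then h (Inl (t, False)) else h (Inr (t, False))) =
        (if fst (t, True) < c then h (Inl (t, True)) else h (Inr (t, True)))"
      using split_C_eq[OF h(1), of t False True] split_C_eq[OF h(2), of t False True] F1 F2 by force
  qed (use split_C_0[OF h(1)] split_C_0[OF h(2)] in auto)
qed (auto intro!: fin_functional_case_sum fin_functional_if simp: pullback_def)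

section \<open>Filling the gaps of a closed set\<close>

text \<open>The bounded components of an open set, given by their end points.\<close>

definition gaps :: "real set \<Rightarrow> (real \<times> real) set" where
  "gaps U = {(u, v). u < v \<and> u \<notin> U \<and> v \<notin> U \<and> {u<..<v} \<subseteq> U}"

lemma gapsD:
  assumes "(u, v) \<in> gaps U"
  shows "u < v" "u \<notin> U" "v \<notin> U" "\<And>t. u < t \<Longrightarrow> t < v \<Longrightarrow> t \<in> U"
  using assms by (auto simp: gaps_def)

lemma gaps_exist:
  assumes "open U" "bounded U" "t \<in> U"
  obtains u v where "(u, v) \<in> gaps U" "u < t" "t < v"
proof -
  obtain a where a: "\<And>x. x \<in> U \<Longrightarrow> \<bar>x\<bar> \<le> a"
    using assms(2) unfolding bounded_real by blast
  define L R where "L = - U \<inter> {..t}" and "R = - U \<inter> {t..}"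
  have cl: "closed L" "closed R"
    using assms(1) by (auto simp: L_def R_def)
  have "- a - 1 \<notin> U" "a + 1 \<notin> U" "\<bar>t\<bar> \<le> a"
    using a[of "-a-1"] a[of "a+1"] a[OF assms(3)] by auto
  then have ne: "- a - 1 \<in> L" "a + 1 \<in> R"
    by (auto simp: L_def R_def)
  have bd: "bdd_above L" "bdd_below R"
    by (auto simp: L_def R_def intro: bdd_aboveI[of _ t] bdd_belowI[of _ t])
  have u: "Sup L \<in> L" and v: "Inf R \<in> R"
    using ne cl bd by (auto intro!: closed_contains_Sup closed_contains_Inf)
  have "x \<in> U" if "Sup L < x" "x < Inf R" for x
  proof (rule ccontr)
    assume "x \<notin> U"
    then have "x \<in> L \<or> x \<in> R" by (auto simp: L_def R_def)
    then show False
      using that cSup_upper[OF _ bd(1), of x] cInf_lower[OF _ bd(2), of x] by auto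
  qed
  moreover have "Sup L < t" "t < Inf R"
    using u v assms(3) by (auto simp: L_def R_def less_le)
  ultimately show thesis
    using u v by (intro that[of "Sup L" "Inf R"]) (auto simp: gaps_def L_def R_def)
qed

lemma gaps_unique:
  assumes "(u, v) \<in> gaps U" "(u', v') \<in> gaps U" "u < t" "t < v" "u' < t" "t < v'"
  shows "u = u' \<and> v = v'"
  using gapsD[OF assms(1)] gapsD[OF assms(2)] assms(3-6)
  by (smt (verit, ccfv_threshold))

lemma gaps_fst_unique:
  assumes "(u, v) \<in> gaps U" "(u, v') \<in> gaps U"
  shows "v = v'"
  using gapsD[OF assms(1)] gapsD[OF assms(2)] by (meson linorder_less_linear)

definition gap_of :: "real set \<Rightarrow> real \<Rightarrow> real \<times> real" where
  "gap_of U t = (THE (u, v). (u, v) \<in> gaps U \<and> u < t \<and> t < v)"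

lemma gap_of_eq:
  assumes "(u, v) \<in> gaps U" "u < t" "t < v"
  shows "gap_of U t = (u, v)"
  unfolding gap_of_def by (rule the_equality) (use assms gaps_unique in fastforce)+

lemma gaps_endpoint_mem:
  assumes "(u, v) \<in> gaps U" "U \<subseteq> F" "closed F"
  shows "u \<in> F" "v \<in> F"
proof -
  have "{u<..<v} \<subseteq> F" using assms by (auto simp: gaps_def)
  then have "closure {u<..<v} \<subseteq> F"
    using assms(3) by (rule closure_minimal)
  then show "u \<in> F" "v \<in> F"
    using gapsD(1)[OF assms(1)] by auto
qed

lemma countable_gaps: "countable (gaps U)"
proof -
  define q where "q n = (SOME r. r \<in> \<rat> \<and> fst n < r \<and> r < snd n)" for n :: "real \<times> real"
  have q: "q n \<in> \<rat> \<and> fst n < q n \<and> q n < snd n" if n: "n \<in> gaps U" for n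
  proof -
    have "fst n < snd n" using n by (auto simp: gaps_def)
    then show ?thesis
      unfolding q_def by (rule someI_ex[OF Rats_dense_in_real[THEN bexE]]) auto
  qed
  have "inj_on q (gaps U)"
  proof (rule inj_onI)
    fix m n assume m: "m \<in> gaps U" and n: "n \<in> gaps U" and eq: "q m = q n"
    then have "fst m = fst n \<and> snd m = snd n"
      using q[OF m] q[OF n] by (intro gaps_unique[of _ _ U _ _ "q m"]) auto
    then show "m = n" by (simp add: prod_eq_iff)
  qed
  moreover have "countable (q ` gaps U)"
    using q by (intro countable_subset[OF _ countable_rat]) auto
  ultimately show ?thesis
    using countable_image_inj_on by blast
qed

lemma affine_between:
  fixes u v s :: real
  assumes "u < v" "0 < s" "s < 1"
  shows "u < u + s * (v - u)" "u + s * (v - u) < v"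
proof -
  have "0 < s * (v - u)" "0 < (1 - s) * (v - u)"
    using assms by simp_all
  then show "u < u + s * (v - u)" "u + s * (v - u) < v"
    by (simp_all add: algebra_simps)
qed

text \<open>
  Only the copies of the end points that face the gap enter, so it does not matter whether the end
  points are split.
\<close>

definition interpolate :: "(real \<times> bool \<Rightarrow> real) \<Rightarrow> real \<Rightarrow> real \<Rightarrow> real \<Rightarrow> real" where
  "interpolate g u v t = g (u, True) + (t - u) / (v - u) * (g (v, False) - g (u, True))"

lemma interpolate_near:
  assumes "\<bar>g (u, True) - c\<bar> < \<epsilon>" "\<bar>g (v, False) - c\<bar> < \<epsilon>" "u < v" "u \<le> t" "t \<le> v"
  shows "\<bar>interpolate g u v t - c\<bar> < \<epsilon>"
proof -
  define l where "l = (t - u) / (v - u)"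
  have l: "0 \<le> l" "l \<le> 1" using assms by (auto simp: l_def)
  have "interpolate g u v t = (1 - l) * g (u, True) + l * g (v, False)"
    by (simp add: interpolate_def l_def[symmetric] algebra_simps)
  moreover have "g (u, True) \<in> {c - \<epsilon><..<c + \<epsilon>}" "g (v, False) \<in> {c - \<epsilon><..<c + \<epsilon>}"
    using assms by auto
  then have "(1 - l) *\<^sub>R g (u, True) + l *\<^sub>R g (v, False) \<in> {c - \<epsilon><..<c + \<epsilon>}"
    using l by (intro convexD) auto
  ultimately show ?thesis by auto
qed

definition split_C_ends :: "real set \<Rightarrow> (real \<times> bool \<Rightarrow> real) set" where
  "split_C_ends B = {f \<in> split_C {0..1} B. \<forall>b. f (0, b) = 0 \<and> f (1, b) = 0}"

text \<open>
  If the ends of an interval are split, their outer copies carry values that have nothing to do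
  with the interval. Resetting these values leaves a function that vanishes at both ends.
\<close>

lemma split_C_ends_modify:
  assumes k: "k \<in> split_C {0..1} (insert 0 (insert 1 B))" and "k (0, True) = 0" "k (1, False) = 0"
  shows "(\<lambda>(s, b). if 0 < s \<and> s < 1 then k (s, b) else 0) \<in> split_C_ends B"
proof -
  let ?k = "\<lambda>(s, b). if 0 < s \<and> s < 1 then k (s, b) else 0"
  have "?k \<in> split_C {0..1} B"
  proof (rule split_CI)
    fix t \<epsilon> :: real assume t: "t \<in> {0..1}" and \<epsilon>: "0 < \<epsilon>"
    obtain d where d: "0 < d"
      "\<And>s b. s \<in> {0..1} \<Longrightarrow> t - d < s \<Longrightarrow> s < t \<Longrightarrow> \<bar>k (s, b) - k (t, False)\<bar> < \<epsilon>"
      using split_C_left[OF k t \<epsilon>] by blast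
    show "\<exists>\<delta>>0. \<forall>s\<in>{0..1}. \<forall>b. t - \<delta> < s \<and> s < t \<longrightarrow> \<bar>?k (s, b) - ?k (t, False)\<bar> < \<epsilon>"
    proof (cases "t = 0")
      case False
      have "\<bar>?k (s, b) - ?k (t, False)\<bar> < \<epsilon>" if "s \<in> {0..1}" "t - min d t < s" "s < t" for s b
        using that t d(2)[of s b] assms by (cases "t = 1") auto
      then show ?thesis using False d(1) t by (intro exI[of _ "min d t"]) auto
    qed (auto intro!: exI[of _ 1])
    obtain d where d: "0 < d"
      "\<And>s b. s \<in> {0..1} \<Longrightarrow> t < s \<Longrightarrow> s < t + d \<Longrightarrow> \<bar>k (s, b) - k (t, True)\<bar> < \<epsilon>"
      using split_C_right[OF k t \<epsilon>] by blast
    show "\<exists>\<delta>>0. \<forall>s\<in>{0..1}. \<forall>b. t < s \<and> s < t + \<delta> \<longrightarrow> \<bar>?k (s, b) - ?k (t, True)\<bar> < \<epsilon>"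
    proof (cases "t = 1")
      case False
      have "\<bar>?k (s, b) - ?k (t, True)\<bar> < \<epsilon>" if "s \<in> {0..1}" "t < s" "s < t + min d (1 - t)" for s b
        using that t d(2)[of s b] assms by (cases "t = 0") auto
      then show ?thesis using False d(1) t by (intro exI[of _ "min d (1 - t)"]) auto
    qed (auto intro!: exI[of _ 1])
  next
    fix t :: real assume "t \<in> {0..1}" "t \<notin> B"
    then show "?k (t, False) = ?k (t, True)"
      using split_C_eq[OF k, of t False True] by auto
  qed auto
  then show ?thesis by (simp add: split_C_ends_def)
qed

text \<open>
  The restriction to \<open>F - U\<close> has the linear interpolation over the gaps as a right inverse, and
  what remains vanishes on \<open>F - U\<close>. A function that vanishes there is small on all but finitely
  many gaps, because the gaps on which it is large could only accumulate at a point of \<open>F - U\<close>.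
  So it is a null sequence of functions on intervals, each of which is an affine copy of the
  unit interval split at \<open>B\<close>.
\<close>

locale gap_filling =
  fixes F U A B :: "real set"
  assumes F: "compact F" and U: "open U" "U \<subseteq> F"
    and gap_split: "\<And>u v s. (u, v) \<in> gaps U \<Longrightarrow> 0 < s \<Longrightarrow> s < 1 \<Longrightarrow> u + s * (v - u) \<in> A \<longleftrightarrow> s \<in> B"
begin

lemma closed_F: "closed F" and bounded_U: "bounded U"
  using F U bounded_subset compact_imp_bounded compact_imp_closed by blast+

lemma gap_ends:
  assumes "(u, v) \<in> gaps U"
  shows "u \<in> F - U" "v \<in> F - U"
  using gaps_endpoint_mem[OF assms U(2) closed_F] gapsD[OF assms] by auto

definition remainder :: "(real \<times> bool \<Rightarrow> real) \<Rightarrow> (real \<times> real) \<times> (real \<times> bool) \<Rightarrow> real" where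
  "remainder f = (\<lambda>((u, v), (s, b)). if (u, v) \<in> gaps U \<and> 0 < s \<and> s < 1
     then f (u + s * (v - u), b) - interpolate f u v (u + s * (v - u)) else 0)"

definition assemble ::
  "((real \<times> bool) + (real \<times> real) \<times> (real \<times> bool) \<Rightarrow> real) \<Rightarrow> real \<times> bool \<Rightarrow> real" where
  "assemble h = (\<lambda>(t, b). if t \<in> F - U then h (Inl (t, b)) else if t \<in> U then
     (case gap_of U t of (u, v) \<Rightarrow> interpolate (\<lambda>x. h (Inl x)) u v t + h (Inr ((u, v), ((t - u) / (v - u), b))))
     else 0)"

lemma remainder_piece:
  assumes f: "f \<in> split_C F A" and n: "(u, v) \<in> gaps U"
  shows "(\<lambda>x. remainder f ((u, v), x)) \<in> split_C_ends B"
proof -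
  have uv: "u < v" using gapsD[OF n] by simp
  have sub: "{u..v} \<subseteq> F"
  proof
    fix x assume "x \<in> {u..v}"
    then consider "x = u" | "x = v" | "u < x" "x < v" by fastforce
    then show "x \<in> F" using gapsD(4)[OF n, of x] gap_ends[OF n] U(2) by cases auto
  qed
  define p where "p s = u + s * (v - u)" for s
  have pin: "p s \<in> F" if "s \<in> {0..1}" for s
  proof -
    have "0 \<le> s * (v - u)" "s * (v - u) \<le> 1 * (v - u)"
      using that uv by (auto intro!: mult_nonneg_nonneg mult_right_mono)
    then show ?thesis using sub unfolding p_def by auto
  qed
  have "split_map {0..1} (insert 0 (insert 1 B)) F A (\<lambda>(s, b). (p s, b))"
  proof (rule split_map_strict_mono)
    show "strict_mono_on {0..1} p"
      using uv by (auto simp: strict_mono_on_def p_def)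
    show "continuous_on {0..1} p"
      unfolding p_def by (intro continuous_intros)
    fix s assume "s \<in> {0..1}" "s \<notin> insert 0 (insert 1 B)"
    then show "p s \<notin> A" using gap_split[OF n, of s] by (auto simp: p_def)
  qed (use pin in auto)
  then have 1: "pullback {0..1} (\<lambda>(s, b). (p s, b)) f \<in> split_C {0..1} (insert 0 (insert 1 B))"
    using pullback_in_split_C f by blast
  have 2: "(\<lambda>(s, b). if s \<in> {0..1} then interpolate f u v (p s) else 0)
     \<in> split_C {0..1} (insert 0 (insert 1 B))"
    by (rule split_C_continuous) (use uv in \<open>auto simp: interpolate_def p_def intro!: continuous_intros\<close>)
  define k where "k x = pullback {0..1} (\<lambda>(s, b). (p s, b)) f x -
      (case x of (s, b) \<Rightarrow> if s \<in> {0..1} then interpolate f u v (p s) else 0)" for x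
  have "k \<in> split_C {0..1} (insert 0 (insert 1 B))"
    using split_C_diff[OF 1 2] by (simp add: k_def[abs_def])
  moreover have "k (0, True) = 0" "k (1, False) = 0"
    using uv by (auto simp: k_def pullback_def interpolate_def p_def)
  ultimately have "(\<lambda>(s, b). if 0 < s \<and> s < 1 then k (s, b) else 0) \<in> split_C_ends B"
    by (rule split_C_ends_modify)
  moreover have "(\<lambda>x. remainder f ((u, v), x)) = (\<lambda>(s, b). if 0 < s \<and> s < 1 then k (s, b) else 0)"
    using n by (auto simp: remainder_def k_def pullback_def p_def fun_eq_iff)
  ultimately show ?thesis by simp
qed

lemma remainder_small:
  assumes n: "(u, v) \<in> gaps U" and c: "\<And>s b. s \<in> F \<Longrightarrow> u < s \<Longrightarrow> s < v \<Longrightarrow> \<bar>f (s, b) - c\<bar> < \<epsilon> / 2"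
    "\<bar>f (u, True) - c\<bar> < \<epsilon> / 2" "\<bar>f (v, False) - c\<bar> < \<epsilon> / 2"
  shows "\<bar>remainder f ((u, v), x)\<bar> \<le> \<epsilon>"
proof -
  obtain s b where x: "x = (s, b)" by (cases x)
  have "0 < \<epsilon>" using c(2) by linarith
  show ?thesis
  proof (cases "0 < s \<and> s < 1")
    case True
    define t where "t = u + s * (v - u)"
    have t: "u < t" "t < v"
      unfolding t_def using True gapsD(1)[OF n] by (simp_all only: affine_between)
    have "\<bar>interpolate f u v t - c\<bar> < \<epsilon> / 2"
      using c t by (intro interpolate_near) auto
    moreover have "\<bar>f (t, b) - c\<bar> < \<epsilon> / 2"
      using c(1)[of t b] t gapsD(4)[OF n, of t] U(2) by auto
    ultimately have "\<bar>f (t, b) - interpolate f u v t\<bar> \<le> \<epsilon>"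
      by linarith
    then show ?thesis
      using True n by (simp add: remainder_def x t_def[symmetric])
  qed (use \<open>0 < \<epsilon>\<close> in \<open>auto simp: remainder_def x\<close>)
qed

lemma remainder_null:
  assumes f: "f \<in> split_C F A" and \<epsilon>: "0 < \<epsilon>"
  shows "finite {n \<in> gaps U. \<exists>x. \<epsilon> < \<bar>remainder f (n, x)\<bar>}" (is "finite ?bad")
proof (rule ccontr)
  assume inf: "infinite ?bad"
  have \<epsilon>2: "0 < \<epsilon> / 2" using \<epsilon> by simp
  have "inj_on fst ?bad"
    by (auto simp: inj_on_def dest: gaps_fst_unique)
  then have "infinite (fst ` ?bad)"
    using inf finite_image_iff by blast
  moreover have "fst ` ?bad \<subseteq> F - U"
    using gap_ends by auto
  moreover have "compact (F - U)"
    using F U by (simp add: compact_diff)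
  ultimately obtain t where t: "t \<in> F - U" "t islimpt fst ` ?bad"
    using Heine_Borel_imp_Bolzano_Weierstrass[of "F - U" "fst ` ?bad"] by blast
  then have tF: "t \<in> F" by blast
  obtain d1 where d1: "0 < d1"
    "\<And>s b. s \<in> F \<Longrightarrow> t - d1 < s \<Longrightarrow> s < t \<Longrightarrow> \<bar>f (s, b) - f (t, False)\<bar> < \<epsilon> / 2"
    using split_C_left[OF f tF \<epsilon>2] by blast
  obtain d2 where d2: "0 < d2"
    "\<And>s b. s \<in> F \<Longrightarrow> t < s \<Longrightarrow> s < t + d2 \<Longrightarrow> \<bar>f (s, b) - f (t, True)\<bar> < \<epsilon> / 2"
    using split_C_right[OF f tF \<epsilon>2] by blast
  define d where "d = min d1 d2"
  have "0 < d" using d1 d2 by (simp add: d_def)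
  then have inf2: "infinite (fst ` ?bad \<inter> ball t d)"
    using t(2) islimpt_eq_infinite_ball by blast
  \<comment> \<open>A bad gap left of \<open>t\<close> ends at \<open>t\<close> at the latest; right of \<open>t\<close>, a bad gap ends before the next
    one begins.\<close>
  have left: False if u: "u \<in> fst ` ?bad" "t - d < u" "u < t" for u
  proof -
    obtain v x where v: "(u, v) \<in> gaps U" "\<epsilon> < \<bar>remainder f ((u, v), x)\<bar>"
      using u(1) by auto
    have "v \<le> t"
      using gapsD(4)[OF v(1), of t] u(3) t(1) by force
    moreover have "t - d1 < u" using u(2) by (simp add: d_def)
    moreover have "\<bar>f (v, False) - f (t, False)\<bar> < \<epsilon> / 2"
      using calculation d1(2)[of v False] \<epsilon>2 gap_ends[OF v(1)] gapsD(1)[OF v(1)] by (cases "v = t") auto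
    ultimately have "\<bar>remainder f ((u, v), x)\<bar> \<le> \<epsilon>"
      using d1(2)[of u True] u(3) gap_ends[OF v(1)] d1(2)
      by (intro remainder_small[OF v(1), where f=f and c="f (t, False)"]) auto
    then show False using v(2) by simp
  qed
  have right: False if u: "u \<in> fst ` ?bad" "t < u" and u': "u' \<in> fst ` ?bad" "u < u'" "u' < t + d" for u u'
  proof -
    obtain v x where v: "(u, v) \<in> gaps U" "\<epsilon> < \<bar>remainder f ((u, v), x)\<bar>"
      using u(1) by auto
    obtain v' where "(u', v') \<in> gaps U" using u'(1) by auto
    then have "v \<le> u'"
      using gapsD(4)[OF v(1), of u'] gapsD(2)[of u' v' U] u'(2) by force
    then have "\<bar>remainder f ((u, v), x)\<bar> \<le> \<epsilon>"
      using u u' gapsD(1)[OF v(1)] gap_ends[OF v(1)] d_def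
      by (intro remainder_small[OF v(1), of f "f (t, True)"] d2(2)) auto
    then show False using v(2) by simp
  qed
  have sub: "fst ` ?bad \<inter> ball t d \<subseteq> insert t (fst ` ?bad \<inter> {t<..<t+d})"
  proof
    fix u assume u: "u \<in> fst ` ?bad \<inter> ball t d"
    then have u': "u \<in> fst ` ?bad" "\<bar>t - u\<bar> < d"
      by (simp_all only: Int_iff mem_ball dist_real_def)
    have "\<not> (t - d < u \<and> u < t)" using left[OF u'(1)] by blast
    then have "u = t \<or> u \<in> {t<..<t+d}"
      using u'(2) by (simp only: greaterThanLessThan_iff) linarith
    then show "u \<in> insert t (fst ` ?bad \<inter> {t<..<t+d})" using u by blast
  qed
  have inf3: "infinite (fst ` ?bad \<inter> {t<..<t+d})"
    using inf2 by (rule contrapos_nn) (rule finite_subset[OF sub finite.insertI])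
  have eq: "u = u'" if u: "u \<in> fst ` ?bad \<inter> {t<..<t+d}" and u': "u' \<in> fst ` ?bad \<inter> {t<..<t+d}" for u u'
  proof (cases u u' rule: linorder_cases)
    case less then show ?thesis
      using right[OF IntD1[OF u] _ IntD1[OF u'] less] IntD2[OF u] IntD2[OF u'] by simp
  next
    case greater then show ?thesis
      using right[OF IntD1[OF u'] _ IntD1[OF u] greater] IntD2[OF u] IntD2[OF u'] by simp
  qed
  obtain u where u: "u \<in> fst ` ?bad \<inter> {t<..<t+d}"
    using infinite_imp_nonempty[OF inf3] by blast
  have "fst ` ?bad \<inter> {t<..<t+d} \<subseteq> {u}"
    using eq[OF _ u] by (intro subsetI) (simp only: singleton_iff)
  from finite_subset[OF this] show False using inf3 by simp
qed

lemma assemble_gap: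
  assumes "(u, v) \<in> gaps U" "u < t" "t < v"
  shows "assemble h (t, b) = interpolate (\<lambda>x. h (Inl x)) u v t + h (Inr ((u, v), ((t - u) / (v - u), b)))"
  using assms gapsD(4)[OF assms] by (auto simp: assemble_def gap_of_eq)

lemma assemble_rest: "t \<in> F - U \<Longrightarrow> assemble h (t, b) = h (Inl (t, b))"
  by (simp add: assemble_def)

lemma assemble_in_split_C:
  assumes h: "h \<in> split_C (F - U) A \<otimes>\<^sub>f c0_sum (gaps U) (split_C_ends B)"
  shows "assemble h \<in> split_C F A"
proof -
  define g where "g x = h (Inl x)" for x
  define k where "k x = h (Inr x)" for x
  have g: "g \<in> split_C (F - U) A" and k: "k \<in> c0_sum (gaps U) (split_C_ends B)"
    using h by (auto simp: prod_space_iff g_def[abs_def] k_def[abs_def])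
  have piece: "(\<lambda>x. k (n, x)) \<in> split_C {0..1} B" "k (n, (0, b)) = 0" "k (n, (1, b)) = 0" if "n \<in> gaps U" for n b
    using c0_sumD(1)[OF k that] by (auto simp: split_C_ends_def)
  have asm_gap: "assemble h (t, b) = interpolate g u v t + k ((u, v), ((t - u) / (v - u), b))"
    if "(u, v) \<in> gaps U" "u < t" "t < v" for u v t b
    using assemble_gap[OF that] by (simp add: g_def[abs_def] k_def)
  have asm_rest: "assemble h (t, b) = g (t, b)" if "t \<in> F - U" for t b
    using assemble_rest[OF that] by (simp add: g_def)
  \<comment> \<open>On the closure of a single gap, the assembled function is a function of the right kind.\<close>
  define m where "m u v x = (case x of (t, b) \<Rightarrow> if t \<in> {u..v} then interpolate g u v t else 0)
      + pullback {u..v} (\<lambda>(t, b). ((t - u) / (v - u), b)) (\<lambda>x. k ((u, v), x)) x" for u v x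
  have m: "m u v \<in> split_C {u..v} (insert u (insert v A))" if n: "(u, v) \<in> gaps U" for u v
  proof -
    have uv: "u < v" using gapsD[OF n] by simp
    have "split_map {u..v} (insert u (insert v A)) {0..1} B (\<lambda>(t, b). ((t - u) / (v - u), b))"
    proof (rule split_map_strict_mono)
      show "strict_mono_on {u..v} (\<lambda>t. (t - u) / (v - u))"
        using uv by (auto simp: strict_mono_on_def divide_strict_right_mono)
      show "continuous_on {u..v} (\<lambda>t. (t - u) / (v - u))"
        using uv by (intro continuous_intros) auto
      fix t assume "t \<in> {u..v}" "t \<notin> insert u (insert v A)"
      then show "(t - u) / (v - u) \<notin> B"
        using gap_split[OF n, of "(t - u) / (v - u)"] uv by auto
    qed (use uv in auto)
    from pullback_in_split_C[OF this piece(1)[OF n]]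
    have 1: "pullback {u..v} (\<lambda>(t, b). ((t - u) / (v - u), b)) (\<lambda>x. k ((u, v), x))
        \<in> split_C {u..v} (insert u (insert v A))" .
    have 2: "(\<lambda>(t, b). if t \<in> {u..v} then interpolate g u v t else 0) \<in> split_C {u..v} (insert u (insert v A))"
      using uv by (intro split_C_continuous) (auto simp: interpolate_def intro!: continuous_intros)
    show ?thesis
      using split_C_add[OF 2 1] by (simp add: m_def[abs_def])
  qed
  have m_eq: "assemble h (t, b) = m u v (t, b)" if "(u, v) \<in> gaps U" "u < t" "t < v" for u v t b
    using asm_gap[OF that] that by (simp add: m_def pullback_def)
  have m_u: "m u v (u, b) = g (u, True)" and m_v: "m u v (v, b) = g (v, False)" if "(u, v) \<in> gaps U" for u v b
    using gapsD(1)[OF that] piece(2,3)[OF that] by (auto simp: m_def pullback_def interpolate_def)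
  show ?thesis
  proof (rule split_CI)
    fix t b assume "t \<notin> F" then show "assemble h (t, b) = 0"
      using U by (auto simp: assemble_def)
  next
    fix t assume t: "t \<in> F" "t \<notin> A"
    show "assemble h (t, False) = assemble h (t, True)"
    proof (cases "t \<in> U")
      case True
      obtain u v where uv: "(u, v) \<in> gaps U" "u < t" "t < v"
        using gaps_exist[OF U(1) bounded_U True] .
      then show ?thesis
        using split_C_eq[OF m[OF uv(1)], of t False True] t by (simp add: m_eq)
    qed (use t split_C_eq[OF g, of t False True] asm_rest in auto)
  next
    fix t \<epsilon> :: real assume t: "t \<in> F" and \<epsilon>: "0 < \<epsilon>"
    show "\<exists>\<delta>>0. \<forall>s\<in>F. \<forall>b. t < s \<and> s < t + \<delta> \<longrightarrow> \<bar>assemble h (s, b) - assemble h (t, True)\<bar> < \<epsilon>"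
    proof (cases "\<exists>u v. (u, v) \<in> gaps U \<and> u \<le> t \<and> t < v")
      case True
      then obtain u v where uv: "(u, v) \<in> gaps U" "u \<le> t" "t < v" by blast
      then have "t \<in> {u..v}" by simp
      from split_C_right[OF m[OF uv(1)] this \<epsilon>] obtain d where d: "0 < d"
        "\<And>s b. s \<in> {u..v} \<Longrightarrow> t < s \<Longrightarrow> s < t + d \<Longrightarrow> \<bar>m u v (s, b) - m u v (t, True)\<bar> < \<epsilon>" by blast
      have "assemble h (t, True) = m u v (t, True)"
        using m_eq[OF uv(1)] uv m_u[OF uv(1)] asm_rest[of u] gap_ends[OF uv(1)] by (cases "u = t") auto
      moreover have "assemble h (s, b) = m u v (s, b)" if "t < s" "s < t + min d (v - t)" for s b
        using that uv by (intro m_eq) auto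
      ultimately show ?thesis
        using d uv by (intro exI[of _ "min d (v - t)"]) auto
    next
      case False
      then have tU: "t \<in> F - U"
        using gaps_exist[OF U(1) bounded_U] t by (metis DiffI less_imp_le)
      have \<epsilon>2: "0 < \<epsilon> / 2" using \<epsilon> by simp
      obtain d1 where d1: "0 < d1"
        "\<And>s b. s \<in> F - U \<Longrightarrow> t < s \<Longrightarrow> s < t + d1 \<Longrightarrow> \<bar>g (s, b) - g (t, True)\<bar> < \<epsilon> / 2"
        using split_C_right[OF g tU \<epsilon>2] by blast
      define bad where "bad = fst ` {n \<in> gaps U. \<exists>x. \<epsilon> / 2 < \<bar>k (n, x)\<bar>} \<inter> {t<..}"
      have "finite bad" using c0_sumD(3)[OF k \<epsilon>2] by (simp add: bad_def)
      \<comment> \<open>To the right of \<open>t\<close>, stay away from the finitely many gaps where the remainder is large.\<close>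
      then obtain d2 where d2: "0 < d2" "\<And>u. u \<in> bad \<Longrightarrow> t + d2 \<le> u"
      proof (cases "bad = {}")
        case False
        then have "Min bad \<in> bad" "\<And>u. u \<in> bad \<Longrightarrow> Min bad \<le> u"
          using \<open>finite bad\<close> by auto
        then show thesis by (intro that[of "Min bad - t"]) (auto simp: bad_def)
      qed (use zero_less_one in blast)
      define d where "d = min d1 d2"
      \<comment> \<open>Near \<open>t\<close>, both ends of a gap are close to \<open>t\<close>: a point of \<open>F - U\<close> to the right of \<open>t\<close> bounds it.\<close>
      obtain e where e: "0 < e" "e \<le> d" "(F - U) \<inter> {t<..<t+e} = {} \<or> t + e \<in> F - U \<and> e < d"
      proof (cases "(F - U) \<inter> {t<..<t+d} = {}")
        case True then show thesis using that[of d] d1 d2 by (auto simp: d_def)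
      next
        case False
        then obtain x where "x \<in> (F - U) \<inter> {t<..<t+d}" by blast
        then show thesis by (intro that[of "x - t"]) auto
      qed
      have "\<bar>assemble h (s, b) - assemble h (t, True)\<bar> < \<epsilon>" if s: "s \<in> F" "t < s" "s < t + e" for s b
      proof (cases "s \<in> U")
        case True
        obtain u v where uv: "(u, v) \<in> gaps U" "u < s" "s < v"
          using gaps_exist[OF U(1) bounded_U True] .
        have tu: "t < u" using False uv s by (meson less_trans not_less)
        then have v: "v \<le> t + e" "e < d"
          using e(3) gap_ends[OF uv(1)] uv s gapsD(4)[OF uv(1), of "t + e"] by force+
        have "\<bar>interpolate g u v s - g (t, True)\<bar> < \<epsilon> / 2"
          using d1(2) gap_ends[OF uv(1)] tu uv s v by (intro interpolate_near) (auto simp: d_def)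
        moreover have "u \<notin> bad" using d2(2)[of u] uv s e(2) by (auto simp: d_def)
        then have "\<bar>k ((u, v), ((s - u) / (v - u), b))\<bar> \<le> \<epsilon> / 2"
          using uv(1) tu unfolding bad_def not_less[symmetric]
          by (metis (mono_tags, lifting) IntI fst_conv greaterThan_iff imageI mem_Collect_eq)
        ultimately show ?thesis
          unfolding asm_gap[OF uv] asm_rest[OF tU] by linarith
      next
        case False
        then show ?thesis
          using d1(2)[of s b] s e(2) asm_rest tU \<epsilon> by (auto simp: d_def)
      qed
      then show ?thesis using e(1) by blast
    qed
    show "\<exists>\<delta>>0. \<forall>s\<in>F. \<forall>b. t - \<delta> < s \<and> s < t \<longrightarrow> \<bar>assemble h (s, b) - assemble h (t, False)\<bar> < \<epsilon>"
    proof (cases "\<exists>u v. (u, v) \<in> gaps U \<and> u < t \<and> t \<le> v")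
      case True
      then obtain u v where uv: "(u, v) \<in> gaps U" "u < t" "t \<le> v" by blast
      then have "t \<in> {u..v}" by simp
      from split_C_left[OF m[OF uv(1)] this \<epsilon>] obtain d where d: "0 < d"
        "\<And>s b. s \<in> {u..v} \<Longrightarrow> t - d < s \<Longrightarrow> s < t \<Longrightarrow> \<bar>m u v (s, b) - m u v (t, False)\<bar> < \<epsilon>" by blast
      have "assemble h (t, False) = m u v (t, False)"
        using m_eq[OF uv(1)] uv m_v[OF uv(1)] asm_rest[of v] gap_ends[OF uv(1)] by (cases "v = t") auto
      moreover have "assemble h (s, b) = m u v (s, b)" if "s < t" "t - min d (t - u) < s" for s b
        using that uv by (intro m_eq) auto
      ultimately show ?thesis
        using d uv by (intro exI[of _ "min d (t - u)"]) auto
    next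
      case False
      then have tU: "t \<in> F - U"
        using gaps_exist[OF U(1) bounded_U] t by (metis DiffI less_imp_le)
      have \<epsilon>2: "0 < \<epsilon> / 2" using \<epsilon> by simp
      obtain d1 where d1: "0 < d1"
        "\<And>s b. s \<in> F - U \<Longrightarrow> t - d1 < s \<Longrightarrow> s < t \<Longrightarrow> \<bar>g (s, b) - g (t, False)\<bar> < \<epsilon> / 2"
        using split_C_left[OF g tU \<epsilon>2] by blast
      define bad where "bad = snd ` {n \<in> gaps U. \<exists>x. \<epsilon> / 2 < \<bar>k (n, x)\<bar>} \<inter> {..<t}"
      have "finite bad" using c0_sumD(3)[OF k \<epsilon>2] by (simp add: bad_def)
      then obtain d2 where d2: "0 < d2" "\<And>v. v \<in> bad \<Longrightarrow> v \<le> t - d2"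
      proof (cases "bad = {}")
        case False
        then have "Max bad \<in> bad" "\<And>u. u \<in> bad \<Longrightarrow> u \<le> Max bad"
          using \<open>finite bad\<close> by auto
        then show thesis by (intro that[of "t - Max bad"]) (auto simp: bad_def)
      qed (use zero_less_one in blast)
      define d where "d = min d1 d2"
      obtain e where e: "0 < e" "e \<le> d" "(F - U) \<inter> {t-e<..<t} = {} \<or> t - e \<in> F - U \<and> e < d"
      proof (cases "(F - U) \<inter> {t-d<..<t} = {}")
        case True then show thesis using that[of d] d1 d2 by (auto simp: d_def)
      next
        case False
        then obtain x where "x \<in> (F - U) \<inter> {t-d<..<t}" by blast
        then show thesis by (intro that[of "t - x"]) auto
      qed
      have "\<bar>assemble h (s, b) - assemble h (t, False)\<bar> < \<epsilon>" if s: "s \<in> F" "t - e < s" "s < t" for s b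
      proof (cases "s \<in> U")
        case True
        obtain u v where uv: "(u, v) \<in> gaps U" "u < s" "s < v"
          using gaps_exist[OF U(1) bounded_U True] .
        have tv: "v < t" using False uv s by (meson less_trans not_less)
        then have u: "t - e \<le> u" "e < d"
          using e(3) gap_ends[OF uv(1)] uv s gapsD(4)[OF uv(1), of "t - e"] by force+
        have "\<bar>interpolate g u v s - g (t, False)\<bar> < \<epsilon> / 2"
          using d1(2) gap_ends[OF uv(1)] tv uv s u by (intro interpolate_near) (auto simp: d_def)
        moreover have "v \<notin> bad" using d2(2)[of v] uv s e(2) by (auto simp: d_def)
        then have "\<bar>k ((u, v), ((s - u) / (v - u), b))\<bar> \<le> \<epsilon> / 2"
          using uv(1) tv unfolding bad_def not_less[symmetric]
          by (metis (mono_tags, lifting) IntI snd_conv lessThan_iff imageI mem_Collect_eq)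
        ultimately show ?thesis
          unfolding asm_gap[OF uv] asm_rest[OF tU] by linarith
      next
        case False
        then show ?thesis
          using d1(2)[of s b] s e(2) asm_rest tU \<epsilon> by (auto simp: d_def)
      qed
      then show ?thesis using e(1) by blast
    qed
  qed
qed

theorem split_C_fill_gaps:
  "split_C F A \<simeq> split_C (F - U) A \<otimes>\<^sub>f c0_sum (gaps U) (split_C_ends B)"
proof (rule fin_isoI[where
      T="\<lambda>f z. case z of Inl x \<Rightarrow> pullback (F - U) (\<lambda>x. x) f x | Inr x \<Rightarrow> remainder f x" and S=assemble])
  fix f assume f: "f \<in> split_C F A"
  have "split_map (F - U) A F A (\<lambda>x. x)"
    by (rule split_map_restrict) auto
  then have "pullback (F - U) (\<lambda>x. x) f \<in> split_C (F - U) A"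
    using pullback_in_split_C f by blast
  moreover have "remainder f \<in> c0_sum (gaps U) (split_C_ends B)"
  proof (rule c0_sumI)
    show "(\<lambda>x. remainder f (n, x)) \<in> split_C_ends B" if "n \<in> gaps U" for n
      using remainder_piece[OF f, of "fst n" "snd n"] that by simp
    show "remainder f (n, x) = 0" if "n \<notin> gaps U" for n x
      using that by (auto simp: remainder_def split: prod.splits)
  qed (rule remainder_null[OF f])
  ultimately show "(\<lambda>z. case z of Inl x \<Rightarrow> pullback (F - U) (\<lambda>x. x) f x | Inr x \<Rightarrow> remainder f x)
      \<in> split_C (F - U) A \<otimes>\<^sub>f c0_sum (gaps U) (split_C_ends B)"
    by (simp add: prod_space_iff)
  show "assemble (\<lambda>z. case z of Inl x \<Rightarrow> pullback (F - U) (\<lambda>x. x) f x | Inr x \<Rightarrow> remainder f x) = f" (is "assemble ?h = f")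
  proof (rule ext, clarify)
    fix t b
    consider "t \<in> F - U" | "t \<in> U" | "t \<notin> F" using U by blast
    then show "assemble ?h (t, b) = f (t, b)"
    proof cases
      case 2
      obtain u v where uv: "(u, v) \<in> gaps U" "u < t" "t < v"
        using gaps_exist[OF U(1) bounded_U 2] .
      define s where "s = (t - u) / (v - u)"
      have s: "0 < s" "s < 1" "u + s * (v - u) = t"
        using uv by (auto simp: s_def)
      have "interpolate (\<lambda>x. ?h (Inl x)) u v t = interpolate f u v t"
        using gap_ends[OF uv(1)] by (simp add: interpolate_def pullback_def)
      then show ?thesis
        using assemble_gap[OF uv, of ?h b] uv s by (simp add: s_def[symmetric] remainder_def)
    qed (use f U in \<open>auto simp: assemble_def pullback_def split_C_0\<close>)
  qed
next
  fix h assume h: "h \<in> split_C (F - U) A \<otimes>\<^sub>f c0_sum (gaps U) (split_C_ends B)"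
  then show "assemble h \<in> split_C F A" by (rule assemble_in_split_C)
  have g: "(\<lambda>x. h (Inl x)) \<in> split_C (F - U) A" and k: "(\<lambda>x. h (Inr x)) \<in> c0_sum (gaps U) (split_C_ends B)"
    using h by (auto simp: prod_space_iff)
  show "(\<lambda>z. case z of Inl x \<Rightarrow> pullback (F - U) (\<lambda>x. x) (assemble h) x | Inr x \<Rightarrow> remainder (assemble h) x) = h"
  proof
    fix z
    show "(case z of Inl x \<Rightarrow> pullback (F - U) (\<lambda>x. x) (assemble h) x | Inr x \<Rightarrow> remainder (assemble h) x) = h z"
    proof (cases z)
      case (Inl x)
      then show ?thesis
        using split_C_0[OF g, of "fst x" "snd x"] assemble_rest[of "fst x" h "snd x"]
        by (auto simp: pullback_def)
    next
      case (Inr y)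
      obtain u v s b where y: "y = ((u, v), (s, b))" by (metis surj_pair)
      show ?thesis
      proof (cases "(u, v) \<in> gaps U \<and> 0 < s \<and> s < 1")
        case True
        then have uv: "(u, v) \<in> gaps U" by simp
        define t where "t = u + s * (v - u)"
        have t: "u < t" "t < v"
          unfolding t_def using True gapsD(1)[OF uv] by (simp_all only: affine_between)
        have ts: "(t - u) / (v - u) = s"
          using gapsD(1)[OF uv] by (auto simp: t_def)
        have "interpolate (assemble h) u v t = interpolate (\<lambda>x. h (Inl x)) u v t"
          using gap_ends[OF uv] by (simp add: interpolate_def assemble_rest)
        then have "remainder (assemble h) y = h (Inr y)"
          using assemble_gap[OF uv t, of h b] True ts by (simp add: remainder_def y t_def[symmetric])
        then show ?thesis by (simp add: Inr)
      next
        case False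
        have "h (Inr y) = 0"
        proof (cases "(u, v) \<in> gaps U")
          case uv: True
          have piece: "(\<lambda>x. h (Inr ((u, v), x))) \<in> split_C_ends B"
            using c0_sumD(1)[OF k uv] .
          have "s = 0 \<or> s = 1 \<or> s \<notin> {0..1}" using False uv by force
          then show ?thesis
            using piece split_C_0[of "\<lambda>x. h (Inr ((u, v), x))" "{0..1}" B s b] y
            by (auto simp: split_C_ends_def)
        next
          case uv: False
          then show ?thesis using c0_sumD(2)[OF k uv] y by simp
        qed
        moreover have "remainder (assemble h) y = 0"
          using False by (auto simp: y remainder_def)
        ultimately show ?thesis by (simp add: Inr)
      qed
    qed
  qed
next
  show "fin_functional (split_C F A)
      (\<lambda>f. case z of Inl x \<Rightarrow> pullback (F - U) (\<lambda>x. x) f x | Inr x \<Rightarrow> remainder f x)" for z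
    by (intro fin_functional_case_sum)
       (auto simp: pullback_def remainder_def interpolate_def split_beta
          intro!: fin_functional_if fin_functional_diff fin_functional_add fin_functional_scale fin_functional_divide)
  show "fin_functional (split_C (F - U) A \<otimes>\<^sub>f c0_sum (gaps U) (split_C_ends B)) (\<lambda>h. assemble h x)" for x
    by (cases x) (auto simp: assemble_def interpolate_def split_beta
          intro!: fin_functional_if fin_functional_diff fin_functional_add fin_functional_scale fin_functional_divide)
qed

end

section \<open>Sets of cardinality at most \<open>omega1\<close>\<close>

lemma Cinfinite_omega1: "Cinfinite omega1"
  by (rule Cinfinite_cardSuc) (rule natLeq_Cinfinite)

lemma countable_iff_card_le_natLeq: "countable A \<longleftrightarrow> |A| \<le>o natLeq"
  unfolding countable_card_of_nat
  using card_of_nat ordIso_symmetric ordLeq_ordIso_trans by blast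

lemma card_eq_omega1_iff: "|A| =o omega1 \<longleftrightarrow> |A| \<le>o omega1 \<and> uncountable A"
proof -
  have "uncountable A \<longleftrightarrow> natLeq <o |A|"
    unfolding countable_iff_card_le_natLeq
    by (simp add: not_ordLeq_iff_ordLess card_of_Well_order natLeq_Well_order)
  also have "\<dots> \<longleftrightarrow> omega1 \<le>o |A|"
    by (rule cardSuc_ordLess_ordLeq[OF natLeq_Card_order card_of_Card_order])
  finally show ?thesis
    using ordIso_iff_ordLeq by blast
qed

lemma card_image_le_omega1: "|A| \<le>o omega1 \<Longrightarrow> |f ` A| \<le>o omega1"
  using card_of_image ordLeq_transitive by blast

lemma card_subset_le_omega1: "A \<subseteq> B \<Longrightarrow> |B| \<le>o omega1 \<Longrightarrow> |A| \<le>o omega1"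
  using card_of_mono1 ordLeq_transitive by blast

lemma countable_le_omega1: "countable A \<Longrightarrow> |A| \<le>o omega1"
  unfolding countable_iff_card_le_natLeq
  using cardSuc_ordLeq[OF natLeq_Card_order] ordLeq_transitive by blast

lemma card_Un_le_omega1: "|A| \<le>o omega1 \<Longrightarrow> |B| \<le>o omega1 \<Longrightarrow> |A \<union> B| \<le>o omega1"
  by (rule Un_Cinfinite_bound[OF _ _ Cinfinite_omega1])

lemma card_UN_le_omega1:
  "countable I \<Longrightarrow> (\<And>i. i \<in> I \<Longrightarrow> |A i| \<le>o omega1) \<Longrightarrow> |\<Union>i\<in>I. A i| \<le>o omega1"
  by (rule UNION_Cinfinite_bound[OF countable_le_omega1 _ Cinfinite_omega1]) auto

text \<open>
  The bound on the cardinality is required once and for all, so that in each interval it is enough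
  to find uncountably many points.
\<close>

definition omega1_dense_unit :: "real set \<Rightarrow> bool" where
  "omega1_dense_unit B \<longleftrightarrow> B \<subseteq> {0<..<1} \<and> |B| \<le>o omega1 \<and>
     (\<forall>s t. 0 \<le> s \<and> s < t \<and> t \<le> 1 \<longrightarrow> uncountable (B \<inter> {s<..<t}))"

lemma omega1_dense_unit:
  assumes "omega1_dense_in (top_of_set {0<..<1}) B"
  shows "omega1_dense_unit B"
  unfolding omega1_dense_unit_def
proof (intro conjI allI impI)
  have B: "B \<subseteq> {0<..<1}"
    and dense: "\<And>U. openin (top_of_set {0<..<1}) U \<Longrightarrow> U \<noteq> {} \<Longrightarrow> |B \<inter> U| =o omega1"
    using assms by (auto simp: omega1_dense_in_def)
  show "B \<subseteq> {0<..<1}" by fact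
  have "|B \<inter> {0<..<1}| =o omega1"
    by (rule dense) auto
  then show "|B| \<le>o omega1"
    using B by (simp add: card_eq_omega1_iff Int_absorb2)
  fix s t :: real assume "0 \<le> s \<and> s < t \<and> t \<le> 1"
  then have "openin (top_of_set {0<..<1}) {s<..<t}" "{s<..<t} \<noteq> {}"
    by (auto intro!: open_subset)
  from dense[OF this] show "uncountable (B \<inter> {s<..<t})"
    by (simp add: card_eq_omega1_iff)
qed

lemma omega1_dense_unit_between:
  assumes "omega1_dense_unit B" "0 \<le> s" "s < t" "t \<le> 1"
  obtains b where "b \<in> B" "s < b" "b < t"
proof -
  have "uncountable (B \<inter> {s<..<t})"
    using assms by (auto simp: omega1_dense_unit_def)
  then have "B \<inter> {s<..<t} \<noteq> {}" by (metis countable_empty)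
  then show thesis using that by auto
qed

section \<open>Homogeneity of the split interval under Baumgartner's axiom\<close>

text \<open>The logistic function identifies the open unit interval with the line.\<close>

lemma baumgartner_unit:
  assumes BA: "baumgartner_axiom" and B: "omega1_dense_unit B" and B': "omega1_dense_unit B'"
  obtains g where "strict_mono_on B g" "g ` B = B'"
proof -
  define L where "L x = ln (x / (1 - x))" for x :: real
  define E where "E y = 1 / (1 + exp (- y))" for y :: real
  have EL: "E (L x) = x" if "x \<in> {0<..<1}" for x
  proof -
    have "exp (- L x) = (1 - x) / x"
      using that by (simp add: L_def exp_minus)
    then have "E (L x) = 1 / (1 + (1 - x) / x)"
      by (simp add: E_def)
    also have "\<dots> = x" using that by (simp add: field_simps)
    finally show ?thesis .
  qed
  have E01: "E y \<in> {0<..<1}" for y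
    by (auto simp: E_def add_pos_pos)
  have E_mono: "E y < E z" if "y < z" for y z
    using that by (auto simp: E_def add_pos_pos intro!: divide_strict_left_mono)
  have LE: "L (E y) = y" for y
  proof -
    have "1 + exp (- y) > 0" by (simp add: add_pos_pos)
    then have "E y / (1 - E y) = exp y"
      by (simp add: E_def field_simps exp_minus)
    then show ?thesis by (simp add: L_def)
  qed
  have L_mono: "L x < L y" if "x < y" "x \<in> {0<..<1}" "y \<in> {0<..<1}" for x y
    using E_mono[of "L y" "L x"] EL[OF that(2)] EL[OF that(3)] that(1)
    by (metis linorder_neqE_linordered_idom order.asym)
  have dense: "omega1_dense_in euclidean (L ` B)" if "omega1_dense_unit B" for B
    unfolding omega1_dense_in_def
  proof (intro conjI allI impI)
    fix U :: "real set" assume U: "openin euclidean U \<and> U \<noteq> {}"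
    then obtain y e where y: "y \<in> U" "e > 0" "ball y e \<subseteq> U"
      using open_contains_ball by (metis all_not_in_conv open_openin)
    have "uncountable (B \<inter> {E y<..<E (y + e)})"
      using that E01[of y] E01[of "y+e"] E_mono[of y "y + e"] y(2) by (auto simp: omega1_dense_unit_def)
    moreover have "inj_on L (B \<inter> {E y<..<E (y + e)})"
      using that EL by (intro inj_on_inverseI[of _ E]) (auto simp: omega1_dense_unit_def)
    ultimately have "uncountable (L ` (B \<inter> {E y<..<E (y + e)}))"
      using countable_image_inj_on by blast
    moreover have "L ` (B \<inter> {E y<..<E (y + e)}) \<subseteq> L ` B \<inter> U"
    proof
      fix z assume "z \<in> L ` (B \<inter> {E y<..<E (y + e)})"
      then obtain b where b: "z = L b" "b \<in> B" "E y < b" "b < E (y + e)" by auto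
      have "b \<in> {0<..<1}" using b(2) that by (auto simp: omega1_dense_unit_def)
      then have "y < z" "z < y + e"
        using L_mono[OF b(3) E01] L_mono[OF b(4) _ E01] by (auto simp: b(1) LE)
      then show "z \<in> L ` B \<inter> U" using b y(3) by (auto simp: dist_real_def subset_iff)
    qed
    ultimately have "uncountable (L ` B \<inter> U)"
      using countable_subset by blast
    moreover have "|B| \<le>o omega1" using that by (simp add: omega1_dense_unit_def)
    then have "|L ` B \<inter> U| \<le>o omega1"
      by (rule card_subset_le_omega1[OF Int_lower1 card_image_le_omega1])
    ultimately show "|L ` B \<inter> U| =o omega1"
      by (simp add: card_eq_omega1_iff)
  qed simp
  obtain f where f: "strict_mono_on (L ` B) f" "f ` L ` B = L ` B'"
    using BA dense[OF B] dense[OF B'] unfolding baumgartner_axiom_def by blast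
  have B01: "B \<subseteq> {0<..<1}" "B' \<subseteq> {0<..<1}"
    using B B' by (auto simp: omega1_dense_unit_def)
  show thesis
  proof (rule that[of "\<lambda>x. E (f (L x))"])
    show "strict_mono_on B (\<lambda>x. E (f (L x)))"
      using B01 by (auto intro!: strict_mono_onI E_mono strict_mono_onD[OF f(1)] L_mono)
    have "(\<lambda>x. E (f (L x))) ` B = E ` (f ` L ` B)" by (simp add: image_image)
    also have "\<dots> = E ` L ` B'" by (simp only: f(2))
    also have "\<dots> = (\<lambda>x. E (L x)) ` B'" by (simp add: image_image)
    also have "\<dots> = (\<lambda>x. x) ` B'" using B01 EL by (intro image_cong) auto
    finally show "(\<lambda>x. E (f (L x))) ` B = B'" by simp
  qed
qed

text \<open>
  A point is sent to the supremum of the images of the points of \<open>B\<close> up to it. Density of \<open>B\<close> makes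
  this strictly monotone, density of \<open>B'\<close> makes it surjective, and monotone surjections are
  continuous.
\<close>

lemma dense_iso_extends:
  assumes B: "omega1_dense_unit B" and B': "omega1_dense_unit B'"
    and g: "strict_mono_on B g" "g ` B = B'"
  obtains \<phi> where "strict_mono_on {0..1} \<phi>" "continuous_on {0..1} \<phi>" "\<phi> ` {0..1} = {0..1}" "\<phi> ` B = B'"
proof -
  define S where "S x = insert 0 (g ` (B \<inter> {..x}))" for x
  \<comment> \<open>The identity outside the unit interval makes the image open.\<close>
  define \<phi> where "\<phi> x = (if x \<in> {0..1} then Sup (S x) else x)" for x
  have B01: "B \<subseteq> {0<..<1}" "B' \<subseteq> {0<..<1}"
    using B B' by (auto simp: omega1_dense_unit_def)
  have g01: "0 < g b" "g b < 1" if "b \<in> B" for b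
    using that g(2) B01 by auto
  have g_less: "g b < g b' \<longleftrightarrow> b < b'" if "b \<in> B" "b' \<in> B" for b b'
    using g(1) that by (metis linorder_less_linear not_less_iff_gr_or_eq strict_mono_onD)
  have bdd: "bdd_above (S x)" for x
    using g01 by (intro bdd_aboveI[of _ 1]) (auto simp: S_def less_imp_le)
  have upper: "g b \<le> \<phi> x" if "b \<in> B" "b \<le> x" "x \<in> {0..1}" for b x
    using that bdd by (auto simp: \<phi>_def S_def intro!: cSup_upper)
  have least: "\<phi> x \<le> y" if "x \<in> {0..1}" "0 \<le> y" "\<And>b. b \<in> B \<Longrightarrow> b \<le> x \<Longrightarrow> g b \<le> y" for x y
    using that by (auto simp: \<phi>_def S_def intro!: cSup_least)
  have nonneg: "0 \<le> \<phi> x" if "x \<in> {0..1}" for x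
    using that bdd by (auto simp: \<phi>_def S_def intro!: cSup_upper)
  have in01: "\<phi> x \<in> {0..1}" if "x \<in> {0..1}" for x
    using nonneg[OF that] least[OF that, of 1] g01 by (auto simp: less_imp_le)
  have ext: "\<phi> b = g b" if "b \<in> B" for b
  proof (rule antisym)
    have b: "b \<in> {0..1}" using that B01 by auto
    have "g b' \<le> g b" if "b' \<in> B" "b' \<le> b" for b'
      using g_less[OF \<open>b \<in> B\<close> that(1)] that(2) by linarith
    then show "\<phi> b \<le> g b" using least[OF b, of "g b"] g01[OF that] by simp
    show "g b \<le> \<phi> b" using upper[OF that order_refl b] .
  qed
  have strict: "\<phi> x < \<phi> y" if xy: "x < y" "x \<in> {0..1}" "y \<in> {0..1}" for x y
  proof -
    obtain b where b: "b \<in> B" "x < b" "b < y"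
      using omega1_dense_unit_between[OF B, of x y] xy by auto
    then obtain b' where b': "b' \<in> B" "b < b'" "b' < y"
      using omega1_dense_unit_between[OF B, of b y] xy by auto
    have "\<phi> x \<le> g b"
      using xy b g01[OF b(1)] g_less[of _ b] by (intro least) (auto simp: less_imp_le)
    also have "\<dots> < g b'" using b b' g_less by auto
    also have "\<dots> \<le> \<phi> y" using b' xy by (intro upper) auto
    finally show ?thesis .
  qed
  have surj01: "\<exists>x\<in>{0..1}. \<phi> x = y" if y: "y \<in> {0..1}" for y
  proof -
    define x where "x = Sup (insert 0 {b \<in> B. g b \<le> y})"
    have bdd': "bdd_above (insert 0 {b \<in> B. g b \<le> y})"
      using B01 by (intro bdd_aboveI[of _ 1]) auto
    have x: "x \<in> {0..1}"
      unfolding x_def using bdd' B01 by (auto intro!: cSup_upper cSup_least)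
    have "\<not> \<phi> x < y"
    proof
      assume "\<phi> x < y"
      then obtain b' where "b' \<in> B'" "\<phi> x < b'" "b' < y"
        using omega1_dense_unit_between[OF B', of "\<phi> x" y] nonneg[OF x] y by auto
      then obtain b where b: "b \<in> B" "\<phi> x < g b" "g b < y" using g(2) by auto
      then have "b \<le> x" unfolding x_def using bdd' by (intro cSup_upper) auto
      then show False using upper[OF b(1) _ x] b by simp
    qed
    moreover have "\<not> y < \<phi> x"
    proof
      assume "y < \<phi> x"
      then obtain b where b: "b \<in> B" "b \<le> x" "y < g b"
        using least[OF x, of y] y by force
      obtain b' where "b' \<in> B'" "y < b'" "b' < g b"
        using omega1_dense_unit_between[OF B', of y "g b"] b y g01[OF b(1)] by auto
      then obtain c where c: "c \<in> B" "y < g c" "g c < g b" using g(2) by auto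
      then have "c < x" using b g_less by force
      then obtain d where "d \<in> insert 0 {b \<in> B. g b \<le> y}" "c < d"
        unfolding x_def using bdd' by (auto simp: less_cSup_iff)
      then show False using c g_less[of c d] B01 by auto
    qed
    ultimately show ?thesis using x by (intro bexI[of _ x]) auto
  qed
  have "surj \<phi>"
  proof -
    have "\<exists>x. y = \<phi> x" for y
    proof (cases "y \<in> {0..1}")
      case True then show ?thesis using surj01[of y] by blast
    next
      case False then show ?thesis by (intro exI[of _ y]) (auto simp: \<phi>_def)
    qed
    then show ?thesis by (simp add: surj_def)
  qed
  moreover have "\<phi> x \<le> \<phi> y" if "x \<le> y" for x y
  proof -
    have out: "\<phi> z = z" if "z \<notin> {0..1}" for z using that by (auto simp: \<phi>_def)
    show ?thesis
      using strict[of x y] in01[of x] in01[of y] out[of x] out[of y] that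
      by (cases "x = y"; cases "x \<in> {0..1}"; cases "y \<in> {0..1}") auto
  qed
  ultimately have "continuous_on UNIV \<phi>"
    by (intro continuous_onI_mono) auto
  show thesis
  proof (rule that[of \<phi>])
    show "continuous_on {0..1} \<phi>"
      using \<open>continuous_on UNIV \<phi>\<close> continuous_on_subset by blast
    show "strict_mono_on {0..1} \<phi>" using strict by (auto simp: strict_mono_on_def)
    show "\<phi> ` {0..1} = {0..1}" using surj01 in01 by (auto simp: image_iff) metis
    show "\<phi> ` B = B'" using ext g(2) by auto
  qed
qed

theorem split_interval_unique:
  assumes "baumgartner_axiom" "omega1_dense_unit B" "omega1_dense_unit B'"
  shows "split_C {0..1} B' \<simeq> split_C {0..1} B"
proof -
  obtain g where g: "strict_mono_on B g" "g ` B = B'"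
    using baumgartner_unit[OF assms] .
  obtain \<phi> where \<phi>: "strict_mono_on {0..1} \<phi>" "continuous_on {0..1} \<phi>" "\<phi> ` {0..1} = {0..1}" "\<phi> ` B = B'"
    using dense_iso_extends[OF assms(2,3) g] .
  have "B \<subseteq> {0..1}" using assms(2) by (auto simp: omega1_dense_unit_def)
  from split_C_reparam[OF compact_Icc \<phi>(1,2) this] show ?thesis
    by (simp add: \<phi>(3,4))
qed

section \<open>The split interval absorbs zero-dimensional lines\<close>

lemma split_C_cong: "A \<inter> F = A' \<inter> F \<Longrightarrow> split_C F A = split_C F A'"
  unfolding split_C_def by (intro Collect_cong conj_cong refl) blast

text \<open>
  If there were finitely many gaps, some point of \<open>F\<close> inside the unit interval would be an end point
  of none of them. What the closed gaps leave of the open unit interval would then be a non-empty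
  open subset of \<open>F\<close>.
\<close>

lemma infinite_gaps:
  assumes F: "closed F" "F \<subseteq> {0..1}" "infinite F" "interior F = {}"
  shows "infinite (gaps ({0<..<1} - F))"
proof
  assume fin: "finite (gaps ({0<..<1} - F))"
  let ?U = "{0<..<1} - F"
  have U: "open ?U" "bounded ?U"
    using F(1) by (auto intro: bounded_subset[of "{0<..<1}"])
  have "finite ({0, 1} \<union> fst ` gaps ?U \<union> snd ` gaps ?U)" using fin by simp
  then obtain t where t: "t \<in> F" "t \<notin> {0, 1} \<union> fst ` gaps ?U \<union> snd ` gaps ?U"
    using F(3) finite_subset[of F] by blast
  define O' where "O' = {0<..<1} - (\<Union>n\<in>gaps ?U. {fst n..snd n})"
  have "open O'"
    unfolding O'_def using fin by (intro open_Diff closed_UN) auto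
  moreover have "O' \<subseteq> F"
  proof
    fix x assume x: "x \<in> O'"
    show "x \<in> F"
    proof (rule ccontr)
      assume "x \<notin> F"
      then have "x \<in> ?U" using x by (auto simp: O'_def)
      then obtain u v where "(u, v) \<in> gaps ?U" "u < x" "x < v"
        using gaps_exist[OF U] by blast
      then show False using x by (force simp: O'_def)
    qed
  qed
  moreover have "t \<in> O'"
  proof -
    have "\<not> (u \<le> t \<and> t \<le> v)" if "(u, v) \<in> gaps ?U" for u v
    proof
      assume "u \<le> t \<and> t \<le> v"
      moreover have "t \<noteq> u" "t \<noteq> v" using t(2) that by force+
      ultimately show False using gapsD(4)[OF that, of t] t(1) by auto
    qed
    then show ?thesis using t F(2) by (force simp: O'_def)
  qed
  ultimately show False
    using F(4) interior_maximal by blast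
qed

text \<open>
  Filling every gap of \<open>F\<close> with a scaled copy of the split interval yields a split interval
  again, because the gaps are dense; under the axiom it is the same one.
\<close>

lemma split_interval_decomposes:
  assumes BA: "baumgartner_axiom" and B: "omega1_dense_unit B"
    and F': "compact F" "F \<subseteq> {0..1}" "0 \<in> F" "1 \<in> F" "infinite F" "interior F = {}"
    and A: "A \<subseteq> F \<inter> {0<..<1}" "|A| \<le>o omega1"
  shows "split_C {0..1} B \<simeq> split_C F A \<otimes>\<^sub>f c0_sum (UNIV :: nat set) (split_C_ends B)"
proof -
  define U where "U = {0<..<1} - F"
  have U': "open U" "bounded U" "U \<subseteq> {0..1}" "{0..1} - U = F"
    using F' by (auto simp: U_def less_le compact_imp_closed intro: bounded_subset[of "{0<..<1}"])
  have B01: "B \<subseteq> {0<..<1}" using B by (auto simp: omega1_dense_unit_def)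
  define G where "G = (\<Union>n\<in>gaps U. (\<lambda>s. fst n + s * (snd n - fst n)) ` B)"
  have G: "\<exists>u v s. (u, v) \<in> gaps U \<and> s \<in> B \<and> x = u + s * (v - u) \<and> u < x \<and> x < v" if "x \<in> G" for x
  proof -
    obtain u v s where us: "(u, v) \<in> gaps U" "s \<in> B" "x = u + s * (v - u)"
      using \<open>x \<in> G\<close> by (force simp: G_def)
    then show ?thesis
      using affine_between[of u v s] B01 gapsD(1)[OF us(1)] by fastforce
  qed
  have GU: "G \<subseteq> U" using G gapsD(4) by blast
  define B' where "B' = A \<union> G"
  have B': "omega1_dense_unit B'"
    unfolding omega1_dense_unit_def
  proof (intro conjI allI impI)
    show "B' \<subseteq> {0<..<1}" using A GU by (auto simp: B'_def U_def)
    have "|G| \<le>o omega1"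
      unfolding G_def using B
      by (intro card_UN_le_omega1 countable_gaps card_image_le_omega1) (auto simp: omega1_dense_unit_def)
    then show "|B'| \<le>o omega1" unfolding B'_def using A by (intro card_Un_le_omega1) auto
    fix s t :: real assume st: "0 \<le> s \<and> s < t \<and> t \<le> 1"
    have "\<not> {s<..<t} \<subseteq> F"
      using st F'(6) interior_maximal[of "{s<..<t}" F] by auto
    then obtain x where "x \<in> {s<..<t} - F" by blast
    then have x: "x \<in> U" "s < x" "x < t"
      using st by (auto simp: U_def)
    obtain u v where uv: "(u, v) \<in> gaps U" "u < x" "x < v"
      using gaps_exist[OF U'(1,2) x(1)] .
    define a b where "a = (max s u - u) / (v - u)" and "b = (min t v - u) / (v - u)"
    have vu: "0 < v - u" using uv by auto
    have ab: "0 \<le> a" "a < b" "b \<le> 1"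
      using x uv vu by (auto simp: a_def b_def divide_strict_right_mono)
    have "uncountable (B \<inter> {a<..<b})" using B ab by (auto simp: omega1_dense_unit_def)
    moreover have "inj_on (\<lambda>s. u + s * (v - u)) (B \<inter> {a<..<b})"
      using vu by (auto simp: inj_on_def)
    ultimately have "uncountable ((\<lambda>s. u + s * (v - u)) ` (B \<inter> {a<..<b}))"
      using countable_image_inj_on by blast
    moreover have "(\<lambda>s. u + s * (v - u)) ` (B \<inter> {a<..<b}) \<subseteq> B' \<inter> {s<..<t}"
    proof
      fix y assume "y \<in> (\<lambda>s. u + s * (v - u)) ` (B \<inter> {a<..<b})"
      then obtain r where "y = u + r * (v - u)" "r \<in> B \<inter> {a<..<b}" by blast
      then have r: "y = u + r * (v - u)" "r \<in> B" "a < r" "r < b" by simp_all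
      then have "max s u - u < r * (v - u)" "r * (v - u) < min t v - u"
        using vu by (auto simp: a_def b_def pos_divide_less_eq pos_less_divide_eq)
      moreover have "y \<in> G" using r uv(1) by (force simp: G_def)
      ultimately show "y \<in> B' \<inter> {s<..<t}" using r(1) by (auto simp: B'_def)
    qed
    ultimately show "uncountable (B' \<inter> {s<..<t})" using countable_subset by blast
  qed
  interpret gap_filling "{0..1}" U B' B
  proof
    fix u v s :: real assume uv: "(u, v) \<in> gaps U" and s: "0 < s" "s < 1"
    let ?x = "u + s * (v - u)"
    have x: "u < ?x" "?x < v" using affine_between[OF gapsD(1)[OF uv] s] .
    show "?x \<in> B' \<longleftrightarrow> s \<in> B"
    proof
      assume "?x \<in> B'"
      then have "?x \<in> G" using gapsD(4)[OF uv x] A by (auto simp: B'_def U_def)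
      then obtain u' v' s' where s': "(u', v') \<in> gaps U" "s' \<in> B" "?x = u' + s' * (v' - u')" "u' < ?x" "?x < v'"
        using G by metis
      have "u = u' \<and> v = v'"
        by (rule gaps_unique[OF uv s'(1) x s'(4,5)])
      then show "s \<in> B" using s' gapsD(1)[OF uv] by auto
    next
      assume "s \<in> B" then show "?x \<in> B'" using uv by (force simp: B'_def G_def)
    qed
  qed (use U' in auto)
  have "infinite (gaps U)"
    unfolding U_def using F' by (intro infinite_gaps compact_imp_closed)
  then have "bij_betw (to_nat_on (gaps U)) (gaps U) UNIV"
    by (intro to_nat_on_infinite countable_gaps)
  then have 1: "c0_sum (gaps U) (split_C_ends B) \<simeq> c0_sum (UNIV :: nat set) (split_C_ends B)"
    by (rule c0_sum_reindex)
  have "B' \<inter> F = A \<inter> F" using GU by (auto simp: B'_def U_def)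
  then have 2: "split_C F B' = split_C F A" by (rule split_C_cong)
  have "split_C {0..1} B' \<simeq> split_C F A \<otimes>\<^sub>f c0_sum (gaps U) (split_C_ends B)"
    using split_C_fill_gaps by (simp add: U'(4) 2)
  from fin_iso_trans[OF split_interval_unique[OF BA B' B] fin_iso_trans[OF this fin_iso_prod_cong[OF fin_iso_refl 1]]]
  show ?thesis .
qed

section \<open>Monotone continuous functions on lines\<close>

lemma dyadic_between:
  fixes x y :: real
  assumes "0 \<le> x" "x < y"
  obtains r where "r \<in> dyadics" "x < r" "r < y"
proof -
  have "closure ({x<..<y} \<inter> (\<Union>k m. {of_nat m / 2^k})) = closure {x<..<y}"
    using assms by (intro closure_dyadic_rationals_in_convex_set_pos_1) auto
  then have "{x<..<y} \<inter> dyadics \<noteq> {}"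
    using assms unfolding dyadics_def by auto
  then show thesis using that by auto
qed

text \<open>
  Urysohn's construction along a line: a relation that can be interpolated and implies the strict
  order produces a monotone function that increases only across pairs in the relation. Here the
  values need to be compared with rays only, which gives continuity at once.
\<close>

lemma monotone_Urysohn:
  fixes less R :: "'a \<Rightarrow> 'a \<Rightarrow> bool"
  assumes less: "\<And>x y z. less x y \<Longrightarrow> less y z \<Longrightarrow> less x z" "\<And>x. \<not> less x x"
    "\<And>x y. x \<in> X \<Longrightarrow> y \<in> X \<Longrightarrow> less x y \<or> x = y \<or> less y x"
    and R: "\<And>x y. R x y \<Longrightarrow> x \<in> X \<and> y \<in> X \<and> less x y" "\<And>x y z. R x y \<Longrightarrow> R y z \<Longrightarrow> R x z"
    "\<And>x y. R x y \<Longrightarrow> \<exists>z. R x z \<and> R z y" and ab: "R a b"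
  obtains c :: "'a \<Rightarrow> real" where
    "\<And>t. 0 \<le> c t \<and> c t \<le> 1"
    "\<And>t. t \<in> X \<Longrightarrow> \<not> less a t \<Longrightarrow> c t = 0" "\<And>t. t \<in> X \<Longrightarrow> \<not> less t b \<Longrightarrow> c t = 1"
    "\<And>s t. s \<in> X \<Longrightarrow> t \<in> X \<Longrightarrow> less s t \<Longrightarrow> c s \<le> c t"
    "\<And>s t. s \<in> X \<Longrightarrow> t \<in> X \<Longrightarrow> c s < c t \<Longrightarrow> \<exists>p q. R p q \<and> \<not> less p s \<and> \<not> less t q"
    "\<And>t y. t \<in> X \<Longrightarrow> c t < y \<Longrightarrow> y \<le> 1 \<Longrightarrow> \<exists>p\<in>X. less t p \<and> (\<forall>s\<in>X. less s p \<longrightarrow> c s < y)"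
    "\<And>t y. t \<in> X \<Longrightarrow> y < c t \<Longrightarrow> 0 \<le> y \<Longrightarrow> \<exists>p\<in>X. less p t \<and> (\<forall>s\<in>X. less p s \<longrightarrow> y < c s)"
proof -
  have "\<exists>f :: real \<Rightarrow> 'a. f 0 = a \<and> f 1 = b \<and>
      (\<forall>x\<in>dyadics \<inter> {0..1}. \<forall>y\<in>dyadics \<inter> {0..1}. x < y \<longrightarrow> R (f x) (f y))"
  proof (rule recursion_on_dyadic_fractions)
    show "R a b" by (rule ab)
    show "\<exists>z. R x z \<and> R z y" if "R x y" for x y using that by (rule R(3))
    show "R x z" if "R x y" "R y z" for x y z using that by (rule R(2))
  qed
  then obtain f :: "real \<Rightarrow> 'a" where f: "f 0 = a" "f 1 = b"
    and fR: "\<And>x y. x \<in> dyadics \<inter> {0..1} \<Longrightarrow> y \<in> dyadics \<inter> {0..1} \<Longrightarrow> x < y \<Longrightarrow> R (f x) (f y)"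
    by blast
  define D where "D = dyadics \<inter> {0..1::real}"
  have D01: "0 \<in> D" "1 \<in> D"
    using real_in_dyadics[of 0] real_in_dyadics[of 1] by (auto simp: D_def)
  have D_between: "\<exists>r\<in>D. x < r \<and> r < y" if xy: "0 \<le> x" "x < y" "y \<le> 1" for x y
  proof -
    obtain r where "r \<in> dyadics" "x < r" "r < y" using dyadic_between[OF xy(1,2)] .
    then show ?thesis using xy by (intro bexI[of _ r]) (auto simp: D_def)
  qed
  have fX: "f r \<in> X" if "r \<in> D" for r
  proof (cases "r = 1")
    case False
    then have "R (f r) (f 1)" using that D01 by (intro fR) (auto simp: D_def)
    then show ?thesis using R(1) by blast
  qed (use f R(1)[OF ab] in simp)
  have f_less: "less (f r) (f s)" if "r \<in> D" "s \<in> D" "r < s" for r s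
    using fR[of r s] R(1) that by (auto simp: D_def)
  define c where "c t = Sup (insert 0 {r \<in> D. \<not> less t (f r)})" for t
  have bdd: "bdd_above (insert 0 {r \<in> D. \<not> less t (f r)})" for t
    by (auto simp: D_def)
  have ge: "r \<le> c t" if "r \<in> D" "\<not> less t (f r)" for r t
    unfolding c_def using that bdd by (intro cSup_upper) auto
  have le: "c t \<le> r" if r: "r \<in> D" "less t (f r)" for r t
    unfolding c_def
  proof (rule cSup_least)
    fix x assume "x \<in> insert 0 {r \<in> D. \<not> less t (f r)}"
    then consider "x = 0" | "x \<in> D" "\<not> less t (f x)" by auto
    then show "x \<le> r"
    proof cases
      case 2 then show ?thesis using f_less[of r x] less(1)[OF r(2), of "f x"] r(1) by force
    qed (use r in \<open>auto simp: D_def\<close>)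
  qed auto
  have nonneg: "0 \<le> c t" for t
    unfolding c_def using bdd by (intro cSup_upper) auto
  have le1: "c t \<le> 1" for t
    unfolding c_def by (rule cSup_least) (auto simp: D_def)
  have up: "less t (f r)" if "c t < r" "r \<in> D" for r t
    using ge[OF that(2), of t] that(1) by force
  have down: "\<not> less t (f r)" if "r < c t" "r \<in> D" for r t
    using le[OF that(2), of t] that(1) by force
  show thesis
  proof (rule that[of c])
    fix t assume t: "t \<in> X" "\<not> less a t"
    show "c t = 0"
    proof (rule ccontr)
      assume "c t \<noteq> 0"
      then obtain r where r: "r \<in> D" "0 < r" "r < c t"
        using D_between[of 0 "c t"] nonneg[of t] le1[of t] by auto
      have "less a (f r)" using f_less[of 0 r] r D01 f by simp
      then have "less t (f r)" using less(1,3) t R(1)[OF ab] by metis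
      then show False using down r by blast
    qed
  next
    fix t assume "t \<in> X" "\<not> less t b"
    then show "c t = 1" using ge[of 1 t] le1[of t] D01 f by auto
  next
    fix s t assume st: "less s t"
    show "c s \<le> c t"
    proof (rule ccontr)
      assume "\<not> c s \<le> c t"
      then obtain r where r: "r \<in> D" "c t < r" "r < c s"
        using D_between[of "c t" "c s"] nonneg le1 by auto
      then show False using up[of t r] down[of r s] less(1)[OF st] by blast
    qed
  next
    fix s t assume "s \<in> X" "t \<in> X" and st: "c s < c t"
    obtain r where r: "r \<in> D" "c s < r" "r < c t"
      using D_between[OF nonneg st le1] by auto
    obtain r' where r': "r' \<in> D" "r < r'" "r' < c t"
      using D_between[of r "c t"] r le1[of t] by (auto simp: D_def)
    have "R (f r) (f r')" using fR r r' by (simp add: D_def)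
    moreover have "\<not> less (f r) s" using up[OF r(2,1)] less(1,2) by blast
    moreover have "\<not> less t (f r')" using down r' by blast
    ultimately show "\<exists>p q. R p q \<and> \<not> less p s \<and> \<not> less t q" by blast
  next
    fix t y assume "t \<in> X" "c t < y" "y \<le> 1"
    then obtain r where r: "r \<in> D" "c t < r" "r < y"
      using D_between[OF nonneg] by meson
    have "c s < y" if "less s (f r)" for s using le[OF r(1) that] r(3) by simp
    moreover have "less t (f r)" using up r by blast
    ultimately show "\<exists>p\<in>X. less t p \<and> (\<forall>s\<in>X. less s p \<longrightarrow> c s < y)"
      using fX r(1) by blast
  next
    fix t y assume t: "t \<in> X" "y < c t" "0 \<le> y"
    then obtain r where r: "r \<in> D" "y < r" "r < c t"
      using D_between[of y "c t"] le1[of t] by auto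
    obtain r' where r': "r' \<in> D" "r < r'" "r' < c t"
      using D_between[of r "c t"] r le1[of t] by (auto simp: D_def)
    have "less (f r) t"
      using f_less[OF r(1) r'(1,2)] down[OF r'(3,1)] less(1,3) fX[OF r'(1)] t(1) by metis
    moreover have "y < c s" if "less (f r) s" for s
      using ge[OF r(1), of s] r(2) that less(1,2) by (meson less_le_trans)
    ultimately show "\<exists>p\<in>X. less p t \<and> (\<forall>s\<in>X. less p s \<longrightarrow> y < c s)"
      using fX r(1) by blast
  qed (use nonneg le1 in auto)
qed

text \<open>
  Sum the functions with weights \<open>1 / 2 ^ (i + 1)\<close>. Between points where none of them decreases, the
  increment of the sum is at least the weighted increment of each single one.
\<close>

lemma countable_family_sum:
  fixes \<G> :: "('a \<Rightarrow> real) set"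
  assumes \<G>: "countable \<G>" "\<G> \<noteq> {}"
    and cont: "\<And>g. g \<in> \<G> \<Longrightarrow> continuous_map X euclideanreal g"
    and range: "\<And>g x. g \<in> \<G> \<Longrightarrow> 0 \<le> g x \<and> g x \<le> 1"
  obtains \<theta> w where "continuous_map X euclideanreal \<theta>" "\<And>x. 0 \<le> \<theta> x \<and> \<theta> x \<le> (1::real)"
    "\<And>g. g \<in> \<G> \<Longrightarrow> (0::real) < w g"
    "\<And>x y g. \<forall>g\<in>\<G>. g x \<le> g y \<Longrightarrow> g \<in> \<G> \<Longrightarrow> w g * (g y - g x) \<le> \<theta> y - \<theta> x"
proof -
  define h where "h i x = (1/2) ^ Suc i * from_nat_into \<G> i x" for i x
  have mem: "from_nat_into \<G> i \<in> \<G>" for i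
    using \<G>(2) by (rule from_nat_into)
  have h: "0 \<le> h i x" "h i x \<le> (1/2) ^ Suc i" for i x
    using range[OF mem, of i x] by (auto simp: h_def mult_left_le)
  have half: "(\<lambda>i. (1/2::real) ^ Suc i) sums 1"
    by (rule power_half_series)
  have sm: "summable (\<lambda>i. h i x)" for x
  proof (rule summable_comparison_test'[OF sums_summable[OF half], of 0])
    show "norm (h i x) \<le> (1 / 2) ^ Suc i" for i using h[of i x] by simp
  qed
  define \<theta> where "\<theta> x = (\<Sum>i. h i x)" for x
  have unif: "uniform_limit (topspace X) (\<lambda>n x. \<Sum>i<n. h i x) \<theta> sequentially"
    unfolding \<theta>_def using h sums_summable[OF half] by (intro Weierstrass_m_test[of _ _ "\<lambda>i. (1/2) ^ Suc i"]) auto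
  have cont_h: "continuous_map X euclideanreal (h i)" for i
    unfolding h_def[abs_def] using cont[OF mem] by (intro continuous_intros)
  have "continuous_map X euclideanreal \<theta>"
  proof -
    have "continuous_map X Met_TC.mtopology \<theta>"
    proof (rule Met_TC.continuous_map_uniform_limit[where F=sequentially and f="\<lambda>n x. \<Sum>i<n. h i x"])
      show "\<forall>\<^sub>F n in sequentially. continuous_map X Met_TC.mtopology (\<lambda>x. \<Sum>i<n. h i x)"
        using cont_h by (intro always_eventually allI) (auto intro!: continuous_intros)
      show "\<forall>\<^sub>F n in sequentially. \<forall>x\<in>topspace X. \<theta> x \<in> UNIV \<and> dist (\<Sum>i<n. h i x) (\<theta> x) < \<epsilon>" if "0 < \<epsilon>" for \<epsilon>
        using uniform_limitD[OF unif that] by simp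
    qed simp
    then show ?thesis by simp
  qed
  moreover have "0 \<le> \<theta> x \<and> \<theta> x \<le> 1" for x
    using suminf_nonneg[OF sm h(1)] suminf_le[OF h(2) sm sums_summable[OF half], of x] sums_unique[OF half]
    by (simp add: \<theta>_def)
  moreover define w where "w g = (1/2::real) ^ Suc (to_nat_on \<G> g)" for g
  have "w g * (g y - g x) \<le> \<theta> y - \<theta> x" if mono: "\<forall>g\<in>\<G>. g x \<le> g y" and g: "g \<in> \<G>" for x y g
  proof -
    have eq: "\<theta> y - \<theta> x = (\<Sum>i. h i y - h i x)"
      unfolding \<theta>_def using sm by (intro suminf_diff)
    have "(\<Sum>i\<in>{to_nat_on \<G> g}. h i y - h i x) \<le> (\<Sum>i. h i y - h i x)"
      using sm mono mem by (intro sum_le_suminf summable_diff) (auto simp: h_def)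
    then show ?thesis
      using \<G>(1) g by (simp add: eq h_def w_def right_diff_distrib)
  qed
  moreover have "0 < w g" for g by (simp add: w_def)
  ultimately show thesis using that by blast
qed

section \<open>Zero-dimensional lines with uncountably many split points\<close>

text \<open>
  Otherwise every rational number in the interval cuts off a countable part of \<open>A\<close> on one side, and
  these parts cover all of \<open>A\<close> with the exception of at most one point.
\<close>

lemma uncountable_splits:
  fixes A :: "real set"
  assumes "uncountable (A \<inter> {p<..<q})"
  shows "\<exists>z. p < z \<and> z < q \<and> uncountable (A \<inter> {p<..<z}) \<and> uncountable (A \<inter> {z<..<q})"
proof (rule ccontr)
  assume no: "\<not> ?thesis"
  define L where "L = {z \<in> \<rat> \<inter> {p<..<q}. countable (A \<inter> {p<..<z})}"
  define R where "R = {z \<in> \<rat> \<inter> {p<..<q}. countable (A \<inter> {z<..<q})}"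
  define C where "C = (\<Union>z\<in>L. A \<inter> {p<..<z}) \<union> (\<Union>z\<in>R. A \<inter> {z<..<q})"
  have "countable L" "countable R"
    by (auto simp: L_def R_def intro: countable_subset[OF _ countable_rat])
  then have "countable C"
    unfolding C_def by (intro countable_Un countable_UN) (auto simp: L_def R_def)
  \<comment> \<open>Two points outside \<open>C\<close> would be separated by a rational, which puts one of them into \<open>C\<close>.\<close>
  have less: False if x: "x \<in> A \<inter> {p<..<q} - C" and y: "y \<in> A \<inter> {p<..<q} - C" and "x < y" for x y
  proof -
    obtain z where z: "z \<in> \<rat>" "x < z" "z < y"
      using Rats_dense_in_real[OF \<open>x < y\<close>] by blast
    then have "z \<in> L \<or> z \<in> R"
      using no that x y by (auto simp: L_def R_def)
    then show False
      using x y z by (auto simp: C_def)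
  qed
  obtain x where x: "x \<in> A \<inter> {p<..<q} - C"
    using assms \<open>countable C\<close> countable_subset[of "A \<inter> {p<..<q}" C] by blast
  have "A \<inter> {p<..<q} \<subseteq> insert x C"
    using less[OF x] less[OF _ x] by (auto simp: not_less_iff_gr_or_eq) (metis Diff_iff Int_iff greaterThanLessThan_iff linorder_neqE_linordered_idom)
  then show False
    using assms \<open>countable C\<close> countable_subset countable_insert by metis
qed

lemma countable_Int_Icc:
  fixes A :: "real set"
  assumes "countable (A \<inter> {u<..<v})"
  shows "countable (A \<inter> {u..v})"
proof -
  have "A \<inter> {u..v} \<subseteq> {u, v} \<union> A \<inter> {u<..<v}" by auto
  then show ?thesis
    using assms by (meson countable_Un countable_empty countable_insert countable_subset)
qed

text \<open>
  A Cantor function adapted to \<open>A\<close>: it is constant exactly across those intervals that contain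
  only countably many points of \<open>A\<close>.
\<close>

lemma adapted_Cantor_function:
  fixes A :: "real set"
  assumes A: "A \<subseteq> {0<..<1}" "uncountable A"
  obtains c :: "real \<Rightarrow> real" where "continuous_on UNIV c" "c 0 = 0" "c 1 = 1"
    "\<And>s t. s \<le> t \<Longrightarrow> c s \<le> c t"
    "\<And>s t. s < t \<Longrightarrow> c s < c t \<longleftrightarrow> uncountable (A \<inter> {s<..<t})"
proof -
  define R where "R p q \<longleftrightarrow> p < q \<and> uncountable (A \<inter> {p<..<q})" for p q
  have R_mono: "R p' q'" if "R p q" "p' \<le> p" "q \<le> q'" for p q p' q'
  proof -
    have "A \<inter> {p<..<q} \<subseteq> A \<inter> {p'<..<q'}" using that by auto
    then show ?thesis using that countable_subset unfolding R_def by (metis dual_order.strict_trans1 dual_order.strict_trans2)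
  qed
  have R_trans: "R p r" if "R p q" "R q r" for p q r
    using R_mono[OF that(1), of p r] that(2) by (auto simp: R_def)
  have R_split: "\<exists>z. R p z \<and> R z q" if "R p q" for p q
    using uncountable_splits[of A p q] that unfolding R_def by metis
  define good where "good p q g \<longleftrightarrow> continuous_on UNIV g \<and> (\<forall>t. 0 \<le> g t \<and> g t \<le> 1) \<and>
      (\<forall>t\<le>p. g t = 0) \<and> (\<forall>t\<ge>q. g t = 1) \<and> (\<forall>s t. s \<le> t \<longrightarrow> g s \<le> g t) \<and>
      (\<forall>s t. g s < g t \<longrightarrow> R s t)" for p q and g :: "real \<Rightarrow> real"
  have ex: "\<exists>g. good p q g" if pq: "R p q" for p q
  proof -
    obtain g :: "real \<Rightarrow> real" where g:
      "\<And>t. 0 \<le> g t \<and> g t \<le> 1"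
      "\<And>t. t \<in> UNIV \<Longrightarrow> \<not> p < t \<Longrightarrow> g t = 0" "\<And>t. t \<in> UNIV \<Longrightarrow> \<not> t < q \<Longrightarrow> g t = 1"
      "\<And>s t. s \<in> UNIV \<Longrightarrow> t \<in> UNIV \<Longrightarrow> s < t \<Longrightarrow> g s \<le> g t"
      "\<And>s t. s \<in> UNIV \<Longrightarrow> t \<in> UNIV \<Longrightarrow> g s < g t \<Longrightarrow> \<exists>p q. R p q \<and> \<not> p < s \<and> \<not> t < q"
      "\<And>t y. t \<in> UNIV \<Longrightarrow> g t < y \<Longrightarrow> y \<le> 1 \<Longrightarrow> \<exists>p\<in>UNIV. t < p \<and> (\<forall>s\<in>UNIV. s < p \<longrightarrow> g s < y)"
      "\<And>t y. t \<in> UNIV \<Longrightarrow> y < g t \<Longrightarrow> 0 \<le> y \<Longrightarrow> \<exists>p\<in>UNIV. p < t \<and> (\<forall>s\<in>UNIV. p < s \<longrightarrow> y < g s)"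
    proof (rule monotone_Urysohn[where X=UNIV and less="(<)" and R=R and a=p and b=q])
      show "\<exists>z. R x z \<and> R z y" if "R x y" for x y using R_split that .
      show "R x z" if "R x y" "R y z" for x y z using R_trans that .
      show "x \<in> UNIV \<and> y \<in> UNIV \<and> x < y" if "R x y" for x y using that by (simp add: R_def)
      show "x < y \<or> x = y \<or> y < x" for x y :: real by auto
      show "x < z" if "x < y" "y < z" for x y z :: real using that by simp
      show "R p q" by (rule pq)
    qed (simp, rule that, assumption+)
    have cont: "\<exists>d>0. \<forall>s. \<bar>s - t\<bar> < d \<longrightarrow> \<bar>g s - g t\<bar> < e" if e: "0 < e" for t e
    proof -
      obtain u where u: "t < u" "\<And>s. s < u \<Longrightarrow> g s < g t + e"
      proof (cases "g t + e \<le> 1")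
        case True then show thesis using g(6)[of t "g t + e"] e that by auto
      next
        case False
        then have "g s < g t + e" for s using g(1)[of s] by linarith
        then show thesis using that[of "t + 1"] by auto
      qed
      obtain l where l: "l < t" "\<And>s. l < s \<Longrightarrow> g t - e < g s"
      proof (cases "0 \<le> g t - e")
        case True then show thesis using g(7)[of t "g t - e"] e that by auto
      next
        case False
        then have "g t - e < g s" for s using g(1)[of s] by linarith
        then show thesis using that[of "t - 1"] by auto
      qed
      have "\<bar>g s - g t\<bar> < e" if "\<bar>s - t\<bar> < min (u - t) (t - l)" for s
      proof -
        have "s < u" "l < s" using that by linarith+
        then show ?thesis using u(2)[of s] l(2)[of s] by linarith
      qed
      then show ?thesis using u(1) l(1) by (intro exI[of _ "min (u - t) (t - l)"]) auto
    qed
    have "continuous_on UNIV g"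
      unfolding continuous_on_iff dist_real_def using cont by simp
    moreover have "R s t" if "g s < g t" for s t
      using g(5)[of s t] that R_mono by (auto simp: not_less)
    ultimately have "good p q g"
      using g(1-4) by (auto simp: good_def le_less)
    then show ?thesis by blast
  qed
  \<comment> \<open>Rational pairs suffice: every pair in \<open>R\<close> has a rational pair in \<open>R\<close> inside.\<close>
  define P where "P = {(p, q). p \<in> \<rat> \<and> q \<in> \<rat> \<and> R p q}"
  define \<G> where "\<G> = (\<lambda>(p, q). SOME g. good p q g) ` P"
  have good: "good p q (SOME g. good p q g)" if "(p, q) \<in> P" for p q
    using someI_ex[OF ex[of p q]] that by (simp add: P_def)
  have R01: "R 0 1"
  proof -
    have "A \<inter> {0<..<1} = A" using A(1) by blast
    then show ?thesis using A(2) by (simp add: R_def)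
  qed
  then have "(0, 1) \<in> P" by (simp add: P_def)
  have "countable P"
    by (rule countable_subset[of _ "\<rat> \<times> \<rat>"]) (auto simp: P_def countable_rat)
  then have \<G>: "countable \<G>" "\<G> \<noteq> {}"
    using \<open>(0, 1) \<in> P\<close> by (auto simp: \<G>_def)
  have \<G>D: "\<exists>p q. (p, q) \<in> P \<and> good p q g" if "g \<in> \<G>" for g
    using that good by (auto simp: \<G>_def)
  obtain \<theta> w where \<theta>: "continuous_map euclideanreal euclideanreal \<theta>" "\<And>x. 0 \<le> \<theta> x \<and> \<theta> x \<le> (1::real)"
    "\<And>g. g \<in> \<G> \<Longrightarrow> (0::real) < w g"
    "\<And>x y g. \<forall>g\<in>\<G>. g x \<le> g y \<Longrightarrow> g \<in> \<G> \<Longrightarrow> w g * (g y - g x) \<le> \<theta> y - \<theta> x"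
  proof (rule countable_family_sum[OF \<G>])
    show "continuous_map euclideanreal euclideanreal g" "0 \<le> g x \<and> g x \<le> 1" if "g \<in> \<G>" for g x
      using \<G>D[OF that] by (auto simp: good_def)
  qed (rule that, assumption+)
  have mono: "g s \<le> g t" if "g \<in> \<G>" "s \<le> t" for g s t
    using \<G>D[OF that(1)] that(2) by (auto simp: good_def)
  have \<theta>_mono: "\<theta> s \<le> \<theta> t" if st: "s \<le> t" for s t
  proof -
    obtain g where g: "g \<in> \<G>" using \<G>(2) by blast
    have "0 \<le> w g * (g t - g s)" using \<theta>(3)[OF g] mono[OF g st] by simp
    also have "\<dots> \<le> \<theta> t - \<theta> s" using g mono st by (intro \<theta>(4)) auto
    finally show ?thesis by simp
  qed
  have iff: "\<theta> s < \<theta> t \<longleftrightarrow> R s t" if st: "s < t" for s t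
  proof
    assume "R s t"
    obtain z1 where z1: "R s z1" "R z1 t" using R_split[OF \<open>R s t\<close>] by blast
    obtain z2 where z2: "R z1 z2" "R z2 t" using R_split[OF z1(2)] by blast
    have "s < z1" "z2 < t" using z1 z2 by (auto simp: R_def)
    obtain p where p: "p \<in> \<rat>" "s < p" "p < z1" using Rats_dense_in_real[OF \<open>s < z1\<close>] by blast
    obtain q where q: "q \<in> \<rat>" "z2 < q" "q < t" using Rats_dense_in_real[OF \<open>z2 < t\<close>] by blast
    have pq: "(p, q) \<in> P"
      using R_mono[OF z2(1), of p q] p q by (auto simp: P_def)
    define g where "g = (SOME g. good p q g)"
    have g: "g \<in> \<G>" "good p q g"
      using pq good[OF pq] by (force simp: \<G>_def g_def)+
    have "0 < w g * (g t - g s)"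
      using g p q \<theta>(3)[OF g(1)] by (auto simp: good_def)
    also have "\<dots> \<le> \<theta> t - \<theta> s" using g mono st by (intro \<theta>(4)) auto
    finally show "\<theta> s < \<theta> t" by simp
  next
    assume less: "\<theta> s < \<theta> t"
    show "R s t"
    proof (rule ccontr)
      assume no: "\<not> R s t"
      have "g t \<le> g s" if "g \<in> \<G>" for g
        using \<G>D[OF that] no by (force simp: good_def not_less[symmetric])
      moreover obtain g where g: "g \<in> \<G>" using \<G>(2) by blast
      ultimately have "w g * (g s - g t) \<le> \<theta> s - \<theta> t" "g s = g t"
        using \<theta>(4)[of t s g] mono[OF g, of s t] st by force+
      then show False using less by simp
    qed
  qed
  have "\<theta> 0 < \<theta> 1" using iff[of 0 1] R01 by simp
  then have m: "0 < \<theta> 1 - \<theta> 0" by simp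
  show thesis
  proof (rule that[of "\<lambda>t. (\<theta> t - \<theta> 0) / (\<theta> 1 - \<theta> 0)"])
    show "continuous_on UNIV (\<lambda>t. (\<theta> t - \<theta> 0) / (\<theta> 1 - \<theta> 0))"
      using \<theta>(1) m by (intro continuous_intros) auto
    show "(\<theta> s - \<theta> 0) / (\<theta> 1 - \<theta> 0) \<le> (\<theta> t - \<theta> 0) / (\<theta> 1 - \<theta> 0)" if "s \<le> t" for s t
      using \<theta>_mono[OF that] m by (simp add: divide_right_mono)
    show "(\<theta> s - \<theta> 0) / (\<theta> 1 - \<theta> 0) < (\<theta> t - \<theta> 0) / (\<theta> 1 - \<theta> 0) \<longleftrightarrow> uncountable (A \<inter> {s<..<t})"
      if "s < t" for s t
      using iff[OF that] m that by (simp add: divide_less_cancel R_def)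
  qed (use m in auto)
qed

text \<open>
  Collapsing the intervals on which the Cantor function is constant maps the line onto a split
  interval. An interval that is collapsed to \<open>y\<close> contains a gap of \<open>F\<close>; sending what lies left and
  right of it to the two copies of \<open>y\<close> makes the map continuous, and the end points of the collapsed
  intervals form a section of it.
\<close>

lemma split_interval_is_factor:
  assumes F: "compact F" "F \<subseteq> {0..1}" "interior F = {}"
    and A: "A \<subseteq> F \<inter> {0<..<1}" "|A| \<le>o omega1" "uncountable A"
  obtains B E where "omega1_dense_unit B" "split_C F A \<simeq> split_C {0..1} B \<otimes>\<^sub>f (E :: (real \<times> bool \<Rightarrow> real) set)"
proof -
  obtain c :: "real \<Rightarrow> real" where c: "continuous_on UNIV c" "c 0 = 0" "c 1 = 1"
    "\<And>s t. s \<le> t \<Longrightarrow> c s \<le> c t"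
    "\<And>s t. s < t \<Longrightarrow> c s < c t \<longleftrightarrow> uncountable (A \<inter> {s<..<t})"
    using adapted_Cantor_function[of A] A by blast
  have closed_A: "x \<in> F" if "\<And>e. 0 < e \<Longrightarrow> \<exists>a\<in>A. \<bar>a - x\<bar> < e" for x
  proof -
    have "x \<in> closure F"
      unfolding closure_approachable dist_real_def using that A(1) by (meson IntD1 subsetD)
    then show ?thesis using F(1) by (simp add: compact_imp_closed)
  qed
  define fib where "fib y = {t \<in> {0..1}. c t = y}" for y
  have fib: "compact (fib y)" for y
  proof -
    have "fib y = {0..1} \<inter> c -` {y}" by (auto simp: fib_def)
    moreover have "closed (c -` {y})"
      using continuous_closed_vimage[of "{y}" c] c(1) by (simp add: continuous_on_eq_continuous_at)
    ultimately show ?thesis by (simp add: compact_Int_closed)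
  qed
  have fib_ne: "fib y \<noteq> {}" if "y \<in> {0..1}" for y
    using IVT'[of c 0 y 1] c(2,3) that continuous_on_subset[OF c(1)] by (auto simp: fib_def)
  define l r where "l y = Inf (fib y)" and "r y = Sup (fib y)" for y
  have lr: "l y \<in> fib y" "r y \<in> fib y" "\<And>t. t \<in> fib y \<Longrightarrow> l y \<le> t" "\<And>t. t \<in> fib y \<Longrightarrow> t \<le> r y"
    if y: "y \<in> {0..1}" for y
  proof -
    have "closed (fib y)" "bdd_below (fib y)" "bdd_above (fib y)"
      using fib[of y] by (auto simp: compact_imp_closed compact_imp_bounded bounded_imp_bdd_below bounded_imp_bdd_above)
    then show "l y \<in> fib y" "r y \<in> fib y" "\<And>t. t \<in> fib y \<Longrightarrow> l y \<le> t" "\<And>t. t \<in> fib y \<Longrightarrow> t \<le> r y"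
      using fib_ne[OF y] unfolding l_def r_def
      by (auto intro: closed_contains_Inf closed_contains_Sup cInf_lower cSup_upper)
  qed
  have c_l: "c (l y) = y" "0 \<le> l y" "l y \<le> 1" and c_r: "c (r y) = y" "0 \<le> r y" "r y \<le> 1" if "y \<in> {0..1}" for y
    using lr(1,2)[OF that] by (auto simp: fib_def)
  have before_l: "c t < y" if "y \<in> {0..1}" "0 \<le> t" "t < l y" for t y
  proof -
    have "c t \<le> y" using c(4)[of t "l y"] c_l[OF that(1)] that(3) by simp
    moreover have "c t \<noteq> y" using lr(3)[OF that(1), of t] that c_l(3)[OF that(1)] by (auto simp: fib_def)
    ultimately show ?thesis by simp
  qed
  have after_r: "y < c t" if "y \<in> {0..1}" "t \<le> 1" "r y < t" for t y
  proof -
    have "y \<le> c t" using c(4)[of "r y" t] c_r[OF that(1)] that(3) by simp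
    moreover have "c t \<noteq> y" using lr(4)[OF that(1), of t] that c_r(2)[OF that(1)] by (auto simp: fib_def)
    ultimately show ?thesis by simp
  qed
  have mid: "c t = y" if "y \<in> {0..1}" "l y \<le> t" "t \<le> r y" for t y
    using c(4)[OF that(2)] c(4)[OF that(3)] c_l(1)[OF that(1)] c_r(1)[OF that(1)] by simp
  have l_F: "l y \<in> F" if y: "0 < y" "y \<le> 1" for y
  proof (rule closed_A)
    fix e :: real assume e: "0 < e"
    have y01: "y \<in> {0..1}" using y by simp
    have l0: "0 < l y" using c_l[OF y01] c(2) y by (cases "l y = 0") auto
    define t where "t = max 0 (l y - e)"
    have t: "0 \<le> t" "t < l y" using l0 e by (auto simp: t_def)
    then have "uncountable (A \<inter> {t<..<l y})"
      using before_l[OF y01 t] c_l(1)[OF y01] c(5)[OF t(2)] by simp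
    then obtain a where "a \<in> A" "t < a" "a < l y" by (metis IntE all_not_in_conv countable_empty greaterThanLessThan_iff)
    then show "\<exists>a\<in>A. \<bar>a - l y\<bar> < e" by (intro bexI[of _ a]) (auto simp: t_def)
  qed
  have r_F: "r y \<in> F" if y: "0 \<le> y" "y < 1" for y
  proof (rule closed_A)
    fix e :: real assume e: "0 < e"
    have y01: "y \<in> {0..1}" using y by simp
    have r1: "r y < 1" using c_r[OF y01] c(3) y by (cases "r y = 1") auto
    define t where "t = min 1 (r y + e)"
    have t: "t \<le> 1" "r y < t" using r1 e by (auto simp: t_def)
    then have "uncountable (A \<inter> {r y<..<t})"
      using after_r[OF y01 t] c_r(1)[OF y01] c(5)[OF t(2)] by simp
    then obtain a where "a \<in> A" "r y < a" "a < t" by (metis IntE all_not_in_conv countable_empty greaterThanLessThan_iff)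
    then show "\<exists>a\<in>A. \<bar>a - r y\<bar> < e" by (intro bexI[of _ a]) (auto simp: t_def)
  qed
  define Y where "Y = {y \<in> {0<..<1}. l y < r y}"
  define B where "B = Y \<union> (c ` A \<inter> {0<..<1})"
  have "countable Y"
  proof -
    define U where "U = (\<Union>y\<in>Y. {l y<..<r y})"
    have "inj_on (\<lambda>y. {l y<..<r y}) Y"
    proof (rule inj_onI)
      fix x y assume x: "x \<in> Y" and y: "y \<in> Y" and eq: "{l x<..<r x} = {l y<..<r y}"
      obtain t where t: "l x < t" "t < r x" using x dense by (auto simp: Y_def)
      then have "l y < t" "t < r y" using eq by auto
      then show "x = y" using mid[of x t] mid[of y t] t x y by (auto simp: Y_def)
    qed
    moreover have "countable ((\<lambda>y. {l y<..<r y}) ` Y)"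
    proof (rule countable_disjoint_open_subsets)
      show "disjoint ((\<lambda>y. {l y<..<r y}) ` Y)"
      proof (rule disjointI)
        fix a b assume "a \<in> (\<lambda>y. {l y<..<r y}) ` Y" "b \<in> (\<lambda>y. {l y<..<r y}) ` Y" "a \<noteq> b"
        then obtain x y where xy: "x \<in> Y" "y \<in> Y" "a = {l x<..<r x}" "b = {l y<..<r y}" "x \<noteq> y" by auto
        have "False" if "t \<in> a" "t \<in> b" for t
          using mid[of x t] mid[of y t] that xy by (auto simp: Y_def)
        then show "a \<inter> b = {}" by blast
      qed
    qed auto
    ultimately show ?thesis using countable_image_inj_on by blast
  qed
  have B: "omega1_dense_unit B"
    unfolding omega1_dense_unit_def
  proof (intro conjI allI impI)
    show "B \<subseteq> {0<..<1}" by (auto simp: B_def Y_def)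
    have "|c ` A \<inter> {0<..<1}| \<le>o omega1"
      by (rule card_subset_le_omega1[OF Int_lower1 card_image_le_omega1[OF A(2)]])
    then show "|B| \<le>o omega1"
      unfolding B_def using countable_le_omega1[OF \<open>countable Y\<close>] by (intro card_Un_le_omega1)
    fix s t :: real assume st: "0 \<le> s \<and> s < t \<and> t \<le> 1"
    have s01: "s \<in> {0..1}" and t01: "t \<in> {0..1}" using st by auto
    have lt: "r s < l t"
    proof (rule ccontr)
      assume "\<not> r s < l t"
      then show False using c(4)[of "l t" "r s"] c_l(1)[OF t01] c_r(1)[OF s01] st by simp
    qed
    then have unc: "uncountable (A \<inter> {r s<..<l t})"
      using c(5)[OF lt] c_l(1)[OF t01] c_r(1)[OF s01] st by simp
    have fib_A: "countable (A \<inter> fib y)" if "y \<in> {0..1}" for y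
    proof -
      have "A \<inter> fib y \<subseteq> A \<inter> {l y..r y}" using lr(3,4)[OF that] by auto
      moreover have "countable (A \<inter> {l y..r y})"
        using c(5)[of "l y" "r y"] c_l(1)[OF that] c_r(1)[OF that]
        by (cases "l y < r y") (auto intro!: countable_Int_Icc)
      ultimately show ?thesis using countable_subset by blast
    qed
    have fib_c: "countable (A \<inter> {r s<..<l t} \<inter> c -` {y})" if "y \<in> {0..1}" for y
    proof (rule countable_subset[OF _ fib_A[OF that]])
      show "A \<inter> {r s<..<l t} \<inter> c -` {y} \<subseteq> A \<inter> fib y"
        using A(1) by (auto simp: fib_def)
    qed
    have unc': "uncountable (c ` (A \<inter> {r s<..<l t}))"
    proof
      assume cnt: "countable (c ` (A \<inter> {r s<..<l t}))"
      have "A \<inter> {r s<..<l t} \<subseteq> (\<Union>y\<in>c ` (A \<inter> {r s<..<l t}). A \<inter> {r s<..<l t} \<inter> c -` {y})" by blast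
      moreover have "c x \<in> {0..1}" if "x \<in> A" for x
        using c(4)[of 0 x] c(4)[of x 1] c(2,3) A(1) that by force
      then have "countable (\<Union>y\<in>c ` (A \<inter> {r s<..<l t}). A \<inter> {r s<..<l t} \<inter> c -` {y})"
        using cnt fib_c by (intro countable_UN) auto
      ultimately show False using unc countable_subset by blast
    qed
    have "c ` (A \<inter> {r s<..<l t}) \<subseteq> B \<inter> {s<..<t}"
    proof
      fix y assume "y \<in> c ` (A \<inter> {r s<..<l t})"
      then obtain a where a: "a \<in> A" "y = c a" "r s < a" "a < l t" by auto
      then have "s < y" "y < t"
        using after_r[OF s01, of a] before_l[OF t01, of a] A(1) by force+
      then show "y \<in> B \<inter> {s<..<t}" using a st by (auto simp: B_def)
    qed
    then show "uncountable (B \<inter> {s<..<t})" using unc' countable_subset by blast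
  qed
  have B01: "0 \<notin> B" "1 \<notin> B" by (auto simp: B_def Y_def)
  have "\<exists>z. l y < z \<and> z < r y \<and> z \<notin> F" if "y \<in> Y" for y
  proof -
    have "\<not> {l y<..<r y} \<subseteq> F"
      using that F(3) interior_maximal[of "{l y<..<r y}" F] by (auto simp: Y_def)
    then show ?thesis by auto
  qed
  then obtain z where z: "\<And>y. y \<in> Y \<Longrightarrow> l y < z y \<and> z y < r y \<and> z y \<notin> F" by metis
  have c01: "c t \<in> {0..1}" if "t \<in> F" for t
    using c(4)[of 0 t] c(4)[of t 1] c(2,3) F(2) that by force
  have c_near: "\<exists>d>0. \<forall>s. \<bar>s - t\<bar> < d \<longrightarrow> \<bar>c s - c t\<bar> < e" if "0 < e" for t e
    using c(1) that unfolding continuous_on_iff dist_real_def by auto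
  have uniq: "t = l y" "t = r y" if "y \<in> {0<..<1}" "y \<notin> Y" "t \<in> {0..1}" "c t = y" for t y
    using that lr(3,4)[of y t] by (auto simp: Y_def fib_def)

  \<comment> \<open>\<open>\<iota>\<close> is the section and \<open>\<kappa>\<close> the collapsing map. At \<open>0\<close> and \<open>1\<close> both use the inner copy,
    because the outer copies of the ends are approached by no other points.\<close>
  define \<iota> where "\<iota> = (\<lambda>(y, b). if y = 0 then (r 0, True) else if y = 1 then (l 1, False)
      else if b then (r y, True) else (l y, False))"
  define \<kappa> where "\<kappa> = (\<lambda>(t, b). if c t = 0 then (0, True) else if c t = 1 then (1, False)
      else if c t \<in> Y then (c t, z (c t) < t) else (c t, b))"
  have \<iota>: "split_map {0..1} B F A \<iota>"
    unfolding split_map_def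
  proof (intro conjI ballI allI impI)
    fix y :: real and b assume "y \<in> {0..1}"
    then show "fst (\<iota> (y, b)) \<in> F" using l_F[of y] r_F[of y] by (auto simp: \<iota>_def)
  next
    fix y assume y: "y \<in> {0..1} - B"
    then show "\<iota> (y, False) = \<iota> (y, True) \<or> fst (\<iota> (y, False)) = fst (\<iota> (y, True)) \<and> fst (\<iota> (y, False)) \<notin> A"
      using c_l[of y] c_r[of y] uniq[of y "r y"] imageI[of "l y" A c] by (cases "y = 0 \<or> y = 1") (auto simp: \<iota>_def B_def)
  next
    fix y \<eta> :: real assume y: "y \<in> {0..1}" and \<eta>: "0 < \<eta>"
    have fst_in: "fst (\<iota> (x, b)) \<in> fib x" if "x \<in> {0..1}" for x b
      using lr(1,2)[OF that] by (auto simp: \<iota>_def)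
    show "\<exists>\<delta>>0. \<forall>s\<in>{0..1}. \<forall>b. y - \<delta> < s \<and> s < y \<longrightarrow>
        \<iota> (s, b) = \<iota> (y, False) \<or> (\<not> snd (\<iota> (y, False)) \<and>
          fst (\<iota> (y, False)) - \<eta> < fst (\<iota> (s, b)) \<and> fst (\<iota> (s, b)) < fst (\<iota> (y, False)))"
    proof (cases "y = 0")
      case False
      then have \<iota>y: "\<iota> (y, False) = (l y, False)" by (simp add: \<iota>_def)
      define x where "x = max 0 (l y - \<eta>)"
      have "0 < l y" using c_l[OF y] c(2) False by (cases "l y = 0") auto
      then have x: "0 \<le> x" "x < l y" using \<eta> by (auto simp: x_def)
      have "l y - \<eta> < fst (\<iota> (s, b)) \<and> fst (\<iota> (s, b)) < l y"
        if s: "s \<in> {0..1}" "c x < s" "s < y" for s b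
      proof -
        have "c (fst (\<iota> (s, b))) = s" using fst_in[OF s(1)] by (simp add: fib_def)
        then have "x < fst (\<iota> (s, b))" "fst (\<iota> (s, b)) < l y"
          using c(4)[of "fst (\<iota> (s, b))" x] c(4)[of "l y" "fst (\<iota> (s, b))"] c_l(1)[OF y] s by force+
        then show ?thesis by (auto simp: x_def)
      qed
      then show ?thesis
        using before_l[OF y x] by (intro exI[of _ "y - c x"]) (auto simp: \<iota>y)
    qed (auto intro!: exI[of _ 1])
    show "\<exists>\<delta>>0. \<forall>s\<in>{0..1}. \<forall>b. y < s \<and> s < y + \<delta> \<longrightarrow>
        \<iota> (s, b) = \<iota> (y, True) \<or> (snd (\<iota> (y, True)) \<and>
          fst (\<iota> (y, True)) < fst (\<iota> (s, b)) \<and> fst (\<iota> (s, b)) < fst (\<iota> (y, True)) + \<eta>)"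
    proof (cases "y = 1")
      case False
      then have \<iota>y: "\<iota> (y, True) = (r y, True)" by (simp add: \<iota>_def)
      define x where "x = min 1 (r y + \<eta>)"
      have "r y < 1" using c_r[OF y] c(3) False by (cases "r y = 1") auto
      then have x: "x \<le> 1" "r y < x" using \<eta> by (auto simp: x_def)
      have "r y < fst (\<iota> (s, b)) \<and> fst (\<iota> (s, b)) < r y + \<eta>"
        if s: "s \<in> {0..1}" "y < s" "s < c x" for s b
      proof -
        have "c (fst (\<iota> (s, b))) = s" using fst_in[OF s(1)] by (simp add: fib_def)
        then have "fst (\<iota> (s, b)) < x" "r y < fst (\<iota> (s, b))"
          using c(4)[of x "fst (\<iota> (s, b))"] c(4)[of "fst (\<iota> (s, b))" "r y"] c_r(1)[OF y] s by force+
        then show ?thesis by (auto simp: x_def)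
      qed
      then show ?thesis
        using after_r[OF y x] by (intro exI[of _ "c x - y"]) (auto simp: \<iota>y)
    qed (auto intro!: exI[of _ 1])
  qed
  have \<kappa>: "split_map F A {0..1} B \<kappa>"
    unfolding split_map_def
  proof (intro conjI ballI allI impI)
    fix t b assume "t \<in> F"
    then show "fst (\<kappa> (t, b)) \<in> {0..1}" using c01[of t] by (auto simp: \<kappa>_def)
  next
    fix t assume t: "t \<in> F - A"
    have "t = a" if "c t = c a" "a \<in> A" "c t \<in> {0<..<1}" "c t \<notin> Y" for a
    proof -
      have "t = l (c t)" "a = l (c t)"
        using that t F(2) A(1) by (intro uniq(1)[OF that(3,4)]; auto)+
      then show ?thesis by simp
    qed
    then show "\<kappa> (t, False) = \<kappa> (t, True) \<or> fst (\<kappa> (t, False)) = fst (\<kappa> (t, True)) \<and> fst (\<kappa> (t, False)) \<notin> B"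
      using t by (auto simp: \<kappa>_def B_def)
  next
    fix t \<eta> :: real assume t: "t \<in> F" and \<eta>: "0 < \<eta>"
    obtain d where d: "0 < d" "\<And>s. \<bar>s - t\<bar> < d \<Longrightarrow> \<bar>c s - c t\<bar> < \<eta>"
      using c_near[OF \<eta>] by blast
    have fst\<kappa>: "fst (\<kappa> (s, b)) = c s" for s b by (auto simp: \<kappa>_def)
    \<comment> \<open>Near \<open>t\<close> the cut point of the interval collapsed together with \<open>t\<close> is not crossed.\<close>
    define d' where "d' = (if c t \<in> Y then min d \<bar>t - z (c t)\<bar> else d)"
    have d': "0 < d'" "d' \<le> d" "c t \<in> Y \<Longrightarrow> d' \<le> \<bar>t - z (c t)\<bar>"
      using d(1) z[of "c t"] t by (auto simp: d'_def)
    have same: "\<kappa> (s, b) = \<kappa> (t, b')" if s: "s \<in> F" "\<bar>s - t\<bar> < d'" "c s = c t" "s \<noteq> t" for s b b'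
    proof (cases "c t = 0 \<or> c t = 1")
      case False
      then have ct: "c t \<in> {0<..<1}" using c01[OF t] by auto
      have Y: "c t \<in> Y"
      proof (rule ccontr)
        assume "c t \<notin> Y"
        then have "t = l (c t)" "s = l (c t)"
          using s t F(2) by (intro uniq(1)[OF ct]; auto)+
        then show False using s(4) by simp
      qed
      then have "(z (c t) < s) = (z (c t) < t)" using d'(3) s(2) by auto
      then show ?thesis using Y s(3) by (simp add: \<kappa>_def)
    qed (use s in \<open>auto simp: \<kappa>_def\<close>)
    have "\<kappa> (s, b) = \<kappa> (t, False) \<or> (\<not> snd (\<kappa> (t, False)) \<and>
          fst (\<kappa> (t, False)) - \<eta> < fst (\<kappa> (s, b)) \<and> fst (\<kappa> (s, b)) < fst (\<kappa> (t, False)))"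
      if s: "s \<in> F" "t - d' < s" "s < t" for s b
    proof (cases "c s = c t")
      case True
      then show ?thesis using same[of s b False] s by auto
    next
      case False
      then have less: "c s < c t" using c(4)[of s t] s by simp
      have "c t - \<eta> < c s" using d(2)[of s] s d'(2) by auto
      moreover have "\<not> snd (\<kappa> (t, False))"
      proof
        assume "snd (\<kappa> (t, False))"
        moreover have "c t \<noteq> 0" using less c01[OF s(1)] by auto
        ultimately have Y: "c t \<in> Y" "z (c t) < t" by (auto simp: \<kappa>_def split: if_splits)
        have "c t \<in> {0..1}" using c01[OF t] .
        then have "l (c t) \<le> t" "t \<le> r (c t)" using lr(3,4)[of "c t" t] t F(2) by (auto simp: fib_def)
        moreover have "z (c t) < s" using d'(3)[OF Y(1)] Y(2) s(2) by auto
        ultimately have "c s = c t" using z[OF Y(1)] s by (intro mid c01[OF t]) auto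
        then show False using less by simp
      qed
      ultimately show ?thesis using less by (simp add: fst\<kappa>)
    qed
    then show "\<exists>\<delta>>0. \<forall>s\<in>F. \<forall>b. t - \<delta> < s \<and> s < t \<longrightarrow>
        \<kappa> (s, b) = \<kappa> (t, False) \<or> (\<not> snd (\<kappa> (t, False)) \<and>
          fst (\<kappa> (t, False)) - \<eta> < fst (\<kappa> (s, b)) \<and> fst (\<kappa> (s, b)) < fst (\<kappa> (t, False)))"
      using d'(1) by blast
    have "\<kappa> (s, b) = \<kappa> (t, True) \<or> (snd (\<kappa> (t, True)) \<and>
          fst (\<kappa> (t, True)) < fst (\<kappa> (s, b)) \<and> fst (\<kappa> (s, b)) < fst (\<kappa> (t, True)) + \<eta>)"
      if s: "s \<in> F" "t < s" "s < t + d'" for s b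
    proof (cases "c s = c t")
      case True
      then show ?thesis using same[of s b True] s by auto
    next
      case False
      then have less: "c t < c s" using c(4)[of t s] s by simp
      have "c s < c t + \<eta>" using d(2)[of s] s d'(2) by auto
      moreover have "snd (\<kappa> (t, True))"
      proof (rule ccontr)
        assume "\<not> snd (\<kappa> (t, True))"
        moreover have "c t \<noteq> 1" using less c01[OF s(1)] by auto
        ultimately have Y: "c t \<in> Y" "\<not> z (c t) < t" by (auto simp: \<kappa>_def split: if_splits)
        have "c t \<in> {0..1}" using c01[OF t] .
        then have "l (c t) \<le> t" "t \<le> r (c t)" using lr(3,4)[of "c t" t] t F(2) by (auto simp: fib_def)
        moreover have "s < z (c t)" using d'(3)[OF Y(1)] Y(2) s(3) by auto
        ultimately have "c s = c t" using z[OF Y(1)] s by (intro mid c01[OF t]) auto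
        then show False using less by simp
      qed
      ultimately show ?thesis using less by (simp add: fst\<kappa>)
    qed
    then show "\<exists>\<delta>>0. \<forall>s\<in>F. \<forall>b. t < s \<and> s < t + \<delta> \<longrightarrow>
        \<kappa> (s, b) = \<kappa> (t, True) \<or> (snd (\<kappa> (t, True)) \<and>
          fst (\<kappa> (t, True)) < fst (\<kappa> (s, b)) \<and> fst (\<kappa> (s, b)) < fst (\<kappa> (t, True)) + \<eta>)"
      using d'(1) by blast
  qed
  have "pullback {0..1} \<iota> (pullback F \<kappa> g) = g" if g: "g \<in> split_C {0..1} B" for g
  proof (rule ext, clarify)
    fix y b
    show "pullback {0..1} \<iota> (pullback F \<kappa> g) (y, b) = g (y, b)"
    proof (cases "y \<in> {0..1}")
      case True
      have inF: "fst (\<iota> (y, b)) \<in> F" using \<iota> True unfolding split_map_def by blast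
      consider "y = 0" | "y = 1" | "y \<in> Y" | "y \<in> {0<..<1}" "y \<notin> Y" using True by fastforce
      then have "g (\<kappa> (\<iota> (y, b))) = g (y, b)"
      proof cases
        case 1 then show ?thesis
          using c_r(1)[of 0] split_C_eq[OF g, of 0] B01 by (simp add: \<iota>_def \<kappa>_def)
      next
        case 2 then show ?thesis
          using c_l(1)[of 1] split_C_eq[OF g, of 1] B01 by (simp add: \<iota>_def \<kappa>_def)
      next
        case 3 then show ?thesis
          using c_l(1)[OF True] c_r(1)[OF True] z[OF 3] by (auto simp: \<iota>_def \<kappa>_def Y_def)
      next
        case 4 then show ?thesis
          using c_l(1)[OF True] c_r(1)[OF True] by (auto simp: \<iota>_def \<kappa>_def)
      qed
      then show ?thesis using True inF by (simp add: pullback_def)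
    qed (use split_C_0[OF g] in \<open>auto simp: pullback_def\<close>)
  qed
  then have "split_C F A \<simeq> split_C {0..1} B \<otimes>\<^sub>f {f \<in> split_C F A. pullback {0..1} \<iota> f = (\<lambda>_. 0)}"
    using fin_operator_pullback[OF \<iota>] fin_operator_pullback[OF \<kappa>] split_C_add split_C_diff
    by (intro fin_iso_complement) auto
  then show thesis using that B by blast
qed

text \<open>
  Pelczynski's decomposition argument: two spaces that are factors of each other are isomorphic if
  one of them absorbs the complementary factor.
\<close>

theorem zero_dim_iso_split_interval:
  assumes BA: "baumgartner_axiom" and B: "omega1_dense_unit B"
    and F: "compact F" "F \<subseteq> {0..1}" "0 \<in> F" "1 \<in> F" "interior F = {}"
    and A: "A \<subseteq> F \<inter> {0<..<1}" "|A| \<le>o omega1" "uncountable A"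
  shows "split_C F A \<simeq> split_C {0..1} B"
proof -
  define X where "X = split_C F A"
  define V where "V = split_C {0..1} B"
  define Z where "Z = c0_sum (UNIV :: nat set) (split_C_ends B)"
  have "infinite F"
    using A countable_finite countable_subset[of A F] by blast
  then have VXZ: "V \<simeq> X \<otimes>\<^sub>f Z"
    unfolding X_def V_def Z_def using split_interval_decomposes[OF BA B F(1-4)] F(5) A by blast
  obtain B' E where B': "omega1_dense_unit B'" "X \<simeq> split_C {0..1} B' \<otimes>\<^sub>f (E :: (real \<times> bool \<Rightarrow> real) set)"
    unfolding X_def using split_interval_is_factor[OF F(1,2,5) A] .
  then have XVE: "X \<simeq> V \<otimes>\<^sub>f E"
    using fin_iso_trans[OF B'(2) fin_iso_prod_cong[OF split_interval_unique[OF BA B B'(1)] fin_iso_refl]]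
    by (simp add: V_def)
  have ZZ: "Z \<otimes>\<^sub>f Z \<simeq> Z" unfolding Z_def by (rule c0_sum_absorb)
  have "V \<simeq> X \<otimes>\<^sub>f (Z \<otimes>\<^sub>f Z)"
    using fin_iso_trans[OF VXZ fin_iso_prod_cong[OF fin_iso_refl fin_iso_sym[OF ZZ]]] .
  also have "\<dots> \<simeq> (X \<otimes>\<^sub>f Z) \<otimes>\<^sub>f Z"
    by (rule fin_iso_sym[OF fin_iso_prod_assoc])
  also have "\<dots> \<simeq> V \<otimes>\<^sub>f Z"
    by (rule fin_iso_prod_cong[OF fin_iso_sym[OF VXZ] fin_iso_refl])
  finally have VVZ: "V \<simeq> V \<otimes>\<^sub>f Z" .
  have "X \<simeq> (V \<otimes>\<^sub>f Z) \<otimes>\<^sub>f E"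
    using fin_iso_trans[OF XVE fin_iso_prod_cong[OF VVZ fin_iso_refl]] .
  also have "\<dots> \<simeq> V \<otimes>\<^sub>f (Z \<otimes>\<^sub>f E)"
    by (rule fin_iso_prod_assoc)
  also have "\<dots> \<simeq> V \<otimes>\<^sub>f (E \<otimes>\<^sub>f Z)"
    by (rule fin_iso_prod_cong[OF fin_iso_refl fin_iso_prod_comm])
  also have "\<dots> \<simeq> (V \<otimes>\<^sub>f E) \<otimes>\<^sub>f Z"
    by (rule fin_iso_sym[OF fin_iso_prod_assoc])
  also have "\<dots> \<simeq> X \<otimes>\<^sub>f Z"
    by (rule fin_iso_prod_cong[OF fin_iso_sym[OF XVE] fin_iso_refl])
  also have "\<dots> \<simeq> V" by (rule fin_iso_sym[OF VXZ])
  finally show ?thesis by (simp add: X_def V_def)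
qed

section \<open>Lines in the order topology\<close>

definition cont_functions :: "'a topology \<Rightarrow> ('a \<Rightarrow> real) set" where
  "cont_functions X = {f. continuous_map X euclideanreal f \<and> (\<forall>x. x \<notin> topspace X \<longrightarrow> f x = 0)}"

lemma continuous_map_real_iff:
  "continuous_map X euclideanreal f \<longleftrightarrow>
     (\<forall>x\<in>topspace X. \<forall>\<epsilon>>0. \<exists>V. openin X V \<and> x \<in> V \<and> (\<forall>y\<in>V. \<bar>f y - f x\<bar> < \<epsilon>))"
  using Met_TC.continuous_map_to_metric[of X f]
  by (simp add: Met_TC.mball_def Met_TC.in_mball dist_real_def abs_minus_commute)

locale line =
  fixes K :: "'k set" and r :: "'k rel"
  assumes linear: "linear_order_on K r"
begin

abbreviation T where "T \<equiv> order_topology K r"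

definition less (infix \<open>\<sqsubset>\<close> 50) where "x \<sqsubset> y \<longleftrightarrow> (x, y) \<in> r \<and> x \<noteq> y"

lemma less_mem: "x \<sqsubset> y \<Longrightarrow> x \<in> K" "x \<sqsubset> y \<Longrightarrow> y \<in> K"
  and less_irrefl: "\<not> x \<sqsubset> x"
  and less_trans: "x \<sqsubset> y \<Longrightarrow> y \<sqsubset> z \<Longrightarrow> x \<sqsubset> z"
  and less_linear: "x \<in> K \<Longrightarrow> y \<in> K \<Longrightarrow> x \<sqsubset> y \<or> x = y \<or> y \<sqsubset> x"
  using linear unfolding less_def linear_order_on_def partial_order_on_def preorder_on_def
    refl_on_def trans_def antisym_def total_on_def by blast+

lemma less_asym: "x \<sqsubset> y \<Longrightarrow> \<not> y \<sqsubset> x"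
  using less_trans less_irrefl by blast

lemma less_le_trans: "x \<sqsubset> y \<Longrightarrow> z \<in> K \<Longrightarrow> \<not> z \<sqsubset> y \<Longrightarrow> x \<sqsubset> z"
  and le_less_trans: "y \<sqsubset> z \<Longrightarrow> x \<in> K \<Longrightarrow> \<not> y \<sqsubset> x \<Longrightarrow> x \<sqsubset> z"
  using less_linear less_trans less_mem by metis+

lemma finite_has_max:
  assumes "finite P" "P \<noteq> {}" "P \<subseteq> K"
  obtains m where "m \<in> P" "\<And>p. p \<in> P \<Longrightarrow> \<not> m \<sqsubset> p"
proof -
  have "\<exists>m\<in>P. \<forall>p\<in>P. \<not> m \<sqsubset> p"
    using assms
  proof (induction rule: finite_ne_induct)
    case (insert x P)
    then obtain m where m: "m \<in> P" "\<forall>p\<in>P. \<not> m \<sqsubset> p" by auto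
    show ?case
    proof (cases "m \<sqsubset> x")
      case True
      then show ?thesis using m less_trans less_irrefl by (intro bexI[of _ x]) blast+
    qed (use m in blast)
  qed (use less_irrefl in blast)
  then show thesis using that by blast
qed

lemma finite_has_min:
  assumes "finite P" "P \<noteq> {}" "P \<subseteq> K"
  obtains m where "m \<in> P" "\<And>p. p \<in> P \<Longrightarrow> \<not> p \<sqsubset> m"
proof -
  have "\<exists>m\<in>P. \<forall>p\<in>P. \<not> p \<sqsubset> m"
    using assms
  proof (induction rule: finite_ne_induct)
    case (insert x P)
    then obtain m where m: "m \<in> P" "\<forall>p\<in>P. \<not> p \<sqsubset> m" by auto
    show ?case
    proof (cases "x \<sqsubset> m")
      case True
      then show ?thesis using m less_trans less_irrefl by (intro bexI[of _ x]) blast+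
    qed (use m in blast)
  qed (use less_irrefl in blast)
  then show thesis using that by blast
qed

subsection \<open>Basic open sets\<close>

definition between :: "'k set \<Rightarrow> 'k set \<Rightarrow> 'k set" where
  "between P Q = {x \<in> K. (\<forall>p\<in>P. p \<sqsubset> x) \<and> (\<forall>q\<in>Q. x \<sqsubset> q)}"

lemma openin_rays:
  assumes "a \<in> K"
  shows "openin T {x \<in> K. x \<sqsubset> a}" "openin T {x \<in> K. a \<sqsubset> x}"
  using assms unfolding order_topology_def less_def
  by (intro topology_generated_by_Basis; blast)+

lemma openin_between:
  assumes "finite P" "finite Q" "P \<subseteq> K" "Q \<subseteq> K"
  shows "openin T (between P Q)"
proof -
  have "openin T (K \<inter> \<Inter>((\<lambda>p. {x \<in> K. p \<sqsubset> x}) ` P) \<inter> \<Inter>((\<lambda>q. {x \<in> K. x \<sqsubset> q}) ` Q))"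
  proof -
    have "openin T (\<Inter> (insert K ((\<lambda>p. {x \<in> K. p \<sqsubset> x}) ` P \<union> (\<lambda>q. {x \<in> K. x \<sqsubset> q}) ` Q)))"
      using assms openin_rays openin_topspace[of T] by (intro openin_Inter) auto
    then show ?thesis by (simp add: Inf_union_distrib Int_assoc)
  qed
  moreover have "K \<inter> \<Inter>((\<lambda>p. {x \<in> K. p \<sqsubset> x}) ` P) \<inter> \<Inter>((\<lambda>q. {x \<in> K. x \<sqsubset> q}) ` Q) = between P Q"
    by (auto simp: between_def)
  ultimately show ?thesis by simp
qed

lemma openin_imp_between:
  assumes "openin T U" "x \<in> U"
  shows "\<exists>P Q. finite P \<and> finite Q \<and> P \<subseteq> K \<and> Q \<subseteq> K \<and> x \<in> between P Q \<and> between P Q \<subseteq> U"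
proof -
  have "generate_topology_on (insert K ((\<lambda>a. {x \<in> K. (x, a) \<in> r \<and> x \<noteq> a}) ` K \<union>
                (\<lambda>a. {x \<in> K. (a, x) \<in> r \<and> x \<noteq> a}) ` K)) U"
    using assms(1) by (simp add: order_topology_def openin_topology_generated_by_iff)
  then show ?thesis
    using assms(2)
  proof (induction arbitrary: x)
    case (Int U V)
    obtain P Q where PQ: "finite P" "finite Q" "P \<subseteq> K" "Q \<subseteq> K" "x \<in> between P Q" "between P Q \<subseteq> U"
      using Int.IH(1)[OF IntD1[OF Int.prems]] by blast
    obtain P' Q' where PQ': "finite P'" "finite Q'" "P' \<subseteq> K" "Q' \<subseteq> K" "x \<in> between P' Q'" "between P' Q' \<subseteq> V"
      using Int.IH(2)[OF IntD2[OF Int.prems]] by blast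
    have "between (P \<union> P') (Q \<union> Q') = between P Q \<inter> between P' Q'"
      by (auto simp: between_def)
    then show ?case
      using PQ PQ' by (intro exI[of _ "P \<union> P'"] exI[of _ "Q \<union> Q'"]) auto
  next
    case (UN \<U>)
    then obtain U where U: "U \<in> \<U>" "x \<in> U" by blast
    then show ?case using UN.IH[OF U] by (meson Union_upper subset_trans)
  next
    case (Basis U)
    then consider "U = K" | a where "a \<in> K" "U = between {} {a}" | a where "a \<in> K" "U = between {a} {}"
      by (fastforce simp: between_def less_def)
    then show ?case
    proof cases
      case 1
      then show ?thesis using Basis.prems by (intro exI[of _ "{}"]) (auto simp: between_def)
    next
      case 2
      then show ?thesis using Basis.prems by (intro exI[of _ "{}"] exI[of _ "{a}"]) auto
    next
      case 3
      then show ?thesis using Basis.prems by (intro exI[of _ "{a}"] exI[of _ "{}"]) auto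
    qed
  qed auto
qed

lemma openin_left:
  assumes "openin T U" "x \<in> U"
  shows "(\<exists>a. a \<sqsubset> x \<and> (\<forall>y. a \<sqsubset> y \<longrightarrow> y \<sqsubset> x \<longrightarrow> y \<in> U)) \<or> (\<forall>y. y \<sqsubset> x \<longrightarrow> y \<in> U)"
proof -
  obtain P Q where PQ: "finite P" "finite Q" "P \<subseteq> K" "Q \<subseteq> K" "x \<in> between P Q" "between P Q \<subseteq> U"
    using openin_imp_between[OF assms] by blast
  have Q: "\<forall>q\<in>Q. y \<sqsubset> q" if "y \<sqsubset> x" for y
    using PQ(5) that less_trans by (auto simp: between_def)
  show ?thesis
  proof (cases "P = {}")
    case True
    then have "\<forall>y. y \<sqsubset> x \<longrightarrow> y \<in> between P Q"
      using Q less_mem by (auto simp: between_def)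
    then show ?thesis using PQ(6) by blast
  next
    case False
    then obtain m where m: "m \<in> P" "\<And>p. p \<in> P \<Longrightarrow> \<not> m \<sqsubset> p"
      using finite_has_max[OF PQ(1) _ PQ(3)] by blast
    have "y \<in> between P Q" if "m \<sqsubset> y" "y \<sqsubset> x" for y
    proof -
      have "p \<sqsubset> y" if "p \<in> P" for p
        using le_less_trans[OF \<open>m \<sqsubset> y\<close>, of p] m(2)[OF that] PQ(3) that by blast
      then show ?thesis
        using Q[OF that(2)] less_mem(1)[OF that(2)] by (simp add: between_def)
    qed
    moreover have "m \<sqsubset> x" using m(1) PQ(5) by (simp add: between_def)
    ultimately show ?thesis using PQ(6) by blast
  qed
qed

lemma openin_right:
  assumes "openin T U" "x \<in> U"
  shows "(\<exists>b. x \<sqsubset> b \<and> (\<forall>y. x \<sqsubset> y \<longrightarrow> y \<sqsubset> b \<longrightarrow> y \<in> U)) \<or> (\<forall>y. x \<sqsubset> y \<longrightarrow> y \<in> U)"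
proof -
  obtain P Q where PQ: "finite P" "finite Q" "P \<subseteq> K" "Q \<subseteq> K" "x \<in> between P Q" "between P Q \<subseteq> U"
    using openin_imp_between[OF assms] by blast
  have P: "\<forall>p\<in>P. p \<sqsubset> y" if "x \<sqsubset> y" for y
    using PQ(5) that less_trans by (auto simp: between_def)
  show ?thesis
  proof (cases "Q = {}")
    case True
    then have "\<forall>y. x \<sqsubset> y \<longrightarrow> y \<in> between P Q"
      using P less_mem by (auto simp: between_def)
    then show ?thesis using PQ(6) by blast
  next
    case False
    then obtain m where m: "m \<in> Q" "\<And>p. p \<in> Q \<Longrightarrow> \<not> p \<sqsubset> m"
      using finite_has_min[OF PQ(2) _ PQ(4)] by blast
    have "y \<in> between P Q" if "x \<sqsubset> y" "y \<sqsubset> m" for y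
    proof -
      have "y \<sqsubset> q" if "q \<in> Q" for q
        using less_le_trans[OF \<open>y \<sqsubset> m\<close>, of q] m(2)[OF that] PQ(4) that by blast
      then show ?thesis
        using P[OF that(1)] less_mem(2)[OF that(1)] by (simp add: between_def)
    qed
    moreover have "x \<sqsubset> m" using m(1) PQ(5) by (simp add: between_def)
    ultimately show ?thesis using PQ(6) by blast
  qed
qed

definition jump :: "'k \<Rightarrow> 'k \<Rightarrow> bool" where
  "jump x y \<longleftrightarrow> x \<sqsubset> y \<and> \<not> (\<exists>z. x \<sqsubset> z \<and> z \<sqsubset> y)"

lemma jump_unique: "jump x y \<Longrightarrow> jump x y' \<Longrightarrow> y = y'" "jump x y \<Longrightarrow> jump x' y \<Longrightarrow> x = x'"
  using less_linear less_mem unfolding jump_def by metis+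

lemma jump_cut:
  assumes "jump x y" "z \<in> K"
  shows "x \<sqsubset> z \<longleftrightarrow> \<not> z \<sqsubset> y"
  using assms less_linear less_trans less_mem unfolding jump_def by metis

end

subsection \<open>Functions on a line as functions on a set of reals with split points\<close>

text \<open>
  A monotone continuous real function on a line whose only non-trivial fibres are the two sides
  of a jump presents the line as its image, split at the values of these fibres.
\<close>

locale line_map = line K r for K :: "'k set" and r :: "'k rel" +
  fixes \<theta> :: "'k \<Rightarrow> real"
  assumes cont: "continuous_map (order_topology K r) euclideanreal \<theta>"
    and mono: "x \<sqsubset> y \<Longrightarrow> \<theta> x \<le> \<theta> y"
    and fibre_jump: "x \<sqsubset> y \<Longrightarrow> \<theta> x = \<theta> y \<Longrightarrow> jump x y"
begin

definition doubles :: "real set" where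
  "doubles = {t. \<exists>x y. x \<sqsubset> y \<and> \<theta> x = t \<and> \<theta> y = t}"

lemma doubles_subset: "doubles \<subseteq> \<theta> ` K"
  using less_mem by (auto simp: doubles_def)

lemma mono_strict: "\<theta> x < \<theta> y \<Longrightarrow> x \<in> K \<Longrightarrow> y \<in> K \<Longrightarrow> x \<sqsubset> y"
  using mono[of y x] less_linear[of x y] by force

text \<open>The first and the last point of a fibre.\<close>

definition lo :: "real \<Rightarrow> 'k" where "lo t = (SOME x. x \<in> K \<and> \<theta> x = t \<and> (\<forall>y. y \<sqsubset> x \<longrightarrow> \<theta> y < t))"
definition hi :: "real \<Rightarrow> 'k" where "hi t = (SOME x. x \<in> K \<and> \<theta> x = t \<and> (\<forall>y. x \<sqsubset> y \<longrightarrow> t < \<theta> y))"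

lemma lo:
  assumes "t \<in> \<theta> ` K"
  shows "lo t \<in> K" "\<theta> (lo t) = t" "\<And>y. y \<sqsubset> lo t \<Longrightarrow> \<theta> y < t"
proof -
  obtain x where x: "x \<in> K" "\<theta> x = t" using assms by auto
  have "\<exists>x. x \<in> K \<and> \<theta> x = t \<and> (\<forall>y. y \<sqsubset> x \<longrightarrow> \<theta> y < t)"
  proof (cases "\<exists>y. y \<sqsubset> x \<and> \<theta> y = t")
    case True
    then obtain y where y: "y \<sqsubset> x" "\<theta> y = t" by blast
    have "\<theta> z < t" if "z \<sqsubset> y" for z
      using mono[OF that] fibre_jump[of z x] less_trans[OF that y(1)] that y x
      by (auto simp: jump_def less_le)
    then show ?thesis using y less_mem by blast
  next
    case False
    then show ?thesis using x mono by (force simp: less_le)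
  qed
  from someI_ex[OF this] show "lo t \<in> K" "\<theta> (lo t) = t" "\<And>y. y \<sqsubset> lo t \<Longrightarrow> \<theta> y < t"
    by (auto simp: lo_def)
qed

lemma hi:
  assumes "t \<in> \<theta> ` K"
  shows "hi t \<in> K" "\<theta> (hi t) = t" "\<And>y. hi t \<sqsubset> y \<Longrightarrow> t < \<theta> y"
proof -
  obtain x where x: "x \<in> K" "\<theta> x = t" using assms by auto
  have "\<exists>x. x \<in> K \<and> \<theta> x = t \<and> (\<forall>y. x \<sqsubset> y \<longrightarrow> t < \<theta> y)"
  proof (cases "\<exists>y. x \<sqsubset> y \<and> \<theta> y = t")
    case True
    then obtain y where y: "x \<sqsubset> y" "\<theta> y = t" by blast
    have "t < \<theta> z" if "y \<sqsubset> z" for z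
      using mono[OF that] fibre_jump[of x z] less_trans[OF y(1) that] that y x
      by (auto simp: jump_def less_le)
    then show ?thesis using y less_mem by blast
  next
    case False
    then show ?thesis using x mono by (force simp: less_le)
  qed
  from someI_ex[OF this] show "hi t \<in> K" "\<theta> (hi t) = t" "\<And>y. hi t \<sqsubset> y \<Longrightarrow> t < \<theta> y"
    by (auto simp: hi_def)
qed

lemma lo_hi_cases:
  assumes "x \<in> K"
  shows "x = lo (\<theta> x) \<or> x = hi (\<theta> x)"
proof (rule ccontr)
  assume not: "\<not> ?thesis"
  have t: "\<theta> x \<in> \<theta> ` K" using assms by blast
  have "lo (\<theta> x) \<sqsubset> x" using lo[OF t] not less_linear[OF assms lo(1)[OF t]] by auto
  moreover have "x \<sqsubset> hi (\<theta> x)" using hi[OF t] not less_linear[OF assms hi(1)[OF t]] by auto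
  moreover from calculation have "jump (lo (\<theta> x)) (hi (\<theta> x))"
    using lo[OF t] hi[OF t] less_trans by (intro fibre_jump) auto
  ultimately show False by (auto simp: jump_def)
qed

lemma lo_eq_hi_iff:
  assumes "t \<in> \<theta> ` K"
  shows "lo t = hi t \<longleftrightarrow> t \<notin> doubles"
proof
  assume eq: "lo t = hi t"
  show "t \<notin> doubles"
  proof
    assume "t \<in> doubles"
    then obtain x y where xy: "x \<sqsubset> y" "\<theta> x = t" "\<theta> y = t" by (auto simp: doubles_def)
    then have "x = lo t" "y = lo t"
      using lo_hi_cases[of x] lo_hi_cases[of y] less_mem[OF xy(1)] eq by auto
    then show False using xy(1) less_irrefl by simp
  qed
next
  assume nd: "t \<notin> doubles"
  have "\<not> lo t \<sqsubset> hi t" "\<not> hi t \<sqsubset> lo t"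
    using nd lo(2)[OF assms] hi(2)[OF assms] by (auto simp: doubles_def)
  then show "lo t = hi t" using less_linear lo(1)[OF assms] hi(1)[OF assms] by blast
qed

lemma lo_less_hi: "t \<in> doubles \<Longrightarrow> lo t \<sqsubset> hi t"
  using doubles_subset lo_eq_hi_iff[of t] less_linear[of "lo t" "hi t"] lo(1,2)[of t] hi(1)[of t] hi(3)[of t "lo t"]
  by force

definition to_split :: "('k \<Rightarrow> real) \<Rightarrow> real \<times> bool \<Rightarrow> real" where
  "to_split f = (\<lambda>(t, b). if t \<in> \<theta> ` K then f (if b then hi t else lo t) else 0)"

definition from_split :: "(real \<times> bool \<Rightarrow> real) \<Rightarrow> 'k \<Rightarrow> real" where
  "from_split g = (\<lambda>x. if x \<in> K then g (\<theta> x, x \<noteq> lo (\<theta> x)) else 0)"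

lemma to_split_in:
  assumes f: "f \<in> cont_functions T"
  shows "to_split f \<in> split_C (\<theta> ` K) doubles"
proof (rule split_CI)
  have f': "continuous_map T euclideanreal f" using f by (simp add: cont_functions_def)
  fix t \<epsilon> :: real assume t: "t \<in> \<theta> ` K" and \<epsilon>: "0 < \<epsilon>"
  have mem: "(if b then hi s else lo s) \<in> K" "\<theta> (if b then hi s else lo s) = s" if "s \<in> \<theta> ` K" for s b
    using lo[OF that] hi[OF that] by auto
  show "\<exists>\<delta>>0. \<forall>s\<in>\<theta> ` K. \<forall>b. t - \<delta> < s \<and> s < t \<longrightarrow> \<bar>to_split f (s, b) - to_split f (t, False)\<bar> < \<epsilon>"
  proof -
    obtain V where V: "openin T V" "lo t \<in> V" "\<And>y. y \<in> V \<Longrightarrow> \<bar>f y - f (lo t)\<bar> < \<epsilon>"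
      using f' lo(1)[OF t] \<epsilon> unfolding continuous_map_real_iff by (metis topspace_order_topology)
    consider a where "a \<sqsubset> lo t" "\<And>y. a \<sqsubset> y \<Longrightarrow> y \<sqsubset> lo t \<Longrightarrow> y \<in> V" | "\<And>y. y \<sqsubset> lo t \<Longrightarrow> y \<in> V"
      using openin_left[OF V(1,2)] by blast
    then show ?thesis
    proof cases
      case 1
      have "\<bar>to_split f (s, b) - to_split f (t, False)\<bar> < \<epsilon>" if s: "s \<in> \<theta> ` K" "\<theta> a < s" "s < t" for s b
      proof -
        let ?y = "if b then hi s else lo s"
        have "a \<sqsubset> ?y" "?y \<sqsubset> lo t"
          using mem[OF s(1), of b] s lo(1,2)[OF t] less_mem(1)[OF 1(1)] by (intro mono_strict; simp)+
        then show ?thesis using V(3)[OF 1(2)] s(1) t by (auto simp: to_split_def)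
      qed
      then show ?thesis
        using lo(3)[OF t 1(1)] by (intro exI[of _ "t - \<theta> a"]) auto
    next
      case 2
      have "\<bar>to_split f (s, b) - to_split f (t, False)\<bar> < \<epsilon>" if s: "s \<in> \<theta> ` K" "s < t" for s b
      proof -
        let ?y = "if b then hi s else lo s"
        have "?y \<sqsubset> lo t"
          using mem[OF s(1), of b] s lo(1,2)[OF t] by (intro mono_strict; simp)+
        then show ?thesis using V(3)[OF 2] s(1) t by (auto simp: to_split_def)
      qed
      then show ?thesis by (intro exI[of _ 1]) auto
    qed
  qed
  show "\<exists>\<delta>>0. \<forall>s\<in>\<theta> ` K. \<forall>b. t < s \<and> s < t + \<delta> \<longrightarrow> \<bar>to_split f (s, b) - to_split f (t, True)\<bar> < \<epsilon>"
  proof -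
    obtain V where V: "openin T V" "hi t \<in> V" "\<And>y. y \<in> V \<Longrightarrow> \<bar>f y - f (hi t)\<bar> < \<epsilon>"
      using f' hi(1)[OF t] \<epsilon> unfolding continuous_map_real_iff by (metis topspace_order_topology)
    consider a where "hi t \<sqsubset> a" "\<And>y. hi t \<sqsubset> y \<Longrightarrow> y \<sqsubset> a \<Longrightarrow> y \<in> V" | "\<And>y. hi t \<sqsubset> y \<Longrightarrow> y \<in> V"
      using openin_right[OF V(1,2)] by blast
    then show ?thesis
    proof cases
      case 1
      have "\<bar>to_split f (s, b) - to_split f (t, True)\<bar> < \<epsilon>" if s: "s \<in> \<theta> ` K" "t < s" "s < \<theta> a" for s b
      proof -
        let ?y = "if b then hi s else lo s"
        have "?y \<sqsubset> a" "hi t \<sqsubset> ?y"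
          using mem[OF s(1), of b] s hi(1,2)[OF t] less_mem(2)[OF 1(1)] by (intro mono_strict; simp)+
        then show ?thesis using V(3)[OF 1(2)] s(1) t by (auto simp: to_split_def)
      qed
      then show ?thesis
        using hi(3)[OF t 1(1)] by (intro exI[of _ "\<theta> a - t"]) auto
    next
      case 2
      have "\<bar>to_split f (s, b) - to_split f (t, True)\<bar> < \<epsilon>" if s: "s \<in> \<theta> ` K" "t < s" for s b
      proof -
        let ?y = "if b then hi s else lo s"
        have "hi t \<sqsubset> ?y"
          using mem[OF s(1), of b] s hi(1,2)[OF t] by (intro mono_strict; simp)+
        then show ?thesis using V(3)[OF 2] s(1) t by (auto simp: to_split_def)
      qed
      then show ?thesis by (intro exI[of _ 1]) auto
    qed
  qed
next
  fix t assume "t \<in> \<theta> ` K" "t \<notin> doubles"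
  then show "to_split f (t, False) = to_split f (t, True)"
    using lo_eq_hi_iff[of t] by (simp add: to_split_def)
qed (simp add: to_split_def)

lemma from_split_in:
  assumes g: "g \<in> split_C (\<theta> ` K) doubles"
  shows "from_split g \<in> cont_functions T"
proof -
  have "\<exists>V. openin T V \<and> x \<in> V \<and> (\<forall>y\<in>V. \<bar>from_split g y - from_split g x\<bar> < \<epsilon>)"
    if x: "x \<in> K" and \<epsilon>: "0 < \<epsilon>" for x \<epsilon>
  proof -
    define t where "t = \<theta> x"
    have t: "t \<in> \<theta> ` K" using x by (simp add: t_def)
    have openin_\<theta>: "openin T {y \<in> K. \<theta> y \<in> W}" if "open W" for W
      using openin_continuous_map_preimage[OF cont, of W] that by simp
    have "\<exists>V. openin T V \<and> x \<in> V \<and> (\<forall>y\<in>V. y \<sqsubset> x \<longrightarrow> \<bar>from_split g y - from_split g x\<bar> < \<epsilon>)"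
    proof (cases "x = lo t")
      case True
      obtain \<delta> where \<delta>: "0 < \<delta>"
        "\<And>s b. s \<in> \<theta> ` K \<Longrightarrow> t - \<delta> < s \<Longrightarrow> s < t \<Longrightarrow> \<bar>g (s, b) - g (t, False)\<bar> < \<epsilon>"
        using split_C_left[OF g t \<epsilon>] by blast
      have "\<bar>from_split g y - from_split g x\<bar> < \<epsilon>" if "y \<in> K" "t - \<delta> < \<theta> y" "y \<sqsubset> x" for y
        using \<delta>(2)[of "\<theta> y"] lo(3)[OF t] that x True lo(2)[OF t] by (auto simp: from_split_def)
      then show ?thesis
        using openin_\<theta>[of "{t - \<delta><..}"] x \<delta>(1) by (intro exI[of _ "{y \<in> K. \<theta> y \<in> {t - \<delta><..}}"]) (auto simp: t_def)
    next
      case False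
      then have "x = hi t" "t \<in> doubles" using lo_hi_cases[OF x] lo_eq_hi_iff[OF t] by (auto simp: t_def)
      then have "jump (lo t) x"
        using lo_less_hi lo(2)[OF t] hi(2)[OF t] by (intro fibre_jump) auto
      then show ?thesis
        using openin_rays(2)[OF lo(1)[OF t]] x by (intro exI[of _ "{y \<in> K. lo t \<sqsubset> y}"]) (auto simp: jump_def)
    qed
    then obtain V1 where V1: "openin T V1" "x \<in> V1"
      "\<And>y. y \<in> V1 \<Longrightarrow> y \<sqsubset> x \<Longrightarrow> \<bar>from_split g y - from_split g x\<bar> < \<epsilon>" by blast
    have "\<exists>V. openin T V \<and> x \<in> V \<and> (\<forall>y\<in>V. x \<sqsubset> y \<longrightarrow> \<bar>from_split g y - from_split g x\<bar> < \<epsilon>)"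
    proof (cases "x = hi t")
      case True
      obtain \<delta> where \<delta>: "0 < \<delta>"
        "\<And>s b. s \<in> \<theta> ` K \<Longrightarrow> t < s \<Longrightarrow> s < t + \<delta> \<Longrightarrow> \<bar>g (s, b) - g (t, True)\<bar> < \<epsilon>"
        using split_C_right[OF g t \<epsilon>] by blast
      have "from_split g x = g (t, True)"
        using x True hi(2)[OF t] lo_eq_hi_iff[OF t] split_C_eq[OF g t, of False True] by (auto simp: from_split_def)
      then have "\<bar>from_split g y - from_split g x\<bar> < \<epsilon>" if "y \<in> K" "\<theta> y < t + \<delta>" "x \<sqsubset> y" for y
        using \<delta>(2)[of "\<theta> y"] hi(3)[OF t] that x True by (auto simp: from_split_def)
      then show ?thesis
        using openin_\<theta>[of "{..<t + \<delta>}"] x \<delta>(1) by (intro exI[of _ "{y \<in> K. \<theta> y \<in> {..<t + \<delta>}}"]) (auto simp: t_def)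
    next
      case False
      then have "x = lo t" "t \<in> doubles" using lo_hi_cases[OF x] lo_eq_hi_iff[OF t] by (auto simp: t_def)
      then have "jump x (hi t)"
        using lo_less_hi lo(2)[OF t] hi(2)[OF t] by (intro fibre_jump) auto
      then show ?thesis
        using openin_rays(1)[OF hi(1)[OF t]] x by (intro exI[of _ "{y \<in> K. y \<sqsubset> hi t}"]) (auto simp: jump_def)
    qed
    then obtain V2 where V2: "openin T V2" "x \<in> V2"
      "\<And>y. y \<in> V2 \<Longrightarrow> x \<sqsubset> y \<Longrightarrow> \<bar>from_split g y - from_split g x\<bar> < \<epsilon>" by blast
    have "\<bar>from_split g y - from_split g x\<bar> < \<epsilon>" if "y \<in> V1 \<inter> V2" for y
    proof -
      have "y \<in> K" using openin_subset[OF V1(1)] that by auto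
      then show ?thesis using less_linear[OF x, of y] V1(3) V2(3) that \<epsilon> by auto
    qed
    then show ?thesis
      using V1(1,2) V2(1,2) by (intro exI[of _ "V1 \<inter> V2"]) auto
  qed
  then show ?thesis
    by (auto simp: cont_functions_def continuous_map_real_iff) (simp add: from_split_def)
qed

theorem cont_functions_iso_split_C: "cont_functions T \<simeq> split_C (\<theta> ` K) doubles"
proof (rule fin_isoI[OF to_split_in _ from_split_in])
  fix f assume f: "f \<in> cont_functions T"
  show "from_split (to_split f) = f"
  proof
    fix x show "from_split (to_split f) x = f x"
    proof (cases "x \<in> K")
      case True
      then show ?thesis using lo_hi_cases[OF True] by (auto simp: from_split_def to_split_def)
    qed (use f in \<open>simp add: from_split_def cont_functions_def\<close>)
  qed
next
  fix g assume g: "g \<in> split_C (\<theta> ` K) doubles"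
  show "to_split (from_split g) = g"
  proof (rule ext, clarify)
    fix t b show "to_split (from_split g) (t, b) = g (t, b)"
    proof (cases "t \<in> \<theta> ` K")
      case True
      show ?thesis
        using lo[OF True] hi[OF True] lo_eq_hi_iff[OF True] split_C_eq[OF g True, of b False] True
        by (auto simp: to_split_def from_split_def)
    qed (use split_C_0[OF g] in \<open>auto simp: to_split_def\<close>)
  qed
qed (auto simp: to_split_def from_split_def split_beta intro!: fin_functional_if)

end

section \<open>Separable compact lines as compact sets of reals with split points\<close>

context line
begin

text \<open>There is a jump between any two points; for compact lines this characterises dimension zero.\<close>

definition zero_dim :: bool where
  "zero_dim \<longleftrightarrow> (\<forall>x y. x \<sqsubset> y \<longrightarrow> (\<exists>p q. jump p q \<and> \<not> p \<sqsubset> x \<and> \<not> y \<sqsubset> q))"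

definition jumps :: "'k set" where "jumps = {p. \<exists>q. jump p q}"

lemma jump_mem: "jump p q \<Longrightarrow> p \<in> K" "jump p q \<Longrightarrow> q \<in> K"
  using less_mem by (auto simp: jump_def)

lemma countable_neighbours:
  assumes "countable D"
  shows "countable {x. \<exists>d\<in>D. jump d x \<or> jump x d}"
proof (rule countable_subset)
  show "{x. \<exists>d\<in>D. jump d x \<or> jump x d} \<subseteq> (\<lambda>d. SOME x. jump d x) ` D \<union> (\<lambda>d. SOME x. jump x d) ` D"
  proof
    fix x assume "x \<in> {x. \<exists>d\<in>D. jump d x \<or> jump x d}"
    then obtain d where d: "d \<in> D" "jump d x \<or> jump x d" by blast
    then have "x = (SOME x. jump d x) \<or> x = (SOME x. jump x d)"
      using jump_unique by (metis someI)
    then show "x \<in> (\<lambda>d. SOME x. jump d x) ` D \<union> (\<lambda>d. SOME x. jump x d) ` D"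
      using d(1) by blast
  qed
qed (use assms in auto)

text \<open>
  A function that increases between two given points, and crosses a jump on the way if there is
  one: the indicator of one side of a jump, or else Urysohn's construction.
\<close>

lemma separating_function:
  assumes "d \<sqsubset> d'"
  shows "\<exists>g. continuous_map T euclideanreal g \<and> (\<forall>x. 0 \<le> g x \<and> g x \<le> 1) \<and>
      (\<forall>x y. x \<sqsubset> y \<longrightarrow> g x \<le> g y) \<and> g d < g d' \<and>
      ((\<exists>p q. jump p q \<and> \<not> p \<sqsubset> d \<and> \<not> d' \<sqsubset> q) \<longrightarrow>
       (\<exists>p q. jump p q \<and> \<not> p \<sqsubset> d \<and> \<not> d' \<sqsubset> q \<and> g p < g q))"
proof (cases "\<exists>p q. jump p q \<and> \<not> p \<sqsubset> d \<and> \<not> d' \<sqsubset> q")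
  case True
  then obtain p q where pq: "jump p q" "\<not> p \<sqsubset> d" "\<not> d' \<sqsubset> q" by blast
  have "p \<sqsubset> q" using pq(1) by (simp add: jump_def)
  define g where "g x = (if p \<sqsubset> x then 1 else 0 :: real)" for x
  have "continuous_map T euclideanreal g"
    unfolding continuous_map_real_iff
  proof (intro ballI allI impI)
    fix x and \<epsilon> :: real assume x: "x \<in> topspace T" and \<epsilon>: "0 < \<epsilon>"
    then have "x \<in> K" by simp
    show "\<exists>V. openin T V \<and> x \<in> V \<and> (\<forall>y\<in>V. \<bar>g y - g x\<bar> < \<epsilon>)"
    proof (cases "p \<sqsubset> x")
      case True
      then show ?thesis
        using openin_rays(2)[OF jump_mem(1)[OF pq(1)]] \<open>x \<in> K\<close> \<epsilon>
        by (intro exI[of _ "{y \<in> K. p \<sqsubset> y}"]) (auto simp: g_def)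
    next
      case False
      then show ?thesis
        using openin_rays(1)[OF jump_mem(2)[OF pq(1)]] \<open>x \<in> K\<close> \<epsilon> jump_cut[OF pq(1)]
        by (intro exI[of _ "{y \<in> K. y \<sqsubset> q}"]) (auto simp: g_def)
    qed
  qed
  moreover have "g x \<le> g y" if "x \<sqsubset> y" for x y
    using less_trans that by (auto simp: g_def)
  moreover have "p \<sqsubset> d'"
    using less_le_trans[OF \<open>p \<sqsubset> q\<close>] pq(3) less_mem(2)[OF assms] by blast
  then have "g d < g d'" "g p < g q"
    using pq(2) \<open>p \<sqsubset> q\<close> less_irrefl by (auto simp: g_def)
  moreover have "\<forall>x. 0 \<le> g x \<and> g x \<le> 1" by (simp add: g_def)
  ultimately show ?thesis using pq by blast
next
  case nojump: False
  define R where "R x y \<longleftrightarrow> x \<sqsubset> y \<and> \<not> x \<sqsubset> d \<and> \<not> d' \<sqsubset> y" for x y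
  obtain g :: "'k \<Rightarrow> real" where g:
    "\<And>t. 0 \<le> g t \<and> g t \<le> 1"
    "\<And>t. t \<in> K \<Longrightarrow> \<not> d \<sqsubset> t \<Longrightarrow> g t = 0" "\<And>t. t \<in> K \<Longrightarrow> \<not> t \<sqsubset> d' \<Longrightarrow> g t = 1"
    "\<And>s t. s \<in> K \<Longrightarrow> t \<in> K \<Longrightarrow> s \<sqsubset> t \<Longrightarrow> g s \<le> g t"
    "\<And>s t. s \<in> K \<Longrightarrow> t \<in> K \<Longrightarrow> g s < g t \<Longrightarrow> \<exists>p q. R p q \<and> \<not> p \<sqsubset> s \<and> \<not> t \<sqsubset> q"
    "\<And>t y. t \<in> K \<Longrightarrow> g t < y \<Longrightarrow> y \<le> 1 \<Longrightarrow> \<exists>p\<in>K. t \<sqsubset> p \<and> (\<forall>s\<in>K. s \<sqsubset> p \<longrightarrow> g s < y)"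
    "\<And>t y. t \<in> K \<Longrightarrow> y < g t \<Longrightarrow> 0 \<le> y \<Longrightarrow> \<exists>p\<in>K. p \<sqsubset> t \<and> (\<forall>s\<in>K. p \<sqsubset> s \<longrightarrow> y < g s)"
  proof (rule monotone_Urysohn[where X=K and less="(\<sqsubset>)" and R=R and a=d and b=d'])
    show "\<exists>z. R x z \<and> R z y" if "R x y" for x y
    proof -
      have xy: "x \<sqsubset> y" "\<not> x \<sqsubset> d" "\<not> d' \<sqsubset> y" using that by (auto simp: R_def)
      then obtain z where z: "x \<sqsubset> z" "z \<sqsubset> y" using nojump by (auto simp: jump_def)
      then show ?thesis
        using xy less_trans[of x z d] less_trans[of d' z y] unfolding R_def by blast
    qed
    show "R x z" if "R x y" "R y z" for x y z
      using that less_trans[of x y z] by (simp add: R_def)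
    show "x \<in> K \<and> y \<in> K \<and> x \<sqsubset> y" if "R x y" for x y using that less_mem[of x y] by (simp add: R_def)
    show "x \<sqsubset> y \<or> x = y \<or> y \<sqsubset> x" if "x \<in> K" "y \<in> K" for x y using that by (rule less_linear)
    show "x \<sqsubset> z" if "x \<sqsubset> y" "y \<sqsubset> z" for x y z using that by (rule less_trans)
    show "R d d'" using assms less_irrefl by (simp add: R_def)
  qed (simp add: less_irrefl, rule that, assumption+)
  have "continuous_map T euclideanreal g"
    unfolding continuous_map_real_iff
  proof (intro ballI allI impI)
    fix x and \<epsilon> :: real assume "x \<in> topspace T" and \<epsilon>: "0 < \<epsilon>"
    then have x: "x \<in> K" by simp
    have "\<exists>V. openin T V \<and> x \<in> V \<and> (\<forall>y\<in>V. g y < g x + \<epsilon>)"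
    proof (cases "g x + \<epsilon> \<le> 1")
      case True
      then obtain p where "p \<in> K" "x \<sqsubset> p" "\<forall>s\<in>K. s \<sqsubset> p \<longrightarrow> g s < g x + \<epsilon>"
        using g(6)[OF x, of "g x + \<epsilon>"] \<epsilon> by auto
      then show ?thesis using openin_rays(1) x by (intro exI[of _ "{y \<in> K. y \<sqsubset> p}"]) auto
    next
      case False
      have "g y < g x + \<epsilon>" for y using g(1)[of y] False by linarith
      then show ?thesis using x openin_topspace[of T] by (intro exI[of _ K]) auto
    qed
    then obtain V where V: "openin T V" "x \<in> V" "\<And>y. y \<in> V \<Longrightarrow> g y < g x + \<epsilon>" by blast
    have "\<exists>V. openin T V \<and> x \<in> V \<and> (\<forall>y\<in>V. g x - \<epsilon> < g y)"
    proof (cases "0 \<le> g x - \<epsilon>")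
      case True
      then obtain p where "p \<in> K" "p \<sqsubset> x" "\<forall>s\<in>K. p \<sqsubset> s \<longrightarrow> g x - \<epsilon> < g s"
        using g(7)[OF x, of "g x - \<epsilon>"] \<epsilon> by auto
      then show ?thesis using openin_rays(2) x by (intro exI[of _ "{y \<in> K. p \<sqsubset> y}"]) auto
    next
      case False
      have "g x - \<epsilon> < g y" for y using g(1)[of y] False by linarith
      then show ?thesis using x openin_topspace[of T] by (intro exI[of _ K]) auto
    qed
    then obtain W where W: "openin T W" "x \<in> W" "\<And>y. y \<in> W \<Longrightarrow> g x - \<epsilon> < g y" by blast
    have "\<bar>g y - g x\<bar> < \<epsilon>" if "y \<in> V \<inter> W" for y
      using V(3)[of y] W(3)[of y] that by (simp add: abs_less_iff)
    then show "\<exists>V. openin T V \<and> x \<in> V \<and> (\<forall>y\<in>V. \<bar>g y - g x\<bar> < \<epsilon>)"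
      using V W by (intro exI[of _ "V \<inter> W"]) auto
  qed
  moreover have "g d = 0" "g d' = 1"
    using g(2)[of d] g(3)[of d'] less_mem[OF assms] less_irrefl by auto
  ultimately show ?thesis using nojump g(1,4) less_mem by (intro exI[of _ g]) auto
qed

text \<open>
  Add to a countable dense set all neighbours of its points across jumps. Separating all pairs of
  points of the resulting countable set \<open>D\<close> leaves only jumps between points outside \<open>D\<close>
  unseparated.
\<close>

lemma separable_line_map:
  assumes sep: "separable_space T" and "infinite K"
  obtains D0 \<theta> where "\<And>U. openin T U \<Longrightarrow> U \<noteq> {} \<Longrightarrow> \<exists>d\<in>D0. d \<in> U"
    "line_map K r \<theta>"
    "\<And>d d'. d \<in> D0 \<Longrightarrow> jump d d' \<or> jump d' d \<Longrightarrow> \<theta> d \<noteq> \<theta> d'"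
    "\<And>d d' p q. d \<in> D0 \<Longrightarrow> d' \<in> D0 \<Longrightarrow> d \<sqsubset> d' \<Longrightarrow> jump p q \<Longrightarrow> \<not> p \<sqsubset> d \<Longrightarrow> \<not> d' \<sqsubset> q \<Longrightarrow>
       \<exists>p q. jump p q \<and> \<not> p \<sqsubset> d \<and> \<not> d' \<sqsubset> q \<and> \<theta> p < \<theta> q"
proof -
  obtain D0 where D0: "countable D0" "D0 \<subseteq> K" "T closure_of D0 = topspace T"
    using sep by (auto simp: separable_space_def)
  have dense: "\<exists>d\<in>D0. d \<in> U" if "openin T U" "U \<noteq> {}" for U
    using D0(3) that unfolding dense_intersects_open by blast
  have dense_between: "\<exists>d\<in>D0. x \<sqsubset> d \<and> d \<sqsubset> y" if "x \<sqsubset> z" "z \<sqsubset> y" for x y z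
  proof -
    have "openin T (between {x} {y})"
      using that less_mem by (intro openin_between) auto
    moreover have "z \<in> between {x} {y}" using that less_mem by (auto simp: between_def)
    ultimately show ?thesis using dense[of "between {x} {y}"] by (auto simp: between_def)
  qed
  define D where "D = D0 \<union> {x. \<exists>d\<in>D0. jump d x \<or> jump x d}"
  define P where "P = {(d, d'). d \<in> D \<and> d' \<in> D \<and> d \<sqsubset> d'}"
  define good where "good d d' g \<longleftrightarrow> continuous_map T euclideanreal g \<and> (\<forall>x. 0 \<le> g x \<and> g x \<le> 1) \<and>
      (\<forall>x y. x \<sqsubset> y \<longrightarrow> g x \<le> g y) \<and> g d < g d' \<and>
      ((\<exists>p q. jump p q \<and> \<not> p \<sqsubset> d \<and> \<not> d' \<sqsubset> q) \<longrightarrow>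
       (\<exists>p q. jump p q \<and> \<not> p \<sqsubset> d \<and> \<not> d' \<sqsubset> q \<and> g p < g q))" for d d' and g :: "'k \<Rightarrow> real"
  define \<G> where "\<G> = (\<lambda>(d, d'). SOME g. good d d' g) ` P"
  have good: "good d d' (SOME g. good d d' g)" if "(d, d') \<in> P" for d d'
  proof -
    have "\<exists>g. good d d' g"
      using separating_function[of d d'] that by (simp add: good_def P_def)
    then show ?thesis by (rule someI_ex)
  qed
  have \<G>D: "\<exists>d d'. (d, d') \<in> P \<and> good d d' g" if "g \<in> \<G>" for g
    using that good by (auto simp: \<G>_def)
  have two: "\<exists>d d'. (d, d') \<in> P \<and> \<not> d \<sqsubset> x \<and> \<not> y \<sqsubset> d'" if xy: "x \<sqsubset> y" "\<not> jump x y" for x y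
  proof -
    obtain z where z: "x \<sqsubset> z" "z \<sqsubset> y" using xy by (auto simp: jump_def)
    obtain d where d: "d \<in> D0" "x \<sqsubset> d" "d \<sqsubset> y" using dense_between[OF z] by blast
    show ?thesis
    proof (cases "jump x d")
      case True
      then have "(x, d) \<in> P" using d by (auto simp: P_def D_def)
      then show ?thesis using d less_irrefl less_asym by blast
    next
      case False
      then obtain z' where "x \<sqsubset> z'" "z' \<sqsubset> d" using d by (auto simp: jump_def)
      then obtain d' where "d' \<in> D0" "x \<sqsubset> d'" "d' \<sqsubset> d" using dense_between by blast
      then have "(d', d) \<in> P" "\<not> d' \<sqsubset> x" using d less_asym by (auto simp: P_def D_def)
      then show ?thesis using d less_asym by blast
    qed
  qed
  have "countable P"
  proof (rule countable_subset[of _ "D \<times> D"])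
    show "countable (D \<times> D)"
      unfolding D_def using D0(1) countable_neighbours[OF D0(1)] by blast
  qed (auto simp: P_def)
  then have "countable \<G>" by (simp add: \<G>_def)
  have "\<G> \<noteq> {}"
  proof -
    have "\<exists>x y. x \<sqsubset> y \<and> \<not> jump x y"
    proof (rule ccontr)
      assume no: "\<not> ?thesis"
      obtain x where x: "x \<in> K" using infinite_imp_nonempty[OF \<open>infinite K\<close>] by blast
      have "K \<subseteq> {x} \<union> {y. jump x y} \<union> {y. jump y x}"
        using no less_linear[OF x] by blast
      moreover have "finite {y. jump x y}" "finite {y. jump y x}"
        by (rule finite_if_finite_subsets_card_bdd[of _ 1, THEN conjunct1]; use jump_unique in \<open>fastforce simp: card_le_Suc0_iff_eq\<close>)+
      ultimately show False using \<open>infinite K\<close> finite_subset by (metis finite.emptyI finite_UnI finite_insert)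
    qed
    then show ?thesis using two by (fastforce simp: \<G>_def)
  qed
  obtain \<theta> w where \<theta>: "continuous_map T euclideanreal \<theta>" "\<And>x. 0 \<le> \<theta> x \<and> \<theta> x \<le> (1::real)"
    "\<And>g. g \<in> \<G> \<Longrightarrow> (0::real) < w g"
    "\<And>x y g. \<forall>g\<in>\<G>. g x \<le> g y \<Longrightarrow> g \<in> \<G> \<Longrightarrow> w g * (g y - g x) \<le> \<theta> y - \<theta> x"
  proof (rule countable_family_sum[OF \<open>countable \<G>\<close> \<open>\<G> \<noteq> {}\<close>])
    show "continuous_map T euclideanreal g" "0 \<le> g x \<and> g x \<le> 1" if "g \<in> \<G>" for g x
      using \<G>D[OF that] by (auto simp: good_def)
  qed (rule that, assumption+)
  have mono: "g x \<le> g y" if "g \<in> \<G>" "x \<sqsubset> y" for g x y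
    using \<G>D[OF that(1)] that(2) unfolding good_def by blast
  have \<theta>_le: "\<theta> x \<le> \<theta> y" if xy: "x \<sqsubset> y" for x y
  proof -
    obtain g where g: "g \<in> \<G>" using \<open>\<G> \<noteq> {}\<close> by blast
    have "0 \<le> w g * (g y - g x)" using \<theta>(3)[OF g] mono[OF g xy] by simp
    also have "\<dots> \<le> \<theta> y - \<theta> x" using g mono xy by (intro \<theta>(4)) auto
    finally show ?thesis by simp
  qed
  have \<theta>_less: "\<theta> x < \<theta> y" if xy: "x \<sqsubset> y" and g: "g \<in> \<G>" "g x < g y" for x y g
  proof -
    have "0 < w g * (g y - g x)" using \<theta>(3)[OF g(1)] g(2) by simp
    also have "\<dots> \<le> \<theta> y - \<theta> x" using g mono xy by (intro \<theta>(4)) auto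
    finally show ?thesis by simp
  qed
  have sep_D: "\<theta> d < \<theta> d'" if "(d, d') \<in> P" for d d'
  proof (rule \<theta>_less)
    show "d \<sqsubset> d'" using that by (simp add: P_def)
    show "(SOME g. good d d' g) \<in> \<G>" using that by (force simp: \<G>_def)
    show "(SOME g. good d d' g) d < (SOME g. good d d' g) d'"
      using good[OF that] by (simp add: good_def)
  qed
  have \<theta>_le': "\<theta> x \<le> \<theta> y" if "x \<in> K" "y \<in> K" "\<not> y \<sqsubset> x" for x y
    using less_linear[OF that(1,2)] \<theta>_le that(3) by auto
  show thesis
  proof (rule that[of D0 \<theta>])
    show "line_map K r \<theta>"
    proof
      fix x y assume xy: "x \<sqsubset> y" "\<theta> x = \<theta> y"
      show "jump x y"
      proof (rule ccontr)
        assume "\<not> jump x y"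
        then obtain d d' where d: "(d, d') \<in> P" "\<not> d \<sqsubset> x" "\<not> y \<sqsubset> d'" using two[OF xy(1)] by blast
        then have "d \<in> K" "d' \<in> K" using less_mem by (auto simp: P_def)
        then have "\<theta> x \<le> \<theta> d" "\<theta> d' \<le> \<theta> y" using d less_mem[OF xy(1)] by (auto intro: \<theta>_le')
        then show False using sep_D[OF d(1)] xy(2) by simp
      qed
    qed (use \<theta> \<theta>_le in auto)
  next
    fix d d' assume d: "d \<in> D0" "jump d d' \<or> jump d' d"
    then have "d \<in> D" "d' \<in> D" "d \<sqsubset> d' \<or> d' \<sqsubset> d" by (auto simp: D_def jump_def)
    then show "\<theta> d \<noteq> \<theta> d'" using sep_D[of d d'] sep_D[of d' d] by (force simp: P_def)
  next
    fix d d' p q assume d: "d \<in> D0" "d' \<in> D0" "d \<sqsubset> d'" and pq: "jump p q" "\<not> p \<sqsubset> d" "\<not> d' \<sqsubset> q"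
    then have dd: "(d, d') \<in> P" by (simp add: P_def D_def)
    define g where "g = (SOME g. good d d' g)"
    have "good d d' g" using good[OF dd] by (simp add: g_def)
    then obtain p' q' where "jump p' q'" "\<not> p' \<sqsubset> d" "\<not> d' \<sqsubset> q'" "g p' < g q'"
      using pq unfolding good_def by blast
    moreover have "g \<in> \<G>" using dd by (force simp: \<G>_def g_def)
    ultimately show "\<exists>p q. jump p q \<and> \<not> p \<sqsubset> d \<and> \<not> d' \<sqsubset> q \<and> \<theta> p < \<theta> q"
      using \<theta>_less[of _ _ g] by (meson jump_def)
  qed (use dense in blast)
qed

text \<open>
  In the presentation obtained in this way, intervals contained in the image come from connected
  pieces of the line: a split point or a jump inside such an interval would force a gap there.
\<close>

theorem separable_compact_line_representation:
  assumes compact: "compact_space T" and sep: "separable_space T" and "infinite K"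
  obtains \<theta> where "line_map K r \<theta>" "compact (\<theta> ` K)" "\<theta> ` K \<subseteq> {0..1}" "0 \<in> \<theta> ` K" "1 \<in> \<theta> ` K"
    "line_map.doubles r \<theta> \<subseteq> {0<..<1}" "line_map.doubles r \<theta> \<inter> interior (\<theta> ` K) = {}"
    "interior (\<theta> ` K) = {} \<longleftrightarrow> zero_dim"
proof -
  obtain D0 \<theta>0 where D0: "\<And>U. openin T U \<Longrightarrow> U \<noteq> {} \<Longrightarrow> \<exists>d\<in>D0. d \<in> U"
    and lm0: "line_map K r \<theta>0"
    and nb0: "\<And>d d'. d \<in> D0 \<Longrightarrow> jump d d' \<or> jump d' d \<Longrightarrow> \<theta>0 d \<noteq> \<theta>0 d'"
    and jp0: "\<And>d d' p q. d \<in> D0 \<Longrightarrow> d' \<in> D0 \<Longrightarrow> d \<sqsubset> d' \<Longrightarrow> jump p q \<Longrightarrow> \<not> p \<sqsubset> d \<Longrightarrow> \<not> d' \<sqsubset> q \<Longrightarrow>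
       \<exists>p q. jump p q \<and> \<not> p \<sqsubset> d \<and> \<not> d' \<sqsubset> q \<and> \<theta>0 p < \<theta>0 q"
    by (rule separable_line_map[OF sep \<open>infinite K\<close>]) (rule that, assumption+)
  interpret L0: line_map K r \<theta>0 by (rule lm0)
  have "K \<noteq> {}" using \<open>infinite K\<close> by auto
  have cpt0: "compact (\<theta>0 ` K)"
    using image_compactin[OF _ L0.cont, of K] compact by (simp add: compact_space_def)
  obtain m where m: "m \<in> \<theta>0 ` K" "\<And>t. t \<in> \<theta>0 ` K \<Longrightarrow> m \<le> t"
    using compact_attains_inf[OF cpt0] \<open>K \<noteq> {}\<close> by blast
  obtain M where M: "M \<in> \<theta>0 ` K" "\<And>t. t \<in> \<theta>0 ` K \<Longrightarrow> t \<le> M"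
    using compact_attains_sup[OF cpt0] \<open>K \<noteq> {}\<close> by blast
  have "m \<noteq> M"
  proof
    assume "m = M"
    then have "\<theta>0 x = m" if "x \<in> K" for x using m(2) M(2) that by (simp add: antisym)
    then have "K \<subseteq> {L0.lo m, L0.hi m}" using L0.lo_hi_cases by blast
    then show False using \<open>infinite K\<close> finite_subset by blast
  qed
  then have mM: "0 < M - m" using m(2)[OF M(1)] by simp
  define \<theta> where "\<theta> x = (\<theta>0 x - m) / (M - m)" for x
  have \<theta>_less: "\<theta> x < \<theta> y \<longleftrightarrow> \<theta>0 x < \<theta>0 y" and \<theta>_eq: "\<theta> x = \<theta> y \<longleftrightarrow> \<theta>0 x = \<theta>0 y" for x y
    using mM by (auto simp: \<theta>_def divide_less_cancel)
  have lm: "line_map K r \<theta>"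
  proof
    show "continuous_map T euclideanreal \<theta>"
      unfolding \<theta>_def[abs_def] using L0.cont by (intro continuous_intros) (use mM in auto)
    show "\<theta> x \<le> \<theta> y" if "x \<sqsubset> y" for x y
      using L0.mono[OF that] mM by (simp add: \<theta>_def divide_right_mono)
    show "jump x y" if "x \<sqsubset> y" "\<theta> x = \<theta> y" for x y
      using L0.fibre_jump[OF that(1)] that(2) \<theta>_eq by blast
  qed
  interpret L: line_map K r \<theta> by (rule lm)
  define F where "F = \<theta> ` K"
  have F: "compact F"
    unfolding F_def using image_compactin[OF _ L.cont, of K] compact by (simp add: compact_space_def)
  have F01: "F \<subseteq> {0..1}"
    using m(2) M(2) mM by (auto simp: F_def \<theta>_def field_simps)
  have "0 \<in> F" "1 \<in> F"
    using m(1) M(1) mM by (auto simp: F_def \<theta>_def image_iff field_simps)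
  have dense_between: "\<exists>d\<in>D0. x \<sqsubset> d \<and> d \<sqsubset> y" if "x \<sqsubset> z" "z \<sqsubset> y" for x y z
  proof -
    have "openin T (between {x} {y})"
      using that less_mem by (intro openin_between) auto
    moreover have "z \<in> between {x} {y}" using that less_mem by (auto simp: between_def)
    ultimately show ?thesis using D0[of "between {x} {y}"] by (auto simp: between_def)
  qed
  have \<theta>_le': "\<theta> x \<le> \<theta> y" if "x \<in> K" "y \<in> K" "\<not> y \<sqsubset> x" for x y
    using less_linear[OF that(1,2)] L.mono that(3) by auto
  have gap: "\<exists>s. \<theta> d < s \<and> s < \<theta> d' \<and> s \<notin> F"
    if d: "d \<in> D0" "d' \<in> D0" "d \<sqsubset> d'" and pq: "jump p q" "\<not> p \<sqsubset> d" "\<not> d' \<sqsubset> q" for d d' p q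
  proof -
    obtain p' q' where j: "jump p' q'" "\<not> p' \<sqsubset> d" "\<not> d' \<sqsubset> q'" "\<theta> p' < \<theta> q'"
      using jp0[OF d pq] \<theta>_less by blast
    obtain s where s: "\<theta> p' < s" "s < \<theta> q'" using dense[OF j(4)] by blast
    have "\<theta> d \<le> \<theta> p'" "\<theta> q' \<le> \<theta> d'"
      using j less_mem[OF d(3)] jump_mem[OF j(1)] by (auto intro: \<theta>_le')
    moreover have "s \<notin> F"
    proof
      assume "s \<in> F"
      then obtain z where z: "z \<in> K" "\<theta> z = s" by (auto simp: F_def)
      then have "p' \<sqsubset> z" "z \<sqsubset> q'"
        using s jump_mem[OF j(1)] by (auto intro: L.mono_strict)
      then show False using j(1) by (auto simp: jump_def)
    qed
    ultimately show ?thesis using s by (intro exI[of _ s]) auto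
  qed
  have pt: "\<exists>z\<in>K. \<theta> z = s" if "s \<in> F" for s using that by (auto simp: F_def)
  have dbl: "L.doubles \<subseteq> {0<..<1}"
  proof
    fix t assume "t \<in> L.doubles"
    then obtain p q where pq: "p \<sqsubset> q" "\<theta> p = t" "\<theta> q = t" by (auto simp: L.doubles_def)
    have j: "jump p q" using pq by (intro L.fibre_jump) auto
    have "\<exists>x. x \<sqsubset> p"
    proof (rule ccontr)
      assume no: "\<not> ?thesis"
      have "{y \<in> K. y \<sqsubset> q} = {p}"
        using j no less_linear[OF jump_mem(1)[OF j]] by (auto simp: jump_def less_mem)
      then have "p \<in> D0" using D0[OF openin_rays(1)[OF jump_mem(2)[OF j]]] by auto
      then show False using nb0[of p q] j pq \<theta>_eq by auto
    qed
    then obtain x where x: "x \<sqsubset> p" by blast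
    have "\<exists>y. q \<sqsubset> y"
    proof (rule ccontr)
      assume no: "\<not> ?thesis"
      have "{y \<in> K. p \<sqsubset> y} = {q}"
        using j no less_linear[OF jump_mem(2)[OF j]] by (auto simp: jump_def less_mem)
      then have "q \<in> D0" using D0[OF openin_rays(2)[OF jump_mem(1)[OF j]]] by auto
      then show False using nb0[of q p] j pq \<theta>_eq by auto
    qed
    then obtain y where y: "q \<sqsubset> y" by blast
    have "\<theta> x \<noteq> t" "\<theta> y \<noteq> t"
      using L.fibre_jump[OF less_trans[OF x pq(1)]] L.fibre_jump[OF less_trans[OF pq(1) y]] x y pq
      by (auto simp: jump_def)
    then have "\<theta> x < t" "t < \<theta> y" using L.mono[OF x] L.mono[OF y] pq by auto
    moreover have "0 \<le> \<theta> x" "\<theta> y \<le> 1" using F01 less_mem(1)[OF x] less_mem(2)[OF y] by (auto simp: F_def)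
    ultimately show "t \<in> {0<..<1}" by simp
  qed
  have dbl_int: "L.doubles \<inter> interior F = {}"
  proof (rule ccontr)
    assume "L.doubles \<inter> interior F \<noteq> {}"
    then obtain t where t: "t \<in> L.doubles" "t \<in> interior F" by blast
    then obtain p q where pq: "p \<sqsubset> q" "\<theta> p = t" "\<theta> q = t" by (auto simp: L.doubles_def)
    have j: "jump p q" using pq by (intro L.fibre_jump) auto
    obtain e where e: "0 < e" "ball t e \<subseteq> F" using t(2) mem_interior by blast
    then have inF: "s \<in> F" if "t - e < s" "s < t + e" for s
      using that by (auto simp: dist_real_def subset_iff)
    obtain z1 where z1: "z1 \<in> K" "\<theta> z1 = t - e/2" using pt[OF inF[of "t - e/2"]] e by auto
    obtain z2 where z2: "z2 \<in> K" "\<theta> z2 = t - e/4" using pt[OF inF[of "t - e/4"]] e by auto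
    obtain z3 where z3: "z3 \<in> K" "\<theta> z3 = t + e/4" using pt[OF inF[of "t + e/4"]] e by auto
    obtain z4 where z4: "z4 \<in> K" "\<theta> z4 = t + e/2" using pt[OF inF[of "t + e/2"]] e by auto
    have "z1 \<sqsubset> z2" "z2 \<sqsubset> p" "q \<sqsubset> z3" "z3 \<sqsubset> z4"
      using z1 z2 z3 z4 pq less_mem[OF pq(1)] e(1) by (auto intro: L.mono_strict)
    then obtain d d' where d: "d \<in> D0" "z1 \<sqsubset> d" "d \<sqsubset> p" "d' \<in> D0" "q \<sqsubset> d'" "d' \<sqsubset> z4"
      using dense_between by meson
    have "d \<sqsubset> d'" using less_trans[OF less_trans[OF d(3) pq(1)] d(5)] .
    then obtain s where "\<theta> d < s" "s < \<theta> d'" "s \<notin> F"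
      using gap[OF d(1,4) _ j] less_asym[OF d(3)] less_asym[OF d(5)] by blast
    moreover have "t - e/2 \<le> \<theta> d" "\<theta> d' \<le> t + e/2"
      using L.mono[OF d(2)] L.mono[OF d(6)] z1 z4 by auto
    ultimately show False using inF[of s] e(1) by auto
  qed
  have zd: "interior F = {} \<longleftrightarrow> zero_dim"
  proof
    assume int: "interior F = {}"
    show zero_dim
      unfolding zero_dim_def
    proof (intro allI impI)
      fix x y assume xy: "x \<sqsubset> y"
      show "\<exists>p q. jump p q \<and> \<not> p \<sqsubset> x \<and> \<not> y \<sqsubset> q"
      proof (cases "\<theta> x = \<theta> y")
        case True
        then show ?thesis using L.fibre_jump[OF xy] less_irrefl by blast
      next
        case False
        then have "\<theta> x < \<theta> y" using L.mono[OF xy] by simp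
        then have "\<not> {\<theta> x<..<\<theta> y} \<subseteq> F"
          using int interior_maximal[of "{\<theta> x<..<\<theta> y}" F] by auto
        then obtain t where "t \<in> {\<theta> x<..<\<theta> y} - F" by blast
        then have t: "\<theta> x < t" "t < \<theta> y" "t \<notin> F" by simp_all
        define u v where "u = Sup (F \<inter> {..t})" and "v = Inf (F \<inter> {t..})"
        have xF: "\<theta> x \<in> F" and yF: "\<theta> y \<in> F" using less_mem[OF xy] by (auto simp: F_def)
        have cl: "closed (F \<inter> {..t})" "closed (F \<inter> {t..})" using F by (auto simp: compact_imp_closed)
        have bd: "bdd_above (F \<inter> {..t})" "bdd_below (F \<inter> {t..})" by auto
        have u: "u \<in> F \<inter> {..t}"
          unfolding u_def using xF t cl bd by (intro closed_contains_Sup) auto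
        have v: "v \<in> F \<inter> {t..}"
          unfolding v_def using yF t cl bd by (intro closed_contains_Inf) auto
        have uv: "u < t" "t < v" using u v t(3) by (auto simp: less_le)
        have out: "s \<le> u \<or> v \<le> s" if "s \<in> F" for s
        proof (cases "s \<le> t")
          case True then show ?thesis using cSup_upper[OF _ bd(1), of s] that by (simp add: u_def)
        next
          case False then show ?thesis using cInf_lower[OF _ bd(2), of s] that by (simp add: v_def)
        qed
        have uK: "u \<in> \<theta> ` K" and vK: "v \<in> \<theta> ` K" using u v by (auto simp: F_def)
        have "L.hi u \<sqsubset> L.lo v"
          using L.hi(1,2)[OF uK] L.lo(1,2)[OF vK] uv by (intro L.mono_strict) auto
        moreover have "\<not> (L.hi u \<sqsubset> z \<and> z \<sqsubset> L.lo v)" for z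
          using L.hi(3)[OF uK, of z] L.lo(3)[OF vK, of z] out[of "\<theta> z"] less_mem(1)[of z "L.lo v"]
          by (auto simp: F_def)
        moreover have "\<not> L.hi u \<sqsubset> x" "\<not> y \<sqsubset> L.lo v"
          using L.hi(3)[OF uK, of x] L.lo(3)[OF vK, of y] out[OF xF] out[OF yF] uv t by auto
        ultimately show ?thesis unfolding jump_def by blast
      qed
    qed
  next
    assume zd: zero_dim
    show "interior F = {}"
    proof (rule ccontr)
      assume "interior F \<noteq> {}"
      then obtain t where "t \<in> interior F" by blast
      then obtain e where e: "0 < e" "ball t e \<subseteq> F" using mem_interior by blast
      then have inF: "s \<in> F" if "t - e < s" "s < t + e" for s
        using that by (auto simp: dist_real_def subset_iff)
      obtain z1 where z1: "z1 \<in> K" "\<theta> z1 = t - e/2" using pt[OF inF[of "t - e/2"]] e by auto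
      obtain z2 where z2: "z2 \<in> K" "\<theta> z2 = t - e/4" using pt[OF inF[of "t - e/4"]] e by auto
      obtain z3 where z3: "z3 \<in> K" "\<theta> z3 = t" using pt[OF inF[of t]] e by auto
      obtain z4 where z4: "z4 \<in> K" "\<theta> z4 = t + e/4" using pt[OF inF[of "t + e/4"]] e by auto
      obtain z5 where z5: "z5 \<in> K" "\<theta> z5 = t + e/2" using pt[OF inF[of "t + e/2"]] e by auto
      have "z1 \<sqsubset> z2" "z2 \<sqsubset> z3" "z3 \<sqsubset> z4" "z4 \<sqsubset> z5"
        using z1 z2 z3 z4 z5 e(1) by (auto intro: L.mono_strict)
      then obtain d d' where d: "d \<in> D0" "z1 \<sqsubset> d" "d \<sqsubset> z3" "d' \<in> D0" "z3 \<sqsubset> d'" "d' \<sqsubset> z5"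
        using dense_between by meson
      have dd: "d \<sqsubset> d'" using less_trans[OF d(3,5)] .
      then obtain p q where "jump p q" "\<not> p \<sqsubset> d" "\<not> d' \<sqsubset> q" using zd unfolding zero_dim_def by blast
      then obtain s where "\<theta> d < s" "s < \<theta> d'" "s \<notin> F" using gap[OF d(1,4) dd] by blast
      moreover have "t - e/2 \<le> \<theta> d" "\<theta> d' \<le> t + e/2"
        using L.mono[OF d(2)] L.mono[OF d(6)] z1 z5 by auto
      ultimately show False using inF[of s] e(1) by auto
    qed
  qed
  show thesis
    using that[OF lm] F F01 \<open>0 \<in> F\<close> \<open>1 \<in> F\<close> dbl dbl_int zd unfolding F_def by blast
qed

subsection \<open>Weight and jumps\<close>

text \<open>
  Some basic open set contains the lower point of a jump, but nothing above this point, which is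
  then its maximum. So different jumps need different basic sets.
\<close>

lemma jumps_le_weight:
  assumes "has_weight T omega1"
  shows "|jumps| \<le>o omega1"
proof -
  obtain \<B> where \<B>: "base_of_topology T \<B>" "|\<B>| =o omega1"
    using assms by (auto simp: has_weight_def)
  have "\<exists>V\<in>\<B>. p \<in> V \<and> (\<forall>x\<in>V. \<not> p \<sqsubset> x)" if "p \<in> jumps" for p
  proof -
    obtain q where q: "jump p q" using \<open>p \<in> jumps\<close> by (auto simp: jumps_def)
    have "p \<in> {x \<in> K. x \<sqsubset> q}" using q jump_mem by (auto simp: jump_def)
    then obtain V where "V \<in> \<B>" "p \<in> V" "V \<subseteq> {x \<in> K. x \<sqsubset> q}"
      using \<B>(1) openin_rays(1)[OF jump_mem(2)[OF q]] unfolding base_of_topology_def by meson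
    then show ?thesis using jump_cut[OF q] by blast
  qed
  then obtain V where V: "\<And>p. p \<in> jumps \<Longrightarrow> V p \<in> \<B> \<and> p \<in> V p \<and> (\<forall>x\<in>V p. \<not> p \<sqsubset> x)"
    by metis
  have "inj_on V jumps"
  proof (rule inj_onI)
    fix p q assume pq: "p \<in> jumps" "q \<in> jumps" "V p = V q"
    then have "\<not> p \<sqsubset> q" "\<not> q \<sqsubset> p" using V[of p] V[of q] by auto
    moreover have "p \<in> K" "q \<in> K" using pq jump_mem by (auto simp: jumps_def)
    ultimately show "p = q" using less_linear by blast
  qed
  then have "|jumps| \<le>o |\<B>|"
    using V by (intro card_of_ordLeqI) auto
  then show ?thesis using \<B>(2) by (rule ordLeq_ordIso_trans)
qed

text \<open>
  If there were only countably many jumps, then their points together with a countable dense set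
  would be the end points of a countable base of intervals.
\<close>

lemma uncountable_jumps:
  assumes "has_weight T omega1" and sep: "separable_space T"
  shows "uncountable jumps"
proof
  assume cnt: "countable jumps"
  obtain D0 where D0: "countable D0" "D0 \<subseteq> K" "T closure_of D0 = topspace T"
    using sep by (auto simp: separable_space_def)
  have dense_between: "\<exists>d\<in>D0. x \<sqsubset> d \<and> d \<sqsubset> y" if "x \<sqsubset> z" "z \<sqsubset> y" for x y z
  proof -
    have "openin T (between {x} {y})"
      using that less_mem by (intro openin_between) auto
    moreover have "z \<in> between {x} {y}" using that less_mem by (auto simp: between_def)
    ultimately show ?thesis
      using D0(3) unfolding dense_intersects_open between_def by fastforce
  qed
  define D where "D = D0 \<union> jumps \<union> {x. \<exists>d\<in>jumps. jump d x \<or> jump x d}"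
  have "countable D"
    unfolding D_def using cnt D0(1) countable_neighbours[OF cnt] by blast
  have DK: "D \<subseteq> K" using D0(2) jump_mem by (auto simp: D_def jumps_def)
  define \<B> where "\<B> = (\<lambda>(P, Q). between P Q) ` ({P. finite P \<and> P \<subseteq> D} \<times> {Q. finite Q \<and> Q \<subseteq> D})"
  have "countable \<B>"
    unfolding \<B>_def using countable_Collect_finite_subset[OF \<open>countable D\<close>] by blast
  have "base_of_topology T \<B>"
    unfolding base_of_topology_def
  proof (intro conjI ballI allI impI)
    fix V assume "V \<in> \<B>"
    then show "openin T V" using DK by (auto simp: \<B>_def intro!: openin_between)
  next
    fix U x assume "openin T U \<and> x \<in> U"
    then obtain P Q where PQ: "finite P" "finite Q" "P \<subseteq> K" "Q \<subseteq> K" "x \<in> between P Q" "between P Q \<subseteq> U"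
      using openin_imp_between by metis
    have "\<exists>p'\<in>D. \<not> p' \<sqsubset> p \<and> p' \<sqsubset> x" if "p \<in> P" for p
    proof -
      have px: "p \<sqsubset> x" using that PQ(5) by (simp add: between_def)
      show ?thesis
      proof (cases "jump p x")
        case True
        then show ?thesis using px less_irrefl by (intro bexI[of _ p]) (auto simp: D_def jumps_def)
      next
        case False
        then show ?thesis using px dense_between[of p _ x] less_asym by (auto simp: jump_def D_def) blast
      qed
    qed
    then obtain f where f: "\<And>p. p \<in> P \<Longrightarrow> f p \<in> D \<and> \<not> f p \<sqsubset> p \<and> f p \<sqsubset> x" by metis
    have "\<exists>q'\<in>D. \<not> q \<sqsubset> q' \<and> x \<sqsubset> q'" if "q \<in> Q" for q
    proof -
      have xq: "x \<sqsubset> q" using that PQ(5) by (simp add: between_def)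
      show ?thesis
      proof (cases "jump x q")
        case True
        then show ?thesis using xq less_irrefl by (intro bexI[of _ q]) (auto simp: D_def jumps_def)
      next
        case False
        then show ?thesis using xq dense_between[of x _ q] less_asym by (auto simp: jump_def D_def) blast
      qed
    qed
    then obtain g where g: "\<And>q. q \<in> Q \<Longrightarrow> g q \<in> D \<and> \<not> q \<sqsubset> g q \<and> x \<sqsubset> g q" by metis
    have "between (f ` P) (g ` Q) \<subseteq> between P Q"
    proof
      fix y assume y: "y \<in> between (f ` P) (g ` Q)"
      have "p \<sqsubset> y" if "p \<in> P" for p
        using y f[OF that] that PQ(3) le_less_trans[of "f p" y p] by (auto simp: between_def)
      moreover have "y \<sqsubset> q" if "q \<in> Q" for q
        using y g[OF that] that PQ(4) less_le_trans[of y "g q" q] by (auto simp: between_def)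
      ultimately show "y \<in> between P Q" using y by (auto simp: between_def)
    qed
    moreover have "x \<in> between (f ` P) (g ` Q)" using f g PQ(5) by (auto simp: between_def)
    moreover have "between (f ` P) (g ` Q) \<in> \<B>"
      using f g PQ(1,2) unfolding \<B>_def by (intro image_eqI[of _ _ "(f ` P, g ` Q)"]) auto
    ultimately show "\<exists>V\<in>\<B>. x \<in> V \<and> V \<subseteq> U" using PQ(6) by blast
  qed
  then have "omega1 \<le>o |\<B>|" using assms(1) by (simp add: has_weight_def)
  moreover have "|\<B>| \<le>o natLeq" using \<open>countable \<B>\<close> by (simp add: countable_iff_card_le_natLeq)
  ultimately have "omega1 \<le>o natLeq" by (rule ordLeq_transitive)
  then show False
    using cardSuc_greater[OF natLeq_Card_order] not_ordLess_ordLeq by blast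
qed

end

context line_map
begin

lemma doubles_le_omega1:
  assumes "|jumps| \<le>o omega1"
  shows "|doubles| \<le>o omega1"
proof -
  have "doubles \<subseteq> \<theta> ` jumps"
    using fibre_jump by (force simp: doubles_def jumps_def)
  then show ?thesis by (rule card_subset_le_omega1[OF _ card_image_le_omega1[OF assms]])
qed

text \<open>The jumps that the map separates leave disjoint intervals, so there are only countably many.\<close>

lemma uncountable_doubles:
  assumes "uncountable jumps"
  shows "uncountable doubles"
proof
  assume cnt: "countable doubles"
  define s where "s p = (SOME q. jump p q)" for p
  have s: "jump p (s p)" if "p \<in> jumps" for p
    using that by (auto simp: s_def jumps_def intro: someI)
  define J1 where "J1 = {p \<in> jumps. \<theta> p = \<theta> (s p)}"
  define J2 where "J2 = {p \<in> jumps. \<theta> p < \<theta> (s p)}"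
  have inj: "inj_on \<theta> J1"
  proof (rule inj_onI)
    have no: False if pq: "p \<in> J1" "q \<in> J1" "\<theta> p = \<theta> q" "p \<sqsubset> q" for p q
    proof -
      have jq: "jump q (s q)" "\<theta> q = \<theta> (s q)" using pq(2) s by (auto simp: J1_def)
      then have "jump p (s q)"
        using pq less_trans by (intro fibre_jump) (auto simp: jump_def)
      then show False using pq(4) jq(1) by (auto simp: jump_def)
    qed
    fix p q assume pq: "p \<in> J1" "q \<in> J1" "\<theta> p = \<theta> q"
    then have "p \<in> K" "q \<in> K" using jump_mem by (auto simp: J1_def jumps_def)
    then show "p = q" using less_linear no[OF pq] no[OF pq(2,1) pq(3)[symmetric]] by blast
  qed
  have "\<theta> ` J1 \<subseteq> doubles"
  proof
    fix t assume "t \<in> \<theta> ` J1"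
    then obtain p where "p \<in> jumps" "\<theta> p = \<theta> (s p)" "t = \<theta> p" by (auto simp: J1_def)
    then show "t \<in> doubles" using s[of p] by (auto simp: doubles_def jump_def)
  qed
  then have "countable (\<theta> ` J1)" using cnt by (rule countable_subset)
  then have "countable J1" using inj by (rule countable_image_inj_on)
  define I where "I p = {\<theta> p<..<\<theta> (s p)}" for p
  have disj: "I p \<inter> I q = {}" if pq: "p \<in> J2" "q \<in> J2" "p \<sqsubset> q" for p q
  proof -
    have "jump p (s p)" using s pq(1) by (simp add: J2_def)
    then have "\<not> q \<sqsubset> s p" "s p \<in> K" "q \<in> K"
      using pq(3) jump_mem less_mem by (auto simp: jump_def)
    then have "\<theta> (s p) \<le> \<theta> q" using less_linear[of "s p" q] mono by auto
    then show ?thesis by (auto simp: I_def)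
  qed
  have disj': "I p \<inter> I q = {}" if "p \<in> J2" "q \<in> J2" "p \<noteq> q" for p q
  proof -
    have "p \<in> K" "q \<in> K" using that jump_mem by (auto simp: J2_def jumps_def)
    then show ?thesis using less_linear[of p q] disj[of p q] disj[of q p] that by blast
  qed
  have ne: "I p \<noteq> {}" if "p \<in> J2" for p
    using that by (auto simp: I_def J2_def)
  have "inj_on I J2"
    using disj' ne by (metis inf.idem inj_onI)
  moreover have "countable (I ` J2)"
  proof (rule countable_disjoint_open_subsets)
    show "disjoint (I ` J2)"
      using disj' by (auto intro!: disjointI)
  qed (auto simp: I_def)
  ultimately have "countable J2" using countable_image_inj_on by blast
  moreover have "jumps \<subseteq> J1 \<union> J2"
  proof
    fix p assume p: "p \<in> jumps"
    then show "p \<in> J1 \<union> J2"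
      using s[OF p] mono[of p "s p"] by (auto simp: J1_def J2_def jump_def)
  qed
  ultimately show False
    using assms countable_subset[OF _ countable_Un[OF \<open>countable J1\<close>]] by blast
qed

end

section \<open>Covering dimension of compact lines\<close>

lemma covering_dim_leE:
  assumes "covering_dim_le X n" "finite \<U>" "\<forall>U\<in>\<U>. openin X U" "\<Union>\<U> = topspace X"
  obtains \<V> where "finite \<V>" "\<forall>V\<in>\<V>. openin X V" "\<Union>\<V> = topspace X"
    "\<forall>V\<in>\<V>. \<exists>U\<in>\<U>. V \<subseteq> U" "\<forall>x\<in>topspace X. int (card {V \<in> \<V>. x \<in> V}) \<le> n + 1"
proof -
  have "\<forall>\<U>. finite \<U> \<and> (\<forall>U\<in>\<U>. openin X U) \<and> \<Union>\<U> = topspace X \<longrightarrow>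
       (\<exists>\<V>. finite \<V> \<and> (\<forall>V\<in>\<V>. openin X V) \<and> \<Union>\<V> = topspace X \<and>
            (\<forall>V\<in>\<V>. \<exists>U\<in>\<U>. V \<subseteq> U) \<and>
            (\<forall>x\<in>topspace X. int (card {V \<in> \<V>. x \<in> V}) \<le> n + 1))"
    using assms(1) unfolding covering_dim_le_def by (rule conjunct2)
  note mp[OF spec[OF this] conjI[OF assms(2) conjI[OF assms(3,4)]]]
  then show thesis using that by (elim exE conjE)
qed

text \<open>Dimension \<open>-1\<close> asks for a cover that has no member at any point.\<close>

lemma covering_dim_empty:
  assumes "topspace X \<noteq> {}"
  shows "\<not> covering_dim_le X (-1)"
proof
  assume "covering_dim_le X (-1)"
  then obtain \<V> where \<V>: "finite \<V>" "\<Union>\<V> = topspace X"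
    "\<forall>x\<in>topspace X. int (card {V \<in> \<V>. x \<in> V}) \<le> -1 + 1"
    by (rule covering_dim_leE[of X "-1" "{topspace X}"]) auto
  obtain x where x: "x \<in> topspace X" using assms by blast
  then have "{V \<in> \<V>. x \<in> V} \<noteq> {}" using \<V>(2) by blast
  then have "card {V \<in> \<V>. x \<in> V} \<noteq> 0" using \<V>(1) by simp
  then show False using \<V>(3) x by force
qed

text \<open>
  Refine the cover by the complements of \<open>x\<close> and \<open>y\<close>. In a refinement without overlaps the member
  that contains \<open>x\<close> is separated from the union of the others by open sets, so it contains all of
  \<open>C\<close>, although it has to miss \<open>x\<close> or \<open>y\<close>.
\<close>

lemma covering_dim_connected:
  assumes C: "connectedin X C" "x \<in> C" "y \<in> C" "x \<noteq> y"
    and xy: "closedin X {x}" "closedin X {y}"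
  shows "\<not> covering_dim_le X 0"
proof
  assume dim: "covering_dim_le X 0"
  define \<U> where "\<U> = {topspace X - {x}, topspace X - {y}}"
  have "finite \<U>" "\<forall>U\<in>\<U>. openin X U" "\<Union>\<U> = topspace X"
    using xy C(4) by (auto simp: \<U>_def)
  then obtain \<V> where \<V>: "finite \<V>" "\<forall>V\<in>\<V>. openin X V" "\<Union>\<V> = topspace X"
    "\<forall>V\<in>\<V>. \<exists>U\<in>\<U>. V \<subseteq> U" "\<forall>z\<in>topspace X. int (card {V \<in> \<V>. z \<in> V}) \<le> 0 + 1"
    by (rule covering_dim_leE[OF dim])
  have CX: "C \<subseteq> topspace X" using C(1) by (rule connectedin_subset_topspace)
  obtain V where V: "V \<in> \<V>" "x \<in> V" using \<V>(3) C(2) CX by blast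
  define W where "W = \<Union>(\<V> - {V})"
  have "V \<inter> W = {}"
  proof (rule ccontr)
    assume "V \<inter> W \<noteq> {}"
    then obtain z V' where z: "z \<in> V" "z \<in> V'" "V' \<in> \<V>" "V' \<noteq> V" by (auto simp: W_def)
    then have "{V, V'} \<subseteq> {V \<in> \<V>. z \<in> V}" using V by auto
    then have "card {V, V'} \<le> card {V \<in> \<V>. z \<in> V}" using \<V>(1) by (intro card_mono) auto
    moreover have "z \<in> topspace X" using z \<V>(3) by blast
    then have "int (card {V \<in> \<V>. z \<in> V}) \<le> 0 + 1" using \<V>(5) by blast
    moreover have "card {V, V'} = 2" using z(4) by simp
    ultimately show False by linarith
  qed
  moreover have "openin X V" "openin X W" using \<V>(2) V(1) by (auto simp: W_def)
  moreover have "C \<subseteq> V \<union> W" using CX \<V>(3) by (auto simp: W_def)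
  moreover have "V \<inter> C \<noteq> {}" using V C(2) by blast
  ultimately have "W \<inter> C = {}"
    using C(1) unfolding connectedin by blast
  then have "y \<in> V" using \<open>C \<subseteq> V \<union> W\<close> C(3) by blast
  then show False using \<V>(4) V by (auto simp: \<U>_def)
qed

text \<open>
  Remove from each set what the sets before it cover: their union is closed, so the remainder is
  still open.
\<close>

lemma clopen_refinement:
  assumes "finite \<W>" "\<And>W. W \<in> \<W> \<Longrightarrow> openin X W \<and> closedin X W"
  shows "\<exists>\<V>. finite \<V> \<and> (\<forall>V\<in>\<V>. openin X V) \<and> \<Union>\<V> = \<Union>\<W> \<and> (\<forall>V\<in>\<V>. \<exists>W\<in>\<W>. V \<subseteq> W) \<and> disjoint \<V>"
  using assms
proof (induction rule: finite_induct)
  case (insert W \<W>)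
  then obtain \<V> where \<V>: "finite \<V>" "\<forall>V\<in>\<V>. openin X V" "\<Union>\<V> = \<Union>\<W>" "\<forall>V\<in>\<V>. \<exists>W\<in>\<W>. V \<subseteq> W" "disjoint \<V>"
    by auto
  have "closedin X (\<Union>\<W>)" using insert by (intro closedin_Union) auto
  then have "openin X (W - \<Union>\<W>)" using insert.prems by (intro openin_diff) auto
  moreover have "disjoint (insert (W - \<Union>\<W>) \<V>)"
    unfolding pairwise_insert using \<V>(3,5) by (auto simp: disjnt_iff)
  moreover have "\<Union>(insert (W - \<Union>\<W>) \<V>) = \<Union>(insert W \<W>)" using \<V>(3) by auto
  ultimately show ?case
    using \<V>(1,2,4) by (intro exI[of _ "insert (W - \<Union>\<W>) \<V>"]) auto
qed (auto intro!: exI[of _ "{}"])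

lemma finite_chain_has_max:
  assumes "finite S" "S \<noteq> {}" "\<And>a b. a \<in> S \<Longrightarrow> b \<in> S \<Longrightarrow> L a \<subseteq> L b \<or> L b \<subseteq> L a"
  shows "\<exists>m\<in>S. \<forall>a\<in>S. L a \<subseteq> L m"
  using assms
proof (induction rule: finite_ne_induct)
  case (insert x S)
  then obtain m where m: "m \<in> S" "\<forall>a\<in>S. L a \<subseteq> L m" by auto
  show ?case
  proof (cases "L m \<subseteq> L x")
    case True then show ?thesis using m by (intro bexI[of _ x]) auto
  next
    case False
    then have "L x \<subseteq> L m" using insert.prems[of m x] m(1) by auto
    then show ?thesis using m by (intro bexI[of _ m]) auto
  qed
qed simp

context line
begin

lemma closedin_singleton: "x \<in> K \<Longrightarrow> closedin T {x}"
proof -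
  assume x: "x \<in> K"
  have "openin T ({y \<in> K. y \<sqsubset> x} \<union> {y \<in> K. x \<sqsubset> y})"
    using openin_rays[OF x] by blast
  moreover have "{y \<in> K. y \<sqsubset> x} \<union> {y \<in> K. x \<sqsubset> y} = K - {x}"
    using less_linear[OF x] less_irrefl by blast
  ultimately show ?thesis using x by (simp add: closedin_def)
qed

lemma clopen_cut:
  assumes "jump p q"
  shows "openin T {y \<in> K. p \<sqsubset> y} \<and> closedin T {y \<in> K. p \<sqsubset> y}"
    and "openin T {y \<in> K. y \<sqsubset> q} \<and> closedin T {y \<in> K. y \<sqsubset> q}"
proof -
  have "K - {y \<in> K. p \<sqsubset> y} = {y \<in> K. y \<sqsubset> q}" "K - {y \<in> K. y \<sqsubset> q} = {y \<in> K. p \<sqsubset> y}"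
    using jump_cut[OF assms] by auto
  then show "openin T {y \<in> K. p \<sqsubset> y} \<and> closedin T {y \<in> K. p \<sqsubset> y}"
    "openin T {y \<in> K. y \<sqsubset> q} \<and> closedin T {y \<in> K. y \<sqsubset> q}"
    using openin_rays jump_mem[OF assms] by (auto simp: closedin_def)
qed

lemma zero_dim_separates:
  assumes zero_dim "x \<in> K" "y \<in> K" "x \<noteq> y"
  shows "\<exists>W. openin T W \<and> closedin T W \<and> x \<in> W \<and> y \<notin> W"
proof -
  have *: "\<exists>p q. jump p q \<and> p \<sqsubset> y \<and> \<not> p \<sqsubset> x \<and> x \<sqsubset> q \<and> \<not> y \<sqsubset> q" if xy: "x \<sqsubset> y" for x y
  proof -
    obtain p q where pq: "jump p q" "\<not> p \<sqsubset> x" "\<not> y \<sqsubset> q" using assms(1) xy unfolding zero_dim_def by blast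
    have "p \<sqsubset> q" using pq(1) by (simp add: jump_def)
    then have "p \<sqsubset> y" "x \<sqsubset> q"
      using less_le_trans[of p q y] le_less_trans[of p q x] pq less_mem[OF xy] by blast+
    then show ?thesis using pq by blast
  qed
  consider "x \<sqsubset> y" | "y \<sqsubset> x" using less_linear assms(2-4) by blast
  then show ?thesis
  proof cases
    case 1
    then obtain p q where pq: "jump p q" "x \<sqsubset> q" "\<not> y \<sqsubset> q" using * by blast
    then show ?thesis
      using clopen_cut(2)[OF pq(1)] assms(2) by (intro exI[of _ "{y \<in> K. y \<sqsubset> q}"]) auto
  next
    case 2
    then obtain p q where pq: "jump p q" "p \<sqsubset> x" "\<not> p \<sqsubset> y" using * by blast
    then show ?thesis
      using clopen_cut(1)[OF pq(1)] assms(2) by (intro exI[of _ "{y \<in> K. p \<sqsubset> y}"]) auto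
  qed
qed

text \<open>
  Jumps on either side of the point cut a clopen interval out of the neighbourhood. The two sides
  are treated separately, since the point may be an end point of the line.
\<close>

lemma zero_dim_clopen_base:
  assumes zero_dim "openin T U" "x \<in> U"
  shows "\<exists>W. openin T W \<and> closedin T W \<and> x \<in> W \<and> W \<subseteq> U"
proof -
  have x: "x \<in> K" using openin_subset[OF assms(2)] assms(3) by auto
  have KK: "openin T K" "closedin T K" using openin_topspace[of T] closedin_topspace[of T] by simp_all
  have "\<exists>W. openin T W \<and> closedin T W \<and> x \<in> W \<and> (\<forall>y\<in>W. y \<sqsubset> x \<longrightarrow> y \<in> U)"
  proof -
    consider a where "a \<sqsubset> x" "\<And>y. a \<sqsubset> y \<Longrightarrow> y \<sqsubset> x \<Longrightarrow> y \<in> U" | "\<And>y. y \<sqsubset> x \<Longrightarrow> y \<in> U"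
      using openin_left[OF assms(2,3)] by blast
    then show ?thesis
    proof cases
      case 1
      obtain p q where pq: "jump p q" "\<not> p \<sqsubset> a" "\<not> x \<sqsubset> q" using assms(1) 1(1) unfolding zero_dim_def by blast
      have "p \<sqsubset> x" using less_le_trans[of p q x] pq x by (auto simp: jump_def)
      moreover have "a \<sqsubset> y" if "p \<sqsubset> y" for y using le_less_trans[OF that less_mem(1)[OF 1(1)] pq(2)] .
      ultimately show ?thesis using clopen_cut(1)[OF pq(1)] 1(2) x by (intro exI[of _ "{y \<in> K. p \<sqsubset> y}"]) auto
    qed (use KK x in blast)
  qed
  then obtain W1 where W1: "openin T W1" "closedin T W1" "x \<in> W1" "\<forall>y\<in>W1. y \<sqsubset> x \<longrightarrow> y \<in> U" by blast
  have "\<exists>W. openin T W \<and> closedin T W \<and> x \<in> W \<and> (\<forall>y\<in>W. x \<sqsubset> y \<longrightarrow> y \<in> U)"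
  proof -
    consider b where "x \<sqsubset> b" "\<And>y. x \<sqsubset> y \<Longrightarrow> y \<sqsubset> b \<Longrightarrow> y \<in> U" | "\<And>y. x \<sqsubset> y \<Longrightarrow> y \<in> U"
      using openin_right[OF assms(2,3)] by blast
    then show ?thesis
    proof cases
      case 1
      obtain p q where pq: "jump p q" "\<not> p \<sqsubset> x" "\<not> b \<sqsubset> q" using assms(1) 1(1) unfolding zero_dim_def by blast
      have "x \<sqsubset> q" using le_less_trans[of p q x] pq x by (auto simp: jump_def)
      moreover have "y \<sqsubset> b" if "y \<sqsubset> q" for y using less_le_trans[OF that less_mem(2)[OF 1(1)] pq(3)] .
      ultimately show ?thesis using clopen_cut(2)[OF pq(1)] 1(2) x by (intro exI[of _ "{y \<in> K. y \<sqsubset> q}"]) auto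
    qed (use KK x in blast)
  qed
  then obtain W2 where W2: "openin T W2" "closedin T W2" "x \<in> W2" "\<forall>y\<in>W2. x \<sqsubset> y \<longrightarrow> y \<in> U" by blast
  have "W1 \<inter> W2 \<subseteq> U"
  proof
    fix y assume y: "y \<in> W1 \<inter> W2"
    then have "y \<in> K" using openin_subset[OF W1(1)] by auto
    then show "y \<in> U" using less_linear[OF x] y W1(4) W2(4) assms(3) by blast
  qed
  then show ?thesis using W1 W2 by (intro exI[of _ "W1 \<inter> W2"]) auto
qed

lemma covering_dim_zero:
  assumes "compact_space T" zero_dim
  shows "covering_dim_le T 0"
  unfolding covering_dim_le_def
proof (intro conjI allI impI)
  fix \<U> assume \<U>: "finite \<U> \<and> (\<forall>U\<in>\<U>. openin T U) \<and> \<Union>\<U> = topspace T"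
  define \<C> where "\<C> = {W. openin T W \<and> closedin T W \<and> (\<exists>U\<in>\<U>. W \<subseteq> U)}"
  have "K \<subseteq> \<Union>\<C>"
  proof
    fix x assume "x \<in> K"
    then obtain U where U: "U \<in> \<U>" "x \<in> U" using \<U> by auto
    then show "x \<in> \<Union>\<C>" using zero_dim_clopen_base[OF assms(2) _ U(2)] \<U> by (auto simp: \<C>_def)
  qed
  moreover have "\<forall>W\<in>\<C>. openin T W" by (simp add: \<C>_def)
  ultimately have "\<exists>\<W>. finite \<W> \<and> \<W> \<subseteq> \<C> \<and> topspace T \<subseteq> \<Union>\<W>"
    using iffD1[OF compact_space_alt assms(1)] by simp
  then obtain \<W> where \<W>: "finite \<W>" "\<W> \<subseteq> \<C>" "K \<subseteq> \<Union>\<W>"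
    by auto
  then obtain \<V> where \<V>: "finite \<V>" "\<forall>V\<in>\<V>. openin T V" "\<Union>\<V> = \<Union>\<W>" "\<forall>V\<in>\<V>. \<exists>W\<in>\<W>. V \<subseteq> W" "disjoint \<V>"
    using clopen_refinement[of \<W> T] by (auto simp: \<C>_def subset_iff)
  have "\<Union>\<W> \<subseteq> K"
    using \<W>(2) openin_subset[of T] by (auto simp: \<C>_def)
  then have "\<Union>\<V> = topspace T" using \<W>(3) \<V>(3) by auto
  moreover have "\<forall>V\<in>\<V>. \<exists>U\<in>\<U>. V \<subseteq> U"
  proof
    fix V assume "V \<in> \<V>"
    then obtain W where "W \<in> \<W>" "V \<subseteq> W" using \<V>(4) by blast
    moreover from this(1) obtain U where "U \<in> \<U>" "W \<subseteq> U" using \<W>(2) by (auto simp: \<C>_def)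
    ultimately show "\<exists>U\<in>\<U>. V \<subseteq> U" by blast
  qed
  moreover have "int (card {V \<in> \<V>. x \<in> V}) \<le> 0 + 1" for x
  proof -
    have "V = V'" if "V \<in> \<V>" "V' \<in> \<V>" "x \<in> V" "x \<in> V'" for V V'
      using \<V>(5) that unfolding pairwise_def disjnt_iff by blast
    then have "card {V \<in> \<V>. x \<in> V} \<le> 1"
      using \<V>(1) by (simp add: card_le_Suc0_iff_eq)
    then show ?thesis by simp
  qed
  ultimately show "\<exists>\<V>. finite \<V> \<and> (\<forall>V\<in>\<V>. openin T V) \<and> \<Union>\<V> = topspace T \<and>
      (\<forall>V\<in>\<V>. \<exists>U\<in>\<U>. V \<subseteq> U) \<and> (\<forall>x\<in>topspace T. int (card {V \<in> \<V>. x \<in> V}) \<le> 0 + 1)"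
    using \<V>(1,2) by (intro exI[of _ \<V>]) simp
qed simp

text \<open>
  In a minimal cover by intervals no point lies in three of them: among three intervals around a
  point, one is covered by the one that reaches furthest to the left together with the one that
  reaches furthest to the right.
\<close>

lemma covering_dim_le_one:
  assumes "compact_space T"
  shows "covering_dim_le T 1"
  unfolding covering_dim_le_def
proof (intro conjI allI impI)
  fix \<U> assume \<U>: "finite \<U> \<and> (\<forall>U\<in>\<U>. openin T U) \<and> \<Union>\<U> = topspace T"
  define \<C> where "\<C> = {W. \<exists>P Q. finite P \<and> finite Q \<and> P \<subseteq> K \<and> Q \<subseteq> K \<and> W = between P Q \<and> (\<exists>U\<in>\<U>. W \<subseteq> U)}"
  have open\<C>: "openin T W" if "W \<in> \<C>" for W
    using that openin_between by (auto simp: \<C>_def)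
  have convex: "y \<in> W" if W: "W \<in> \<C>" "x \<in> W" "z \<in> W" and xyz: "x \<sqsubset> y" "y \<sqsubset> z" for W x y z
  proof -
    obtain P Q where "W = between P Q" using W(1) by (auto simp: \<C>_def)
    then show ?thesis
      using W(2,3) less_trans[OF _ xyz(1)] less_trans[OF xyz(2)] less_mem(1)[OF xyz(2)]
      by (auto simp: between_def)
  qed
  have "K \<subseteq> \<Union>\<C>"
  proof
    fix x assume "x \<in> K"
    then obtain U where U: "U \<in> \<U>" "x \<in> U" using \<U> by auto
    have "openin T U" using \<U> U(1) by blast
    then obtain P Q where "finite P" "finite Q" "P \<subseteq> K" "Q \<subseteq> K" "x \<in> between P Q" "between P Q \<subseteq> U"
      using openin_imp_between[OF _ U(2)] by blast
    then show "x \<in> \<Union>\<C>" using U(1) by (auto simp: \<C>_def)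
  qed
  define good where "good \<W> \<longleftrightarrow> finite \<W> \<and> \<W> \<subseteq> \<C> \<and> K \<subseteq> \<Union>\<W>" for \<W>
  have "\<exists>\<W>. good \<W>"
    using assms \<open>K \<subseteq> \<Union>\<C>\<close> open\<C> unfolding compact_space_alt good_def by simp
  then obtain \<W> where \<W>: "good \<W>" and min: "\<And>\<W>'. good \<W>' \<Longrightarrow> card \<W> \<le> card \<W>'"
    using ex_has_least_nat[of good _ card] by blast
  have fin: "finite \<W>" and sub: "\<W> \<subseteq> \<C>" and cov: "K \<subseteq> \<Union>\<W>" using \<W> by (auto simp: good_def)
  have "card {W \<in> \<W>. x \<in> W} \<le> 2" if x: "x \<in> K" for x
  proof (rule ccontr)
    let ?S = "{W \<in> \<W>. x \<in> W}"
    assume "\<not> card ?S \<le> 2"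
    then have S: "finite ?S" "2 < card ?S" using fin by simp_all
    then have ne: "?S \<noteq> {}" by (metis card.empty not_less_zero)
    define L where "L W = {y \<in> W. y \<sqsubset> x}" for W
    define R where "R W = {y \<in> W. x \<sqsubset> y}" for W
    have "L V \<subseteq> L W \<or> L W \<subseteq> L V" if V: "V \<in> ?S" and W: "W \<in> ?S" for V W
    proof (rule ccontr)
      assume "\<not> ?thesis"
      then obtain y z where yz: "y \<in> V" "y \<sqsubset> x" "y \<notin> W" "z \<in> W" "z \<sqsubset> x" "z \<notin> V" by (auto simp: L_def)
      then have "y = z"
        using less_linear[of y z] less_mem(1)[OF yz(2)] less_mem(1)[OF yz(5)] sub V W
          convex[of V y x z] convex[of W z x y] by blast
      then show False using yz by simp
    qed
    then obtain V where V: "V \<in> ?S" "\<And>W. W \<in> ?S \<Longrightarrow> L W \<subseteq> L V"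
      using finite_chain_has_max[OF S(1) ne, of L] by blast
    have "R V \<subseteq> R W \<or> R W \<subseteq> R V" if V: "V \<in> ?S" and W: "W \<in> ?S" for V W
    proof (rule ccontr)
      assume "\<not> ?thesis"
      then obtain y z where yz: "y \<in> V" "x \<sqsubset> y" "y \<notin> W" "z \<in> W" "x \<sqsubset> z" "z \<notin> V" by (auto simp: R_def)
      then have "y = z"
        using less_linear[of y z] less_mem(2)[OF yz(2)] less_mem(2)[OF yz(5)] sub V W
          convex[of V x y z] convex[of W x z y] by blast
      then show False using yz by simp
    qed
    then obtain V' where V': "V' \<in> ?S" "\<And>W. W \<in> ?S \<Longrightarrow> R W \<subseteq> R V'"
      using finite_chain_has_max[OF S(1) ne, of R] by blast
    have "card {V, V'} \<le> 2" by (simp add: card_insert_if)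
    then have "\<not> ?S \<subseteq> {V, V'}" using S(2) card_mono[of "{V, V'}" ?S] by auto
    then obtain W where W: "W \<in> ?S" "W \<noteq> V" "W \<noteq> V'" by blast
    have "W \<subseteq> V \<union> V'"
    proof
      fix y assume y: "y \<in> W"
      then have "y \<in> K" using openin_subset[OF open\<C>, of W] W(1) sub by auto
      then consider "y = x" | "y \<in> L W" | "y \<in> R W"
        using less_linear[OF x] y by (auto simp: L_def R_def)
      then show "y \<in> V \<union> V'"
        using V V' W(1) by cases (auto simp: L_def R_def)
    qed
    then have "\<Union>\<W> \<subseteq> \<Union>(\<W> - {W})"
      using V(1) V'(1) W by blast
    then have "good (\<W> - {W})"
      using fin sub cov by (auto simp: good_def)
    then have "card \<W> \<le> card (\<W> - {W})" by (rule min)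
    then show False using W(1) fin by (metis (no_types, lifting) card_Diff1_less mem_Collect_eq not_le)
  qed
  then have "\<forall>x\<in>topspace T. int (card {W \<in> \<W>. x \<in> W}) \<le> 1 + 1" by force
  moreover have "\<Union>\<W> = topspace T"
    using cov sub openin_subset[OF open\<C>] by fastforce
  moreover have "\<forall>V\<in>\<W>. \<exists>U\<in>\<U>. V \<subseteq> U" using sub by (auto simp: \<C>_def)
  ultimately show "\<exists>\<V>. finite \<V> \<and> (\<forall>V\<in>\<V>. openin T V) \<and> \<Union>\<V> = topspace T \<and>
      (\<forall>V\<in>\<V>. \<exists>U\<in>\<U>. V \<subseteq> U) \<and> (\<forall>x\<in>topspace T. int (card {V \<in> \<V>. x \<in> V}) \<le> 1 + 1)"
    using fin sub open\<C> by (intro exI[of _ \<W>]) auto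
qed simp

end

context line_map
begin

text \<open>An interval of values without split points is the image of an arc in the line.\<close>

lemma continuous_lo:
  assumes sub: "{a..b} \<subseteq> \<theta> ` K" "{a..b} \<inter> doubles = {}"
  shows "continuous_map (top_of_set {a..b}) T lo"
  unfolding continuous_map_def
proof (intro conjI allI impI)
  show "lo \<in> topspace (top_of_set {a..b}) \<rightarrow> topspace T" using lo(1) sub(1) by auto
  fix U assume U: "openin T U"
  show "openin (top_of_set {a..b}) {t \<in> topspace (top_of_set {a..b}). lo t \<in> U}"
    unfolding openin_euclidean_subtopology_iff
  proof (intro conjI ballI)
    fix t assume "t \<in> {t \<in> topspace (top_of_set {a..b}). lo t \<in> U}"
    then have t: "t \<in> {a..b}" "lo t \<in> U" by auto
    have tK: "t \<in> \<theta> ` K" using t sub by blast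
    have hi_lo: "hi t = lo t" using lo_eq_hi_iff[OF tK] t(1) sub(2) by force
    have lt: "lo s \<sqsubset> lo s'" if "s < s'" "s \<in> {a..b}" "s' \<in> {a..b}" for s s'
    proof -
      have "s \<in> \<theta> ` K" "s' \<in> \<theta> ` K" using sub(1) that by blast+
      then show ?thesis using lo(1,2) that(1) by (intro mono_strict) auto
    qed
    have "\<exists>d>0. \<forall>s\<in>{a..b}. t - d < s \<and> s < t \<longrightarrow> lo s \<in> U"
    proof -
      consider x where "x \<sqsubset> lo t" "\<And>y. x \<sqsubset> y \<Longrightarrow> y \<sqsubset> lo t \<Longrightarrow> y \<in> U" | "\<And>y. y \<sqsubset> lo t \<Longrightarrow> y \<in> U"
        using openin_left[OF U t(2)] by blast
      then show ?thesis
      proof cases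
        case 1
        have "lo s \<in> U" if "s \<in> {a..b}" "\<theta> x < s" "s < t" for s
        proof (rule 1(2))
          have "s \<in> \<theta> ` K" using sub(1) that by blast
          then show "x \<sqsubset> lo s" using lo(1,2) that less_mem(1)[OF 1(1)] by (intro mono_strict) auto
          show "lo s \<sqsubset> lo t" using lt[of s t] t(1) that by simp
        qed
        then show ?thesis using lo(3)[OF tK 1(1)] by (intro exI[of _ "t - \<theta> x"]) auto
      next
        case 2
        then show ?thesis using lt t(1) by (intro exI[of _ 1]) auto
      qed
    qed
    then obtain d1 where d1: "0 < d1" "\<And>s. s \<in> {a..b} \<Longrightarrow> t - d1 < s \<Longrightarrow> s < t \<Longrightarrow> lo s \<in> U" by blast
    have "\<exists>d>0. \<forall>s\<in>{a..b}. t < s \<and> s < t + d \<longrightarrow> lo s \<in> U"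
    proof -
      consider x where "lo t \<sqsubset> x" "\<And>y. lo t \<sqsubset> y \<Longrightarrow> y \<sqsubset> x \<Longrightarrow> y \<in> U" | "\<And>y. lo t \<sqsubset> y \<Longrightarrow> y \<in> U"
        using openin_right[OF U t(2)] by blast
      then show ?thesis
      proof cases
        case 1
        have "lo s \<in> U" if "s \<in> {a..b}" "t < s" "s < \<theta> x" for s
        proof (rule 1(2))
          have "s \<in> \<theta> ` K" using sub(1) that by blast
          then show "lo s \<sqsubset> x" using lo(1,2) that less_mem(2)[OF 1(1)] by (intro mono_strict) auto
          show "lo t \<sqsubset> lo s" using lt[of t s] t(1) that by simp
        qed
        then show ?thesis
          using hi(3)[OF tK, of x] 1(1) hi_lo by (intro exI[of _ "\<theta> x - t"]) auto
      next
        case 2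
        then show ?thesis using lt t(1) by (intro exI[of _ 1]) auto
      qed
    qed
    then obtain d2 where d2: "0 < d2" "\<And>s. s \<in> {a..b} \<Longrightarrow> t < s \<Longrightarrow> s < t + d2 \<Longrightarrow> lo s \<in> U" by blast
    have "lo s \<in> U" if s: "s \<in> {a..b}" "\<bar>s - t\<bar> < min d1 d2" for s
    proof -
      consider "s = t" | "t - d1 < s" "s < t" | "t < s" "s < t + d2"
        using s(2) by linarith
      then show ?thesis using d1(2) d2(2) t(2) s(1) by cases auto
    qed
    then show "\<exists>e>0. \<forall>s\<in>{a..b}. dist s t < e \<longrightarrow> s \<in> {t \<in> topspace (top_of_set {a..b}). lo t \<in> U}"
      using d1(1) d2(1) by (intro exI[of _ "min d1 d2"]) (auto simp: dist_real_def)
  qed auto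
qed

lemma covering_dim_not_zero:
  assumes "a < b" "{a..b} \<subseteq> \<theta> ` K" "{a..b} \<inter> doubles = {}"
  shows "\<not> covering_dim_le T 0"
proof (rule covering_dim_connected)
  show "connectedin T (lo ` {a..b})"
    using assms by (intro connectedin_continuous_map_image[OF continuous_lo]) (auto simp: connectedin_subtopology)
  show "lo a \<in> lo ` {a..b}" "lo b \<in> lo ` {a..b}" using assms(1) by auto
  have ab: "a \<in> \<theta> ` K" "b \<in> \<theta> ` K" using assms by auto
  show "lo a \<noteq> lo b" using lo(2)[OF ab(1)] lo(2)[OF ab(2)] assms(1) by auto
  show "closedin T {lo a}" "closedin T {lo b}"
    using closedin_singleton lo(1) ab by auto
qed

end

section \<open>Linear homeomorphisms\<close>

text \<open>Elements of \<open>Cp X\<close> are \<open>undefined\<close> outside the space, elements of \<open>cont_functions X\<close> vanish there.\<close>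

definition zero_extend :: "'a set \<Rightarrow> ('a \<Rightarrow> real) \<Rightarrow> 'a \<Rightarrow> real" where
  "zero_extend S f = (\<lambda>x. if x \<in> S then f x else 0)"

lemma Cp_memI:
  assumes "continuous_map X euclideanreal f"
  shows "restrict f (topspace X) \<in> topspace (Cp X)"
proof -
  have "continuous_map X euclideanreal (restrict f (topspace X))"
    by (rule continuous_map_eq[OF assms]) simp
  then show ?thesis by (simp add: topspace_Cp)
qed

lemma Cp_cont: "f \<in> topspace (Cp X) \<Longrightarrow> continuous_map X euclideanreal f"
  by (simp add: topspace_Cp)

lemma Cp_eqI:
  assumes "f \<in> topspace (Cp X)" "g \<in> topspace (Cp X)" "\<And>x. x \<in> topspace X \<Longrightarrow> f x = g x"
  shows "f = g"
  using assms by (auto simp: topspace_Cp intro: extensionalityI)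

lemma zero_extend_cont_functions:
  assumes "f \<in> topspace (Cp X)"
  shows "zero_extend (topspace X) f \<in> cont_functions X"
proof -
  have "continuous_map X euclideanreal (zero_extend (topspace X) f)"
    by (rule continuous_map_eq[OF Cp_cont[OF assms]]) (simp add: zero_extend_def)
  then show ?thesis by (simp add: cont_functions_def zero_extend_def)
qed

lemma continuous_map_evaluation:
  assumes "x \<in> topspace X"
  shows "continuous_map (Cp X) euclideanreal (\<lambda>f. f x)"
  unfolding Cp_def using assms
  by (intro continuous_map_from_subtopology continuous_map_product_projection[of x _ "\<lambda>_. euclideanreal", simplified])

lemma continuous_map_fin_functional:
  assumes "fin_functional (cont_functions X) \<phi>"
  shows "continuous_map (Cp X) euclideanreal (\<lambda>f. \<phi> (zero_extend (topspace X) f))"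
proof -
  obtain P c where P: "finite P" "\<forall>f\<in>cont_functions X. \<phi> f = (\<Sum>x\<in>P. c x * f x)"
    using assms unfolding fin_functional_def by blast
  have "continuous_map (Cp X) euclideanreal (\<lambda>f. zero_extend (topspace X) f x)" for x
    by (cases "x \<in> topspace X") (simp_all add: zero_extend_def continuous_map_evaluation)
  then have "continuous_map (Cp X) euclideanreal (\<lambda>f. \<Sum>x\<in>P. c x * zero_extend (topspace X) f x)"
    using P(1) by (intro continuous_intros) auto
  then show ?thesis
    by (rule continuous_map_eq) (simp add: P(2)[rule_format, OF zero_extend_cont_functions])
qed

lemma fin_functional_linear:
  assumes "fin_functional V \<phi>" "f \<in> V" "g \<in> V" "h \<in> V" "\<And>x. h x = a * f x + b * g x"
  shows "\<phi> h = a * \<phi> f + b * \<phi> g"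
proof -
  obtain P c where P: "\<forall>f\<in>V. \<phi> f = (\<Sum>x\<in>P. c x * f x)"
    using assms(1) unfolding fin_functional_def by blast
  then show ?thesis
    using assms(2-5) by (simp add: sum_distrib_left sum.distrib[symmetric] algebra_simps)
qed

text \<open>
  Finite combinations of evaluations are linear, and they are continuous for pointwise
  convergence.
\<close>

theorem Cp_linearly_homeomorphic_fin_iso:
  assumes "cont_functions X \<simeq> cont_functions Y"
  shows "Cp_linearly_homeomorphic X Y"
proof -
  obtain T S where TS: "fin_operator (cont_functions X) (cont_functions Y) T"
    "fin_operator (cont_functions Y) (cont_functions X) S"
    "\<And>f. f \<in> cont_functions X \<Longrightarrow> S (T f) = f" "\<And>g. g \<in> cont_functions Y \<Longrightarrow> T (S g) = g"
    using fin_isoE[OF assms] by blast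
  have T: "T f \<in> cont_functions Y" "fin_functional (cont_functions X) (\<lambda>f. T f y)" if "f \<in> cont_functions X" for f y
    using TS(1) that by (auto simp: fin_operator_def)
  have S: "S g \<in> cont_functions X" "fin_functional (cont_functions Y) (\<lambda>g. S g x)" if "g \<in> cont_functions Y" for g x
    using TS(2) that by (auto simp: fin_operator_def)
  have zr_X: "zero_extend (topspace X) (restrict f (topspace X)) = f" if "f \<in> cont_functions X" for f
    using that by (auto simp: zero_extend_def cont_functions_def fun_eq_iff)
  have zr_Y: "zero_extend (topspace Y) (restrict g (topspace Y)) = g" if "g \<in> cont_functions Y" for g
    using that by (auto simp: zero_extend_def cont_functions_def fun_eq_iff)
  define T' where "T' f = restrict (T (zero_extend (topspace X) f)) (topspace Y)" for f
  define S' where "S' g = restrict (S (zero_extend (topspace Y) g)) (topspace X)" for g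
  have T'_mem: "T' f \<in> topspace (Cp Y)" if "f \<in> topspace (Cp X)" for f
    unfolding T'_def using T(1)[OF zero_extend_cont_functions[OF that]]
    by (intro Cp_memI) (simp add: cont_functions_def)
  have S'_mem: "S' g \<in> topspace (Cp X)" if "g \<in> topspace (Cp Y)" for g
    unfolding S'_def using S(1)[OF zero_extend_cont_functions[OF that]]
    by (intro Cp_memI) (simp add: cont_functions_def)
  have "continuous_map (Cp X) (Cp Y) T'"
  proof -
    have "continuous_map (Cp X) euclideanreal (\<lambda>f. T' f y)" if "y \<in> topspace Y" for y
      unfolding T'_def using that continuous_map_fin_functional[of X "\<lambda>f. T f y"] TS(1)
      by (simp add: fin_operator_def)
    then have "continuous_map (Cp X) (product_topology (\<lambda>_. euclideanreal) (topspace Y)) T'"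
      unfolding continuous_map_componentwise by (auto simp: T'_def)
    then show ?thesis
      using T'_mem unfolding Cp_def[of Y] by (intro continuous_map_into_subtopology) (auto simp: topspace_Cp)
  qed
  moreover have "continuous_map (Cp Y) (Cp X) S'"
  proof -
    have "continuous_map (Cp Y) euclideanreal (\<lambda>f. S' f y)" if "y \<in> topspace X" for y
      unfolding S'_def using that continuous_map_fin_functional[of Y "\<lambda>f. S f y"] TS(2)
      by (simp add: fin_operator_def)
    then have "continuous_map (Cp Y) (product_topology (\<lambda>_. euclideanreal) (topspace X)) S'"
      unfolding continuous_map_componentwise by (auto simp: S'_def)
    then show ?thesis
      using S'_mem unfolding Cp_def[of X] by (intro continuous_map_into_subtopology) (auto simp: topspace_Cp)
  qed
  moreover have "S' (T' f) = f" if f: "f \<in> topspace (Cp X)" for f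
  proof (rule Cp_eqI[OF S'_mem[OF T'_mem[OF f]] f])
    fix x assume "x \<in> topspace X"
    then show "S' (T' f) x = f x"
      using zero_extend_cont_functions[OF f] T(1) TS(3)
      by (simp add: S'_def T'_def zr_Y) (simp add: zero_extend_def)
  qed
  moreover have "T' (S' g) = g" if g: "g \<in> topspace (Cp Y)" for g
  proof (rule Cp_eqI[OF T'_mem[OF S'_mem[OF g]] g])
    fix y assume "y \<in> topspace Y"
    then show "T' (S' g) y = g y"
      using zero_extend_cont_functions[OF g] S(1) TS(4)
      by (simp add: S'_def T'_def zr_X) (simp add: zero_extend_def)
  qed
  ultimately have "homeomorphic_map (Cp X) (Cp Y) T'"
    unfolding homeomorphic_map_maps homeomorphic_maps_def by blast
  moreover have lin: "T' (\<lambda>x\<in>topspace X. a * f x + b * g x) = (\<lambda>y\<in>topspace Y. a * T' f y + b * T' g y)"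
    if f: "f \<in> topspace (Cp X)" and g: "g \<in> topspace (Cp X)" for f g a b
  proof -
    have "(\<lambda>x\<in>topspace X. a * f x + b * g x) \<in> topspace (Cp X)"
      using Cp_cont[OF f] Cp_cont[OF g] by (intro Cp_memI continuous_intros)
    then have "T (zero_extend (topspace X) (\<lambda>x\<in>topspace X. a * f x + b * g x)) y =
        a * T (zero_extend (topspace X) f) y + b * T (zero_extend (topspace X) g) y" for y
      using f g TS(1)
      by (intro fin_functional_linear[where V="cont_functions X" and \<phi>="\<lambda>f. T f y"] zero_extend_cont_functions)
         (auto simp: fin_operator_def zero_extend_def)
    then show ?thesis by (auto simp: T'_def)
  qed
  ultimately have "linear_homeomorphism X Y T'"
    unfolding linear_homeomorphism_def using lin[of _ _ 1 1] lin[of f f c 0 for f c] by simp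
  then show ?thesis by (auto simp: Cp_linearly_homeomorphic_def)
qed

lemma linear_homeomorphism_mem:
  assumes "linear_homeomorphism X Y T" "f \<in> topspace (Cp X)"
  shows "T f \<in> topspace (Cp Y)"
  using assms homeomorphic_imp_surjective_map unfolding linear_homeomorphism_def by blast

lemma linear_homeomorphism_linear:
  assumes T: "linear_homeomorphism X Y T" and f: "f \<in> topspace (Cp X)" and g: "g \<in> topspace (Cp X)"
  shows "T (\<lambda>x\<in>topspace X. a * f x + b * g x) = (\<lambda>y\<in>topspace Y. a * T f y + b * T g y)"
proof -
  have sc: "(\<lambda>x\<in>topspace X. a * f x) \<in> topspace (Cp X)"
    if "f \<in> topspace (Cp X)" for a f
    using Cp_cont[OF that] by (intro Cp_memI continuous_intros)
  have "T (\<lambda>x\<in>topspace X. (\<lambda>x\<in>topspace X. a * f x) x + (\<lambda>x\<in>topspace X. b * g x) x) =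
      (\<lambda>y\<in>topspace Y. T (\<lambda>x\<in>topspace X. a * f x) y + T (\<lambda>x\<in>topspace X. b * g x) y)"
    using T sc[OF f] sc[OF g] unfolding linear_homeomorphism_def by blast
  moreover have eq: "T (\<lambda>x\<in>topspace X. a * f x) = (\<lambda>y\<in>topspace Y. a * T f y)"
    "T (\<lambda>x\<in>topspace X. b * g x) = (\<lambda>y\<in>topspace Y. b * T g y)"
    using T f g unfolding linear_homeomorphism_def by blast+
  moreover have "(\<lambda>x\<in>topspace X. (\<lambda>x\<in>topspace X. a * f x) x + (\<lambda>x\<in>topspace X. b * g x) x) =
      (\<lambda>x\<in>topspace X. a * f x + b * g x)"
    by (rule restrict_ext) simp
  ultimately have "T (\<lambda>x\<in>topspace X. a * f x + b * g x) =
      (\<lambda>y\<in>topspace Y. (\<lambda>y\<in>topspace Y. a * T f y) y + (\<lambda>y\<in>topspace Y. b * T g y) y)"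
    by (simp only:)
  also have "\<dots> = (\<lambda>y\<in>topspace Y. a * T f y + b * T g y)"
    by (rule restrict_ext) simp
  finally show ?thesis .
qed

lemma linear_homeomorphism_inverse:
  assumes T: "linear_homeomorphism X Y T"
  obtains S where "linear_homeomorphism Y X S" "\<And>f. f \<in> topspace (Cp X) \<Longrightarrow> S (T f) = f"
proof -
  obtain S where S: "homeomorphic_maps (Cp X) (Cp Y) T S"
    using T unfolding linear_homeomorphism_def homeomorphic_map_maps by blast
  have ST: "S (T f) = f" if "f \<in> topspace (Cp X)" for f
    using S that by (auto simp: homeomorphic_maps_def)
  have TS: "T (S g) = g" if "g \<in> topspace (Cp Y)" for g
    using S that by (auto simp: homeomorphic_maps_def)
  have hS: "homeomorphic_map (Cp Y) (Cp X) S"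
    using S homeomorphic_maps_sym homeomorphic_map_maps by blast
  have mem: "S g \<in> topspace (Cp X)" if "g \<in> topspace (Cp Y)" for g
    using homeomorphic_imp_surjective_map[OF hS] that by blast
  have lin: "S (\<lambda>y\<in>topspace Y. a * f y + b * g y) = (\<lambda>x\<in>topspace X. a * S f x + b * S g x)"
    if f: "f \<in> topspace (Cp Y)" and g: "g \<in> topspace (Cp Y)" for f g a b
  proof -
    have "(\<lambda>x\<in>topspace X. a * S f x + b * S g x) \<in> topspace (Cp X)"
      using Cp_cont[OF mem[OF f]] Cp_cont[OF mem[OF g]] by (intro Cp_memI continuous_intros)
    moreover have "T (\<lambda>x\<in>topspace X. a * S f x + b * S g x) = (\<lambda>y\<in>topspace Y. a * f y + b * g y)"
      using linear_homeomorphism_linear[OF T mem[OF f] mem[OF g]] TS[OF f] TS[OF g] by simp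
    ultimately show ?thesis using ST by metis
  qed
  have "linear_homeomorphism Y X S"
    unfolding linear_homeomorphism_def using hS lin[of _ _ 1 1] lin[of f f c 0 for f c] by simp
  then show thesis using that ST by blast
qed

lemma Cp_linearly_homeomorphic_sym:
  "Cp_linearly_homeomorphic X Y \<Longrightarrow> Cp_linearly_homeomorphic Y X"
  unfolding Cp_linearly_homeomorphic_def by (metis linear_homeomorphism_inverse)

section \<open>Arcs obstruct zero-dimensionality\<close>

text \<open>A neighbourhood of \<open>0\<close> restricts only finitely many coordinates, so by homogeneity each
  value of the image depends on finitely many values of the argument.\<close>

lemma linear_homeomorphism_local:
  assumes T: "linear_homeomorphism X Y T" and y: "y \<in> topspace Y"
  obtains P where "finite P" "P \<subseteq> topspace X"
    "\<And>f. f \<in> topspace (Cp X) \<Longrightarrow> \<forall>x\<in>P. f x = 0 \<Longrightarrow> T f y = 0"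
proof -
  define z where "z = (\<lambda>x\<in>topspace X. 0 :: real)"
  have z: "z \<in> topspace (Cp X)" unfolding z_def by (intro Cp_memI) simp
  have "T z y = 0"
    using linear_homeomorphism_linear[OF T z z, of 0 0] y by (simp add: z_def)
  have "continuous_map (Cp X) (Cp Y) T"
    using T homeomorphic_imp_continuous_map unfolding linear_homeomorphism_def by blast
  then have "continuous_map (Cp X) euclideanreal ((\<lambda>g. g y) \<circ> T)"
    using continuous_map_evaluation[OF y] by (rule continuous_map_compose)
  from openin_continuous_map_preimage[OF this, of "{-1<..<1}"]
  have "openin (Cp X) {f \<in> topspace (Cp X). T f y \<in> {-1<..<1}}" by simp
  moreover define A where "A = {f \<in> topspace (Cp X). T f y \<in> {-1<..<1}}"
  ultimately have "openin (Cp X) A" by simp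
  then obtain V where V: "openin (product_topology (\<lambda>_. euclideanreal) (topspace X)) V"
    "A = V \<inter> {f. continuous_map X euclideanreal f}"
    unfolding Cp_def openin_subtopology by blast
  have "z \<in> A" using z \<open>T z y = 0\<close> by (simp add: A_def)
  then have "z \<in> V" using V(2) by blast
  then obtain U where U: "finite {x \<in> topspace X. U x \<noteq> topspace euclideanreal}" "z \<in> PiE (topspace X) U"
    "PiE (topspace X) U \<subseteq> V"
    using V(1) unfolding openin_product_topology_alt by blast
  define P where "P = {x \<in> topspace X. U x \<noteq> UNIV}"
  show thesis
  proof (rule that[of P])
    show "finite P" "P \<subseteq> topspace X" using U(1) by (auto simp: P_def)
    fix f assume f: "f \<in> topspace (Cp X)" "\<forall>x\<in>P. f x = 0"
    have small: "\<bar>c * T f y\<bar> < 1" for c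
    proof -
      define g where "g = (\<lambda>x\<in>topspace X. c * f x + 0 * f x)"
      have g: "g \<in> topspace (Cp X)"
        unfolding g_def using Cp_cont[OF f(1)] by (intro Cp_memI continuous_intros)
      have "g x \<in> U x" if "x \<in> topspace X" for x
      proof (cases "x \<in> P")
        case True
        then have "g x = z x" using f(2) that by (simp add: g_def z_def)
        then show ?thesis using U(2) that by (auto simp: PiE_iff)
      next
        case False
        then show ?thesis using that by (simp add: P_def)
      qed
      then have "g \<in> PiE (topspace X) U" by (auto simp: g_def)
      then have "g \<in> A"
        using U(3) V(2) Cp_cont[OF g] by blast
      then have "T g y \<in> {-1<..<1}" by (simp add: A_def)
      moreover have "T g y = c * T f y"
        unfolding g_def linear_homeomorphism_linear[OF T f(1) f(1)] using y by simp
      ultimately show ?thesis by (simp add: abs_less_iff)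
    qed
    show "T f y = 0"
    proof (rule ccontr)
      assume "T f y \<noteq> 0"
      then show False using small[of "1 / T f y"] by simp
    qed
  qed
qed

locale totally_separated =
  fixes Y :: "'b topology"
  assumes separated: "y \<in> topspace Y \<Longrightarrow> y' \<in> topspace Y \<Longrightarrow> y \<noteq> y' \<Longrightarrow>
    \<exists>W. openin Y W \<and> closedin Y W \<and> y \<in> W \<and> y' \<notin> W"
begin

definition clopen :: "'b set \<Rightarrow> bool" where "clopen W \<longleftrightarrow> openin Y W \<and> closedin Y W"

lemma separated_finite:
  assumes "finite Q" "Q \<subseteq> topspace Y" "y \<in> topspace Y" "y \<notin> Q"
  shows "\<exists>W. clopen W \<and> y \<in> W \<and> W \<inter> Q = {}"
  using assms
proof (induction rule: finite_induct)
  case empty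
  then show ?case by (intro exI[of _ "topspace Y"]) (auto simp: clopen_def)
next
  case (insert x Q)
  then obtain W where "clopen W" "y \<in> W" "W \<inter> Q = {}" by auto
  moreover obtain W' where "clopen W'" "y \<in> W'" "x \<notin> W'"
    using separated[of y x] insert.prems by (auto simp: clopen_def)
  ultimately show ?case by (intro exI[of _ "W \<inter> W'"]) (auto simp: clopen_def)
qed

lemma disjoint_neighbourhoods:
  assumes "finite P" "P \<subseteq> topspace Y"
  obtains W where "\<And>y. y \<in> P \<Longrightarrow> clopen (W y) \<and> y \<in> W y"
    "\<And>y y'. y \<in> P \<Longrightarrow> y' \<in> P \<Longrightarrow> y \<noteq> y' \<Longrightarrow> W y \<inter> W y' = {}"
proof -
  have "\<exists>W. clopen W \<and> y \<in> W \<and> W \<inter> (P - {y}) = {}" if "y \<in> P" for y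
    using assms that by (intro separated_finite) auto
  then obtain W where W: "\<And>y. y \<in> P \<Longrightarrow> clopen (W y) \<and> y \<in> W y \<and> W y \<inter> (P - {y}) = {}" by metis
  have "clopen (W y - (\<Union>z\<in>P - {y}. W z))" if "y \<in> P" for y
  proof -
    have "openin Y (\<Union>z\<in>P - {y}. W z)" using W by (intro openin_Union) (auto simp: clopen_def)
    moreover have "closedin Y (\<Union>z\<in>P - {y}. W z)" using W assms(1) by (intro closedin_Union) (auto simp: clopen_def)
    ultimately show ?thesis using W[OF that] by (auto simp: clopen_def openin_diff closedin_diff)
  qed
  then show thesis
    using W by (intro that[of "\<lambda>y. W y - (\<Union>z\<in>P - {y}. W z)"]) blast+
qed

definition ind :: "'b set \<Rightarrow> 'b \<Rightarrow> real" where "ind W = (\<lambda>y\<in>topspace Y. if y \<in> W then 1 else 0)"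

lemma ind_Cp:
  assumes "clopen W"
  shows "ind W \<in> topspace (Cp Y)"
  unfolding ind_def
proof (rule Cp_memI)
  show "continuous_map Y euclideanreal (\<lambda>y. if y \<in> W then 1 else 0)"
    unfolding continuous_map_real_iff
  proof (intro ballI allI impI)
    fix y and \<epsilon> :: real assume y: "y \<in> topspace Y" and \<epsilon>: "0 < \<epsilon>"
    show "\<exists>V. openin Y V \<and> y \<in> V \<and> (\<forall>z\<in>V. \<bar>(if z \<in> W then 1 else 0) - (if y \<in> W then 1 else 0)\<bar> < \<epsilon>)"
    proof (cases "y \<in> W")
      case True
      then show ?thesis using assms \<epsilon> by (intro exI[of _ W]) (auto simp: clopen_def)
    next
      case False
      then show ?thesis using assms \<epsilon> y by (intro exI[of _ "topspace Y - W"]) (auto simp: clopen_def)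
    qed
  qed
qed

lemma linear_sum:
  assumes S: "linear_homeomorphism Y X S" and x: "x \<in> topspace X"
    and "finite Q" "\<And>q. q \<in> Q \<Longrightarrow> e q \<in> topspace (Cp Y)"
  shows "S (\<lambda>y\<in>topspace Y. \<Sum>q\<in>Q. a q * e q y) x = (\<Sum>q\<in>Q. a q * S (e q) x) \<and>
    (\<lambda>y\<in>topspace Y. \<Sum>q\<in>Q. a q * e q y) \<in> topspace (Cp Y)"
  using assms(3,4)
proof (induction rule: finite_induct)
  case empty
  have z: "(\<lambda>y\<in>topspace Y. 0) \<in> topspace (Cp Y)" by (intro Cp_memI) simp
  have "S (\<lambda>y\<in>topspace Y. 0) x = 0"
    using linear_homeomorphism_linear[OF S z z, of 0 0] x by simp
  then show ?case using z by (simp only: sum.empty simp_thms)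
next
  case (insert q Q)
  define g where "g = (\<lambda>y\<in>topspace Y. \<Sum>q\<in>Q. a q * e q y)"
  have g: "S g x = (\<Sum>q\<in>Q. a q * S (e q) x)" "g \<in> topspace (Cp Y)"
    using insert.IH[OF insert.prems[OF insertI2]] unfolding g_def by blast+
  have eq: "(\<lambda>y\<in>topspace Y. \<Sum>q\<in>insert q Q. a q * e q y) = (\<lambda>y\<in>topspace Y. a q * e q y + 1 * g y)"
    using insert.hyps by (auto simp: g_def)
  have "(\<lambda>y\<in>topspace Y. a q * e q y + 1 * g y) \<in> topspace (Cp Y)"
    using insert.prems[of q] g(2) by (intro Cp_memI continuous_intros Cp_cont) auto
  then show ?case
    unfolding eq
  proof (rule conjI[rotated])
    show "S (\<lambda>y\<in>topspace Y. a q * e q y + 1 * g y) x = (\<Sum>q\<in>insert q Q. a q * S (e q) x)"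
      unfolding linear_homeomorphism_linear[OF S insert.prems[OF insertI1] g(2)]
      using insert.hyps g(1) x by simp
  qed
qed

text \<open>
  The value depends on finitely many points, which have disjoint clopen neighbourhoods. On these
  points a function agrees with a combination of the indicators of the neighbourhoods, so the
  coefficients can be read off from the images of the indicators.
\<close>

lemma functional_representation:
  assumes S: "linear_homeomorphism Y X S" and x: "x \<in> topspace X"
  shows "\<exists>P c. finite P \<and> P \<subseteq> topspace Y \<and> (\<forall>y\<in>P. c y \<noteq> 0) \<and>
    (\<forall>g\<in>topspace (Cp Y). S g x = (\<Sum>y\<in>P. c y * g y))"
proof -
  obtain Q where Q: "finite Q" "Q \<subseteq> topspace Y"
    "\<And>g. g \<in> topspace (Cp Y) \<Longrightarrow> \<forall>y\<in>Q. g y = 0 \<Longrightarrow> S g x = 0"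
    using linear_homeomorphism_local[OF S x] by blast
  obtain W where W: "\<And>y. y \<in> Q \<Longrightarrow> clopen (W y) \<and> y \<in> W y"
    "\<And>y y'. y \<in> Q \<Longrightarrow> y' \<in> Q \<Longrightarrow> y \<noteq> y' \<Longrightarrow> W y \<inter> W y' = {}"
    using disjoint_neighbourhoods[OF Q(1,2)] by blast
  have e: "ind (W q) \<in> topspace (Cp Y)" if "q \<in> Q" for q using W(1)[OF that] ind_Cp by blast
  have eval: "ind (W q) y = (if y = q then 1 else 0)" if "q \<in> Q" "y \<in> Q" for q y
    using W(1)[OF that(1)] W(1)[OF that(2)] W(2)[OF that] Q(2) that by (auto simp: ind_def)
  define c where "c y = S (ind (W y)) x" for y
  have rep: "S g x = (\<Sum>y\<in>Q. c y * g y)" if g: "g \<in> topspace (Cp Y)" for g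
  proof -
    define k where "k = (\<lambda>y\<in>topspace Y. \<Sum>q\<in>Q. g q * ind (W q) y)"
    have k: "S k x = (\<Sum>q\<in>Q. g q * c q)" "k \<in> topspace (Cp Y)"
      using linear_sum[OF S x Q(1), of "\<lambda>q. ind (W q)" g] e by (auto simp: k_def c_def)
    define d where "d = (\<lambda>y\<in>topspace Y. 1 * g y + (-1) * k y)"
    have d: "d \<in> topspace (Cp Y)"
      unfolding d_def using g k(2) by (intro Cp_memI continuous_intros Cp_cont)
    have "d y = 0" if y: "y \<in> Q" for y
    proof -
      have "k y = (\<Sum>q\<in>Q. g q * (if y = q then 1 else 0))"
        using Q(2) y eval by (auto simp: k_def intro!: sum.cong)
      also have "\<dots> = g y" using Q(1) y by (simp add: sum.delta if_distrib[of "\<lambda>t. _ * t"] cong: if_cong)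
      finally show ?thesis using Q(2) y by (auto simp: d_def)
    qed
    then have "S d x = 0" using Q(3)[OF d] by blast
    moreover have "S d x = S g x - S k x"
      unfolding d_def linear_homeomorphism_linear[OF S g k(2)] using x by simp
    ultimately show ?thesis using k(1) by (simp add: mult.commute)
  qed
  have "(\<Sum>y\<in>Q. c y * g y) = (\<Sum>y\<in>{y \<in> Q. c y \<noteq> 0}. c y * g y)" for g
    using Q(1) by (intro sum.mono_neutral_right) auto
  then show ?thesis
    using rep Q(1,2) by (intro exI[of _ "{y \<in> Q. c y \<noteq> 0}"] exI[of _ c]) auto
qed

text \<open>
  The evaluations along an arc become functionals with finite supports. By Baire's theorem the size of
  the supports is constant on some interval; there the supports vary continuously in a totally
  separated space, so they are constant. But infinitely many independent evaluations cannot be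
  supported by a fixed finite set.
\<close>

theorem no_arc:
  fixes X :: "'a topology" and h :: "real \<Rightarrow> 'a"
  assumes ab: "a < b" and h: "continuous_map (top_of_set {a..b}) X h"
    and \<psi>: "continuous_map X euclideanreal \<psi>"
    and \<psi>h: "\<And>s. s \<in> {a..b} \<Longrightarrow> \<psi> (h s) = s"
  shows "\<not> Cp_linearly_homeomorphic X Y"
proof
  assume "Cp_linearly_homeomorphic X Y"
  then obtain T where T: "linear_homeomorphism X Y T" by (auto simp: Cp_linearly_homeomorphic_def)
  obtain S where S: "linear_homeomorphism Y X S" "\<And>f. f \<in> topspace (Cp X) \<Longrightarrow> S (T f) = f"
    using linear_homeomorphism_inverse[OF T] by blast
  have hX: "h s \<in> topspace X" if "s \<in> {a..b}" for s
    using h that by (auto simp: continuous_map_def)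
  define rep where "rep s P c \<longleftrightarrow> finite P \<and> P \<subseteq> topspace Y \<and> (\<forall>y\<in>P. c y \<noteq> 0) \<and>
    (\<forall>g\<in>topspace (Cp Y). S g (h s) = (\<Sum>y\<in>P. c y * g y))" for s P and c :: "'b \<Rightarrow> real"
  have "\<exists>P c. rep s P c" if "s \<in> {a..b}" for s
    using functional_representation[OF S(1) hX[OF that]] by (simp add: rep_def)
  then obtain P c where rep: "\<And>s. s \<in> {a..b} \<Longrightarrow> rep s (P s) (c s)" by metis
  have P: "finite (P s)" "P s \<subseteq> topspace Y" if "s \<in> {a..b}" for s
    using rep[OF that] by (auto simp: rep_def)
  have S_rep: "S g (h s) = (\<Sum>y\<in>P s. c s y * g y)" if "s \<in> {a..b}" "g \<in> topspace (Cp Y)" for s g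
    using rep[OF that(1)] that(2) by (auto simp: rep_def)
  \<comment> \<open>Supports are lower semicontinuous: the indicator of a clopen set that contains exactly one
    point of \<open>P s\<close> has an image that does not vanish at \<open>h s\<close>, so it does not vanish nearby either.\<close>
  have lsc: "\<exists>d>0. \<forall>s'\<in>{a..b}. \<bar>s' - s\<bar> < d \<longrightarrow> P s' \<inter> W \<noteq> {}"
    if s: "s \<in> {a..b}" and W: "clopen W" "P s \<inter> W \<noteq> {}" for s W
  proof -
    obtain y where y: "y \<in> P s" "y \<in> W" using W(2) by blast
    have "\<exists>V. clopen V \<and> y \<in> V \<and> V \<inter> (P s - {y}) = {}"
      using P[OF s] y(1) by (intro separated_finite) auto
    then obtain V where V: "clopen V" "y \<in> V" "V \<inter> (P s - {y}) = {}" by blast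
    have VW: "clopen (V \<inter> W)" using V(1) W(1) by (auto simp: clopen_def)
    define m where "m s = S (ind (V \<inter> W)) (h s)" for s
    have "m s = (\<Sum>z\<in>P s. if z = y then c s y else 0)"
      unfolding m_def S_rep[OF s ind_Cp[OF VW]]
      using V y P(2)[OF s] by (intro sum.cong) (auto simp: ind_def)
    then have "m s = c s y" using P(1)[OF s] y(1) by simp
    then have ms: "m s \<noteq> 0" using rep[OF s] y(1) by (simp add: rep_def)
    have "continuous_map X euclideanreal (S (ind (V \<inter> W)))"
      using linear_homeomorphism_mem[OF S(1) ind_Cp[OF VW]] by (rule Cp_cont)
    then have "continuous_map (top_of_set {a..b}) euclideanreal (S (ind (V \<inter> W)) \<circ> h)"
      by (rule continuous_map_compose[OF h])
    then have "continuous_on {a..b} m"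
      by (simp add: m_def[abs_def] o_def)
    then obtain d where d: "d > 0" "\<And>s'. s' \<in> {a..b} \<Longrightarrow> \<bar>s' - s\<bar> < d \<Longrightarrow> \<bar>m s' - m s\<bar> < \<bar>m s\<bar>"
      using s ms unfolding continuous_on_iff dist_real_def by (metis zero_less_abs_iff)
    have "P s' \<inter> W \<noteq> {}" if s': "s' \<in> {a..b}" "\<bar>s' - s\<bar> < d" for s'
    proof
      assume "P s' \<inter> W = {}"
      then have "m s' = 0"
        unfolding m_def S_rep[OF s'(1) ind_Cp[OF VW]]
        using P(2)[OF s'(1)] by (intro sum.neutral) (auto simp: ind_def)
      then show False using d(2)[OF s'] by simp
    qed
    then show ?thesis using d(1) by blast
  qed
  have all: "\<exists>d>0. \<forall>s'\<in>{a..b}. \<bar>s' - s\<bar> < d \<longrightarrow> (\<forall>y\<in>P s. P s' \<inter> W y \<noteq> {})"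
    if s: "s \<in> {a..b}" and W: "\<And>y. y \<in> P s \<Longrightarrow> clopen (W y) \<and> y \<in> W y" for s W
  proof -
    have "\<exists>d>0. \<forall>s'\<in>{a..b}. \<bar>s' - s\<bar> < d \<longrightarrow> P s' \<inter> W y \<noteq> {}" if "y \<in> P s" for y
      using lsc[OF s, of "W y"] W[OF that] that by blast
    then obtain d where d: "\<And>y. y \<in> P s \<Longrightarrow> d y > 0 \<and> (\<forall>s'\<in>{a..b}. \<bar>s' - s\<bar> < d y \<longrightarrow> P s' \<inter> W y \<noteq> {})"
      by metis
    define e where "e = Min (insert 1 (d ` P s))"
    have "e > 0" "\<And>y. y \<in> P s \<Longrightarrow> e \<le> d y"
      using P(1)[OF s] d by (auto simp: e_def)
    then show ?thesis using d by (intro exI[of _ e]) (meson less_le_trans)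
  qed
  have card_lsc: "\<exists>d>0. \<forall>s'\<in>{a..b}. \<bar>s' - s\<bar> < d \<longrightarrow> card (P s) \<le> card (P s')"
    if s: "s \<in> {a..b}" for s
  proof -
    obtain W where W: "\<And>y. y \<in> P s \<Longrightarrow> clopen (W y) \<and> y \<in> W y"
      "\<And>y y'. y \<in> P s \<Longrightarrow> y' \<in> P s \<Longrightarrow> y \<noteq> y' \<Longrightarrow> W y \<inter> W y' = {}"
      using disjoint_neighbourhoods[OF P[OF s]] by blast
    obtain d where d: "d > 0" "\<And>s'. s' \<in> {a..b} \<Longrightarrow> \<bar>s' - s\<bar> < d \<Longrightarrow> \<forall>y\<in>P s. P s' \<inter> W y \<noteq> {}"
      using all[OF s, of W] W(1) by blast
    have "card (P s) \<le> card (P s')" if s': "s' \<in> {a..b}" "\<bar>s' - s\<bar> < d" for s'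
    proof -
      have "\<exists>z. z \<in> P s' \<inter> W y" if "y \<in> P s" for y using d(2)[OF s'] that by blast
      then obtain f where f: "\<And>y. y \<in> P s \<Longrightarrow> f y \<in> P s' \<inter> W y" by metis
      have "inj_on f (P s)" using f W(2) by (metis IntD2 IntI empty_iff inj_onI)
      then show ?thesis using f P(1)[OF s'(1)] by (intro card_inj_on_le[of f]) auto
    qed
    then show ?thesis using d(1) by blast
  qed
  have "\<exists>s0 e k. s0 \<in> {a..b} \<and> e > 0 \<and> (\<forall>s\<in>{a..b}. \<bar>s - s0\<bar> < e \<longrightarrow> card (P s) \<le> k)"
  proof (rule ccontr)
    assume no: "\<not> ?thesis"
    define G where "G k = {s \<in> {a..b}. k < card (P s)}" for k :: nat
    have "openin (top_of_set {a..b}) (G k) \<and> {a..b} \<subseteq> closure (G k)" for k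
    proof
      show "openin (top_of_set {a..b}) (G k)"
        unfolding openin_euclidean_subtopology_iff
      proof (intro conjI ballI)
        fix s assume s: "s \<in> G k"
        then obtain d where "d > 0" "\<forall>s'\<in>{a..b}. \<bar>s' - s\<bar> < d \<longrightarrow> card (P s) \<le> card (P s')"
          using card_lsc[of s] by (auto simp: G_def)
        then show "\<exists>e>0. \<forall>s'\<in>{a..b}. dist s' s < e \<longrightarrow> s' \<in> G k"
          using s by (intro exI[of _ d]) (force simp: G_def dist_real_def)
      qed (auto simp: G_def)
      show "{a..b} \<subseteq> closure (G k)"
      proof
        fix s assume s: "s \<in> {a..b}"
        show "s \<in> closure (G k)"
          unfolding closure_approachable
        proof (intro allI impI)
          fix e :: real assume "0 < e"
          then obtain s' where "s' \<in> {a..b}" "\<bar>s' - s\<bar> < e" "\<not> card (P s') \<le> k" using no s by blast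
          then show "\<exists>s'\<in>G k. dist s' s < e" by (intro bexI[of _ s']) (auto simp: G_def dist_real_def)
        qed
      qed
    qed
    then have "{a..b} \<subseteq> closure (\<Inter>(range G))"
      by (intro Baire) auto
    moreover have "\<Inter>(range G) = {}" by (auto simp: G_def)
    ultimately show False using ab by auto
  qed
  then obtain s0 e k where s0: "s0 \<in> {a..b}" "e > 0" "\<And>s. s \<in> {a..b} \<Longrightarrow> \<bar>s - s0\<bar> < e \<Longrightarrow> card (P s) \<le> k"
    by blast
  define I where "I = {s \<in> {a..b}. \<bar>s - s0\<bar> < e}"
  have "\<exists>s1\<in>I. \<forall>s\<in>I. card (P s) \<le> card (P s1)"
  proof -
    have "s0 \<in> I" using s0 by (auto simp: I_def)
    moreover have "\<forall>s. s \<in> I \<longrightarrow> card (P s) < Suc k" using s0(3) by (auto simp: I_def less_Suc_eq_le)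
    ultimately show ?thesis using ex_has_greatest_nat[of "\<lambda>s. s \<in> I" s0 "\<lambda>s. card (P s)" "Suc k"] by blast
  qed
  then obtain s1 where s1: "s1 \<in> I" "\<And>s. s \<in> I \<Longrightarrow> card (P s) \<le> card (P s1)" by blast
  have s1ab: "s1 \<in> {a..b}" using s1(1) by (simp add: I_def)
  obtain W where W: "\<And>y. y \<in> P s1 \<Longrightarrow> clopen (W y) \<and> y \<in> W y"
    "\<And>y y'. y \<in> P s1 \<Longrightarrow> y' \<in> P s1 \<Longrightarrow> y \<noteq> y' \<Longrightarrow> W y \<inter> W y' = {}"
    using disjoint_neighbourhoods[OF P[OF s1ab]] by blast
  obtain d where d: "d > 0" "\<And>s'. s' \<in> {a..b} \<Longrightarrow> \<bar>s' - s1\<bar> < d \<Longrightarrow> \<forall>y\<in>P s1. P s' \<inter> W y \<noteq> {}"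
    using all[OF s1ab, of W] W(1) by blast
  define l u where "l = max a (max (s0 - e) (s1 - d))" and "u = min b (min (s0 + e) (s1 + d))"
  have lu: "l < u" "l \<le> s1" "s1 \<le> u" using ab d(1) s1(1) by (auto simp: l_def u_def I_def)
  \<comment> \<open>An interval around \<open>s1\<close>, open in \<open>{a..b}\<close>.\<close>
  define N where "N = {s \<in> {a..b}. \<bar>s - s0\<bar> < e \<and> \<bar>s - s1\<bar> < d}"
  have N_sub: "N \<subseteq> {a..b}" and N_s1: "s1 \<in> N" using s1(1) d(1) by (auto simp: N_def I_def)
  have "is_interval N"
    unfolding is_interval_1 by (auto simp: N_def)
  then have "connected N" by (simp add: is_interval_connected)
  have one: "\<exists>z. P s \<inter> W y = {z}" and sub: "P s \<subseteq> (\<Union>y\<in>P s1. W y)" if s: "s \<in> N" and y: "y \<in> P s1" for s y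
  proof -
    have sab: "s \<in> {a..b}" using s N_sub by blast
    have meets: "P s \<inter> W y \<noteq> {}" if "y \<in> P s1" for y using d(2)[OF sab] s that by (auto simp: N_def)
    have cardle: "card (P s) \<le> card (P s1)" using s1(2) s by (auto simp: N_def I_def)
    have "\<exists>z. z \<in> P s \<inter> W y" if "y \<in> P s1" for y using meets[OF that] by blast
    then obtain f where f: "\<And>y. y \<in> P s1 \<Longrightarrow> f y \<in> P s \<inter> W y" by metis
    have inj: "inj_on f (P s1)" using f W(2) by (metis IntD2 IntI empty_iff inj_onI)
    have img: "f ` P s1 = P s"
    proof (rule card_seteq[OF P(1)[OF sab]])
      show "f ` P s1 \<subseteq> P s" using f by blast
      show "card (P s) \<le> card (f ` P s1)" using cardle card_image[OF inj] by simp
    qed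
    show "P s \<subseteq> (\<Union>y\<in>P s1. W y)"
    proof
      fix z assume "z \<in> P s"
      then obtain y' where "y' \<in> P s1" "z = f y'" unfolding img[symmetric] by (rule imageE)
      then show "z \<in> (\<Union>y\<in>P s1. W y)" using f[of y'] by auto
    qed
    have "P s \<inter> W y = {f y}"
    proof -
      have "z = f y" if z: "z \<in> P s" "z \<in> W y" for z
      proof -
        obtain y' where y': "y' \<in> P s1" "z = f y'" using z(1) unfolding img[symmetric] by (rule imageE)
        then have "z \<in> W y'" using f[OF y'(1)] by simp
        then have "y' = y" using W(2)[OF y'(1) y] z(2) by blast
        then show ?thesis using y'(2) by simp
      qed
      then show ?thesis using f[OF y] by blast
    qed
    then show "\<exists>z. P s \<inter> W y = {z}" by blast
  qed
  have const: "y \<in> P s" if s: "s \<in> N" and y: "y \<in> P s1" for s y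
  proof (rule ccontr)
    assume ny: "y \<notin> P s"
    obtain z where z: "P s \<inter> W y = {z}" using one[OF s y] by blast
    have yY: "y \<in> topspace Y" "z \<in> topspace Y" "y \<noteq> z"
      using y z ny P(2)[OF s1ab] P(2)[of s] s N_sub W(1)[OF y] by blast+
    then obtain V0 where V0: "clopen V0" "y \<in> V0" "z \<notin> V0" using separated by (auto simp: clopen_def)
    define V1 V2 where "V1 = V0 \<inter> W y" and "V2 = W y - V0"
    have V: "clopen V1" "clopen V2"
      using V0(1) W(1)[OF y] by (auto simp: V1_def V2_def clopen_def openin_diff closedin_diff)
    define O1 O2 where "O1 = {t \<in> N. P t \<inter> V1 \<noteq> {}}" and "O2 = {t \<in> N. P t \<inter> V2 \<noteq> {}}"
    have open': "openin (top_of_set N) {t \<in> N. P t \<inter> V \<noteq> {}}" if Vc: "clopen V" for V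
      unfolding openin_euclidean_subtopology_iff
    proof (intro conjI ballI)
      fix t assume t: "t \<in> {t \<in> N. P t \<inter> V \<noteq> {}}"
      then have "t \<in> {a..b}" "P t \<inter> V \<noteq> {}" using N_sub by auto
      then obtain d where "d > 0" "\<forall>s'\<in>{a..b}. \<bar>s' - t\<bar> < d \<longrightarrow> P s' \<inter> V \<noteq> {}"
        using lsc[OF _ Vc] by meson
      then show "\<exists>e>0. \<forall>s'\<in>N. dist s' t < e \<longrightarrow> s' \<in> {t \<in> N. P t \<inter> V \<noteq> {}}"
        using N_sub by (intro exI[of _ d]) (auto simp: dist_real_def)
    qed auto
    have "O1 \<union> O2 = N"
    proof -
      have "t \<in> O1 \<union> O2" if "t \<in> N" for t
        using one[OF that y] that by (auto simp: O1_def O2_def V1_def V2_def)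
      then show ?thesis by (auto simp: O1_def O2_def)
    qed
    moreover have "O1 \<inter> O2 = {}"
    proof -
      have False if t: "t \<in> O1" "t \<in> O2" for t
      proof -
        have "t \<in> N" using t by (simp add: O1_def)
        then obtain w where w: "P t \<inter> W y = {w}" using one[OF _ y] by blast
        moreover obtain w1 where "w1 \<in> P t" "w1 \<in> V0" "w1 \<in> W y" using t(1) by (auto simp: O1_def V1_def)
        moreover obtain w2 where "w2 \<in> P t" "w2 \<notin> V0" "w2 \<in> W y" using t(2) by (auto simp: O2_def V2_def)
        ultimately show False by (metis IntI singletonD)
      qed
      then show ?thesis by blast
    qed
    moreover have "openin (top_of_set N) O1" "openin (top_of_set N) O2"
      unfolding O1_def O2_def using open' V by blast+
    moreover have "s1 \<in> O1" "s \<in> O2"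
      using N_s1 y V0 W(1)[OF y] s z by (auto simp: O1_def O2_def V1_def V2_def)
    ultimately show False
      using \<open>connected N\<close> unfolding connected_openin by (metis empty_iff order_refl)
  qed
  have P_const: "P s = P s1" if s: "s \<in> N" for s
  proof -
    have "P s1 \<subseteq> P s" using const[OF s] by blast
    moreover have "card (P s) \<le> card (P s1)" using s1(2) s by (auto simp: N_def I_def)
    moreover have "finite (P s)" using P(1) s N_sub by blast
    ultimately show ?thesis by (metis card_seteq)
  qed
  have "\<exists>Q. finite Q \<and> Q \<subseteq> topspace X \<and> (\<forall>f\<in>topspace (Cp X). (\<forall>x\<in>Q. f x = 0) \<longrightarrow> T f y = 0)"
    if "y \<in> P s1" for y
    using linear_homeomorphism_local[OF T, of y] P(2)[OF s1ab] that by (metis subsetD)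
  then obtain Q where Q: "\<And>y. y \<in> P s1 \<Longrightarrow> finite (Q y) \<and> Q y \<subseteq> topspace X \<and>
      (\<forall>f\<in>topspace (Cp X). (\<forall>x\<in>Q y. f x = 0) \<longrightarrow> T f y = 0)" by metis
  define R where "R = (\<Union>y\<in>P s1. Q y)"
  have R: "finite R" "R \<subseteq> topspace X" using Q P(1)[OF s1ab] by (auto simp: R_def)
  have "infinite N"
  proof -
    have "{l<..<u} \<subseteq> N" by (auto simp: l_def u_def N_def)
    then show ?thesis using lu(1) finite_subset by (metis infinite_Ioo)
  qed
  then obtain s where s: "s \<in> N" "s \<notin> \<psi> ` R" using R(1) by (meson finite_imageI finite_subset subsetI)
  have sab: "s \<in> {a..b}" using s N_sub by blast
  \<comment> \<open>The values of \<open>T f\<close> on \<open>P s1\<close> depend only on the values of \<open>f\<close> on \<open>R\<close>. This \<open>f\<close> vanishes on \<open>R\<close>,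
    but not at \<open>h s\<close>.\<close>
  define f where "f = (\<lambda>x\<in>topspace X. \<Prod>z\<in>R. \<psi> x - \<psi> z)"
  have f: "f \<in> topspace (Cp X)"
    unfolding f_def using \<psi> R(1) by (intro Cp_memI continuous_intros) auto
  have f_R: "f x = 0" if "x \<in> R" for x
    using that R by (auto simp: f_def)
  have "T f y = 0" if y: "y \<in> P s1" for y
  proof -
    have "\<forall>x\<in>Q y. f x = 0" using f_R y by (auto simp: R_def)
    then show ?thesis using Q[OF y] f by blast
  qed
  then have "S (T f) (h s) = 0"
    using S_rep[OF sab linear_homeomorphism_mem[OF T f]] P_const[OF s(1)] by simp
  then have "f (h s) = 0" using S(2)[OF f] by simp
  moreover have "f (h s) \<noteq> 0"
    using hX[OF sab] \<psi>h[OF sab] R(1) s(2) by (auto simp: f_def)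
  ultimately show False by blast
qed

end

section \<open>The two model spaces\<close>

lemma continuous_map_from_disjoint_sum:
  "continuous_map (X \<oplus>\<^sub>t Y) Z f \<longleftrightarrow> continuous_map X Z (\<lambda>x. f (Inl x)) \<and> continuous_map Y Z (\<lambda>y. f (Inr y))"
proof -
  have "Inl -` {z \<in> topspace X <+> topspace Y. f z \<in> U} = {x \<in> topspace X. f (Inl x) \<in> U}"
    "Inr -` {z \<in> topspace X <+> topspace Y. f z \<in> U} = {y \<in> topspace Y. f (Inr y) \<in> U}" for U
    by auto
  then show ?thesis
    unfolding continuous_map_def by (auto simp: openin_disjoint_sum_topology)
qed

lemma cont_functions_sum: "cont_functions (X \<oplus>\<^sub>t Y) = cont_functions X \<otimes>\<^sub>f cont_functions Y"
  by (auto simp: cont_functions_def prod_space_def continuous_map_from_disjoint_sum)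
     (metis sum.exhaust PlusE InlI InrI)+

lemma cont_functions_Icc: "cont_functions (top_of_set {a..b::real}) \<simeq> split_C {a..b} {}"
proof (rule fin_isoI[where T="\<lambda>f (t, c). f t" and S="\<lambda>g t. g (t, False)"])
  fix f :: "real \<Rightarrow> real" assume "f \<in> cont_functions (top_of_set {a..b})"
  then have f: "continuous_on {a..b} f" "\<And>x. x \<notin> {a..b} \<Longrightarrow> f x = 0"
    by (auto simp: cont_functions_def)
  have eq: "(\<lambda>(t, c). f t) = (\<lambda>(t, c). if t \<in> {a..b} then f t else 0)"
    using f(2) by auto
  show "(\<lambda>(t, c). f t) \<in> split_C {a..b} {}"
    unfolding eq by (rule split_C_continuous[OF f(1)])
next
  fix g assume g: "g \<in> split_C {a..b} {}"
  have "\<exists>d>0. \<forall>s\<in>{a..b}. \<bar>s - t\<bar> < d \<longrightarrow> \<bar>g (s, False) - g (t, False)\<bar> < e"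
    if t: "t \<in> {a..b}" and e: "0 < e" for t e
  proof -
    obtain d1 where d1: "0 < d1"
      "\<And>s c. s \<in> {a..b} \<Longrightarrow> t - d1 < s \<Longrightarrow> s < t \<Longrightarrow> \<bar>g (s, c) - g (t, False)\<bar> < e"
      using split_C_left[OF g t e] by blast
    obtain d2 where d2: "0 < d2"
      "\<And>s c. s \<in> {a..b} \<Longrightarrow> t < s \<Longrightarrow> s < t + d2 \<Longrightarrow> \<bar>g (s, c) - g (t, True)\<bar> < e"
      using split_C_right[OF g t e] by blast
    have eq: "g (t, True) = g (t, False)" using split_C_eq[OF g t] by simp
    have "\<bar>g (s, False) - g (t, False)\<bar> < e" if s: "s \<in> {a..b}" "\<bar>s - t\<bar> < min d1 d2" for s
    proof -
      consider "s = t" | "t - d1 < s" "s < t" | "t < s" "s < t + d2"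
        using s(2) by linarith
      then show ?thesis using d1(2)[OF s(1)] d2(2)[OF s(1)] e eq by cases auto
    qed
    then show ?thesis using d1(1) d2(1) by (intro exI[of _ "min d1 d2"]) auto
  qed
  then have "continuous_on {a..b} (\<lambda>t. g (t, False))"
    by (simp add: continuous_on_iff dist_real_def)
  then show "(\<lambda>t. g (t, False)) \<in> cont_functions (top_of_set {a..b})"
    using split_C_0[OF g] by (auto simp: cont_functions_def)
  show "(\<lambda>(t, c). g (t, False)) = g"
    using split_C_eq[OF g, of _ False] split_C_0[OF g] by (fastforce simp: fun_eq_iff)
qed (auto simp: split_beta)

locale split_interval_line =
  fixes B :: "real set"
  assumes B01: "B \<subseteq> {0<..<1}"
begin

sublocale line "split_interval_carrier B" "split_interval_order B"
  by standard (rule linear_order_on_split_interval)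

notation less (infix \<open>\<sqsubset>\<close> 50)

lemma carrier_iff: "(t, i) \<in> split_interval_carrier B \<longleftrightarrow> t \<in> {0..1} \<and> (i = 0 \<or> i = 1 \<and> t \<in> B)"
  using B01 by (auto simp: split_interval_carrier_def)

lemma less_iff: "(s, i) \<sqsubset> (t, j) \<longleftrightarrow> (s, i) \<in> split_interval_carrier B \<and> (t, j) \<in> split_interval_carrier B \<and>
    (s < t \<or> s = t \<and> i < j)"
  unfolding less_def by (auto simp: split_interval_order_def)

lemma less_fst: "x \<sqsubset> y \<Longrightarrow> fst x \<le> fst y"
  by (cases x; cases y) (auto simp: less_iff)

lemma same_fst: "x \<sqsubset> y \<Longrightarrow> fst x = fst y \<Longrightarrow> snd x = 0 \<and> snd y = 1 \<and> fst x \<in> B"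
  by (cases x; cases y) (auto simp: less_iff carrier_iff)

lemma split_point_jump:
  assumes "t \<in> B"
  shows "jump (t, 0) (t, 1)"
  unfolding jump_def
proof
  show "(t, 0) \<sqsubset> (t, 1)" using assms B01 by (auto simp: less_iff carrier_iff)
  have False if z: "(t, 0) \<sqsubset> (s, i)" "(s, i) \<sqsubset> (t, 1)" for s i
    using z by (auto simp: less_iff)
  then show "\<not> (\<exists>z. (t, 0) \<sqsubset> z \<and> z \<sqsubset> (t, 1))" by auto
qed

sublocale line_map "split_interval_carrier B" "split_interval_order B" fst
proof
  show "continuous_map T euclideanreal fst"
    unfolding continuous_map_real_iff
  proof (intro ballI allI impI)
    fix x and \<epsilon> :: real assume x: "x \<in> topspace T" and \<epsilon>: "0 < \<epsilon>"
    obtain t i where ti: "x = (t, i)" by (cases x)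
    have xK: "x \<in> split_interval_carrier B" using x by simp
    then have t: "t \<in> {0..1}" by (simp add: ti carrier_iff)
    have K: "openin T (split_interval_carrier B)" using openin_topspace[of T] by simp
    have "\<exists>V. openin T V \<and> x \<in> V \<and> (\<forall>y\<in>V. t - \<epsilon> < fst y)"
    proof (cases "t = 0")
      case False
      define a :: "real \<times> nat" where "a = (max 0 (t - \<epsilon> / 2), 0)"
      have a: "a \<in> split_interval_carrier B" using t \<epsilon> by (auto simp: a_def carrier_iff)
      moreover have "a \<sqsubset> x" using False t \<epsilon> xK a unfolding ti a_def by (simp add: less_iff)
      moreover have "t - \<epsilon> < fst y" if "a \<sqsubset> y" for y using less_fst[OF that] \<epsilon> by (auto simp: a_def)
      ultimately show ?thesis
        using openin_rays(2)[OF a] xK by (intro exI[of _ "{y \<in> split_interval_carrier B. a \<sqsubset> y}"]) auto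
    next
      case True
      then show ?thesis
        using K xK \<epsilon> by (intro exI[of _ "split_interval_carrier B"]) (auto simp: carrier_iff)
    qed
    then obtain V where V: "openin T V" "x \<in> V" "\<And>y. y \<in> V \<Longrightarrow> t - \<epsilon> < fst y" by blast
    have "\<exists>V. openin T V \<and> x \<in> V \<and> (\<forall>y\<in>V. fst y < t + \<epsilon>)"
    proof (cases "t = 1")
      case False
      define a :: "real \<times> nat" where "a = (min 1 (t + \<epsilon> / 2), 0)"
      have a: "a \<in> split_interval_carrier B" using t \<epsilon> by (auto simp: a_def carrier_iff)
      moreover have "x \<sqsubset> a" using False t \<epsilon> xK a unfolding ti a_def by (simp add: less_iff)
      moreover have "fst y < t + \<epsilon>" if "y \<sqsubset> a" for y using less_fst[OF that] \<epsilon> by (auto simp: a_def)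
      ultimately show ?thesis
        using openin_rays(1)[OF a] xK by (intro exI[of _ "{y \<in> split_interval_carrier B. y \<sqsubset> a}"]) auto
    next
      case True
      then show ?thesis
        using K xK \<epsilon> by (intro exI[of _ "split_interval_carrier B"]) (auto simp: carrier_iff)
    qed
    then obtain W where W: "openin T W" "x \<in> W" "\<And>y. y \<in> W \<Longrightarrow> fst y < t + \<epsilon>" by blast
    have "\<bar>fst y - fst x\<bar> < \<epsilon>" if "y \<in> V \<inter> W" for y
      using V(3)[of y] W(3)[of y] that by (simp add: ti abs_less_iff)
    then show "\<exists>V. openin T V \<and> x \<in> V \<and> (\<forall>y\<in>V. \<bar>fst y - fst x\<bar> < \<epsilon>)"
      using V(1,2) W(1,2) by (intro exI[of _ "V \<inter> W"]) auto
  qed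
  show "jump x y" if xy: "x \<sqsubset> y" "fst x = fst y" for x y
  proof -
    have "x = (fst x, 0)" "y = (fst x, 1)" "fst x \<in> B" using same_fst[OF xy] xy(2) by (simp_all add: prod_eq_iff)
    then show ?thesis using split_point_jump by metis
  qed
qed (rule less_fst)

lemma image_fst: "fst ` split_interval_carrier B = {0..1}"
  using B01 by (force simp: split_interval_carrier_def)

lemma doubles_eq: "doubles = B"
proof -
  have "t \<in> doubles" if "t \<in> B" for t
    using split_point_jump[OF that] unfolding doubles_def jump_def by (intro CollectI exI[of _ "(t, 0)"] exI[of _ "(t, 1)"]) simp
  moreover have "t \<in> B" if "t \<in> doubles" for t
    using that same_fst by (auto simp: doubles_def)
  ultimately show ?thesis by blast
qed

lemma cont_functions_split_interval: "cont_functions (split_interval B) \<simeq> split_C {0..1} B"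
  using cont_functions_iso_split_C unfolding image_fst doubles_eq split_interval_def .

lemma zero_dim_split_interval:
  assumes "\<And>s t. 0 \<le> s \<Longrightarrow> s < t \<Longrightarrow> t \<le> 1 \<Longrightarrow> \<exists>b\<in>B. s < b \<and> b < t"
  shows zero_dim
  unfolding zero_dim_def
proof (intro allI impI)
  fix x y assume xy: "x \<sqsubset> y"
  show "\<exists>p q. jump p q \<and> \<not> p \<sqsubset> x \<and> \<not> y \<sqsubset> q"
  proof (cases "fst x = fst y")
    case True
    then show ?thesis using fibre_jump[OF xy] less_irrefl by blast
  next
    case False
    have "fst x \<in> {0..1}" "fst y \<in> {0..1}"
      using less_mem[OF xy] image_fst by blast+
    then obtain b where b: "b \<in> B" "fst x < b" "b < fst y"
      using assms[of "fst x" "fst y"] less_fst[OF xy] False by auto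
    then have "\<not> (b, 0) \<sqsubset> x" "\<not> y \<sqsubset> (b, 1)"
      using less_fst[of "(b, 0)" x] less_fst[of y "(b, 1)"] by auto
    then show ?thesis using split_point_jump[OF b(1)] by blast
  qed
qed

end

section \<open>Lines of dimension one\<close>

lemma interior_countable:
  fixes C :: "real set"
  assumes "countable C"
  shows "interior C = {}"
proof (rule ccontr)
  assume "interior C \<noteq> {}"
  then obtain x e where "0 < e" "ball x e \<subseteq> C" using mem_interior by blast
  then show False using assms uncountable_ball[of e x] countable_subset by blast
qed

text \<open>Equidistant points give a finite number of gaps, a sequence converging to \<open>0\<close> infinitely many.\<close>

lemma countable_gaps_realised:
  assumes "countable N" "N \<noteq> {}"
  obtains C :: "real set" and p where "compact C" "C \<subseteq> {0..1}" "0 \<in> C" "1 \<in> C" "interior C = {}"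
    "bij_betw p (gaps ({0<..<1} - C)) N"
proof (cases "finite N")
  case True
  define k where "k = card N"
  have k: "0 < k" using True assms(2) by (simp add: k_def card_gt_0_iff)
  define C where "C = (\<lambda>i. real i / real k) ` {..k}"
  have C: "finite C" "C \<subseteq> {0..1}" "0 \<in> C" "1 \<in> C"
    using k by (auto simp: C_def image_iff intro!: bexI[of _ 0] bexI[of _ k])
  have "inj_on (\<lambda>i. real i / real k) {..k}" using k by (auto simp: inj_on_def)
  then have card_C: "card C = k + 1" by (simp add: C_def card_image)
  let ?U = "{0<..<1} - C"
  have "fst ` gaps ?U = C - {1}"
  proof
    show "fst ` gaps ?U \<subseteq> C - {1}"
    proof clarsimp
      fix u v assume uv: "(u, v) \<in> gaps ?U"
      have "?U \<subseteq> {0..1}" by auto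
      then have "u \<in> {0..1}" "v \<in> {0..1}" using gaps_endpoint_mem[OF uv] by blast+
      then show "u \<in> C \<and> u \<noteq> 1" using gapsD(1,2)[OF uv] C(3,4) by (cases "u = 0") auto
    qed
    show "C - {1} \<subseteq> fst ` gaps ?U"
    proof
      fix u assume u: "u \<in> C - {1}"
      define v where "v = Min {c \<in> C. u < c}"
      have "finite {c \<in> C. u < c}" "1 \<in> {c \<in> C. u < c}" using C u by (auto simp: less_le)
      then have v: "v \<in> {c \<in> C. u < c}" "\<And>c. c \<in> C \<Longrightarrow> u < c \<Longrightarrow> v \<le> c"
        unfolding v_def using Min_in by (blast, auto)
      have "t \<in> ?U" if "u < t" "t < v" for t
      proof -
        have "0 \<le> u" "v \<le> 1" using u v(1) C(2) by auto
        then show ?thesis using v(2)[of t] that by auto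
      qed
      then have "(u, v) \<in> gaps ?U" using u v by (auto simp: gaps_def)
      then show "u \<in> fst ` gaps ?U" by force
    qed
  qed
  moreover have "inj_on fst (gaps ?U)" by (auto simp: inj_on_def dest: gaps_fst_unique)
  ultimately have "bij_betw fst (gaps ?U) (C - {1})" by (simp add: bij_betw_def)
  moreover have "card (C - {1}) = card N" using card_C C(1,4) by (simp add: k_def)
  then obtain q where "bij_betw q (C - {1}) N"
    using True C(1) by (metis finite_Diff finite_same_card_bij)
  ultimately have "bij_betw (q \<circ> fst) (gaps ?U) N" by (rule bij_betw_trans)
  then show thesis
    using that[of C] C interior_countable countable_finite[OF C(1)] finite_imp_compact[OF C(1)] by blast
next
  case False
  define s where "s n = 1 / (real n + 1)" for n
  define C where "C = insert 0 (range s)"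
  have "s \<longlonglongrightarrow> 0"
    unfolding s_def using LIMSEQ_inverse_real_of_nat by (simp add: inverse_eq_divide add.commute)
  then have cpt: "compact C" unfolding C_def by (rule compact_sequence_with_limit)
  have C: "C \<subseteq> {0..1}" "0 \<in> C" "1 \<in> C"
    by (auto simp: C_def s_def image_iff intro: exI[of _ 0])
  have "inj s" by (auto simp: inj_def s_def)
  then have "infinite C" unfolding C_def using range_inj_infinite by auto
  have int: "interior C = {}" by (rule interior_countable) (auto simp: C_def)
  have "infinite (gaps ({0<..<1} - C))"
    using infinite_gaps[OF _ C(1) \<open>infinite C\<close> int] cpt by (simp add: compact_imp_closed)
  then have "bij_betw (to_nat_on (gaps ({0<..<1} - C))) (gaps ({0<..<1} - C)) UNIV"
    by (intro to_nat_on_infinite countable_gaps)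
  moreover have "bij_betw (from_nat_into N) UNIV N"
    using bij_betw_from_nat_into[OF assms(1) False] .
  ultimately have "bij_betw (from_nat_into N \<circ> to_nat_on (gaps ({0<..<1} - C))) (gaps ({0<..<1} - C)) N"
    by (rule bij_betw_trans)
  then show thesis using that[OF cpt C int] by blast
qed

lemma interior_affine_image:
  fixes C :: "real set"
  assumes "interior C = {}" "c \<noteq> 0"
  shows "interior ((\<lambda>x. a + c * x) ` C) = {}"
proof -
  let ?\<phi> = "\<lambda>x. a + c * x"
  have "open (?\<phi> -` interior (?\<phi> ` C))"
    by (intro open_vimage open_interior continuous_intros)
  moreover have "?\<phi> -` interior (?\<phi> ` C) \<subseteq> C"
    using interior_subset[of "?\<phi> ` C"] assms(2) by auto
  ultimately have "?\<phi> -` interior (?\<phi> ` C) = {}"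
    using interior_maximal assms(1) by blast
  moreover have "interior (?\<phi> ` C) \<subseteq> range ?\<phi>"
    using interior_subset[of "?\<phi> ` C"] by blast
  ultimately show ?thesis by blast
qed

text \<open>
  The split interval absorbs the functions on \<open>C\<close>: putting \<open>C\<close> next to a zero-dimensional line
  gives another zero-dimensional line.
\<close>

lemma split_interval_absorbs:
  fixes C F A B :: "real set"
  assumes BA: "baumgartner_axiom" and B: "omega1_dense_unit B"
    and C: "compact C" "C \<subseteq> {0..1}" "0 \<in> C" "1 \<in> C" "interior C = {}"
    and F: "compact F" "F \<subseteq> {0..1}" "0 \<in> F" "1 \<in> F" "interior F = {}"
    and A: "A \<subseteq> F \<inter> {0<..<1}" "|A| \<le>o omega1" "uncountable A"
  shows "split_C {0..1} B \<simeq> split_C C {} \<otimes>\<^sub>f split_C {0..1} B"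
proof -
  \<comment> \<open>Copies in the outer thirds of the unit interval. The summand \<open>0\<close> puts both maps into the same
    form, for \<open>interior_affine_image\<close>.\<close>
  define \<phi> where "\<phi> x = 0 + 1/3 * x" for x :: real
  define \<psi> where "\<psi> x = 2/3 + 1/3 * x" for x :: real
  have mono: "strict_mono_on S \<phi>" "strict_mono_on S \<psi>" for S
    by (auto simp: strict_mono_on_def \<phi>_def \<psi>_def)
  have cont: "continuous_on S \<phi>" "continuous_on S \<psi>" for S
    unfolding \<phi>_def \<psi>_def by (intro continuous_intros)+
  define G where "G = \<phi> ` C \<union> \<psi> ` F"
  have GV: "split_C G (\<psi> ` A) \<simeq> split_C {0..1} B"
  proof (rule zero_dim_iso_split_interval[OF BA B])
    have cpt: "compact (\<phi> ` C)" "compact (\<psi> ` F)"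
      using C(1) F(1) cont by (auto intro: compact_continuous_image)
    then show "compact G" unfolding G_def by (rule compact_Un)
    show "G \<subseteq> {0..1}" using C(2) F(2) by (fastforce simp: G_def \<phi>_def \<psi>_def)
    show "0 \<in> G" "1 \<in> G" using C(3) F(4) by (force simp: G_def \<phi>_def \<psi>_def)+
    have "interior (\<phi> ` C) = {}"
      unfolding \<phi>_def by (rule interior_affine_image[OF C(5)]) simp
    moreover have "interior (\<psi> ` F) = {}"
      unfolding \<psi>_def by (rule interior_affine_image[OF F(5)]) simp
    ultimately show "interior G = {}"
      unfolding G_def using interior_closed_Un_empty_interior[of "\<phi> ` C" "\<psi> ` F"] cpt
      by (simp add: compact_imp_closed)
    show "\<psi> ` A \<subseteq> G \<inter> {0<..<1}" using A(1) by (auto simp: G_def \<psi>_def)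
    show "|\<psi> ` A| \<le>o omega1" using A(2) by (rule card_image_le_omega1)
    have "inj_on \<psi> A" by (auto simp: inj_on_def \<psi>_def)
    then show "uncountable (\<psi> ` A)" using A(3) countable_image_inj_on by blast
  qed
  have G_split: "split_C G (\<psi> ` A) \<simeq> split_C (\<phi> ` C) (\<psi> ` A) \<otimes>\<^sub>f split_C (\<psi> ` F) (\<psi> ` A)"
    unfolding G_def using C(2) F(2)
    by (intro split_C_disjoint_union[where c="1/2"]) (force simp: \<phi>_def \<psi>_def)+
  have C_eq: "split_C (\<phi> ` C) (\<psi> ` A) = split_C (\<phi> ` C) (\<phi> ` {})"
  proof (rule split_C_cong)
    have "\<psi> y \<noteq> \<phi> x" if "x \<in> C" "y \<in> A" for x y
      using C(2) A(1) that by (force simp: \<phi>_def \<psi>_def)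
    then show "\<psi> ` A \<inter> \<phi> ` C = \<phi> ` {} \<inter> \<phi> ` C" by auto
  qed
  have C_iso: "split_C (\<phi> ` C) (\<phi> ` {}) \<simeq> split_C C {}"
    using C(1) mono cont by (intro split_C_reparam) auto
  have "split_C (\<psi> ` F) (\<psi> ` A) \<simeq> split_C F A"
    using F(1) A(1) mono cont by (intro split_C_reparam) auto
  also have "split_C F A \<simeq> split_C {0..1} B"
    by (rule zero_dim_iso_split_interval[OF BA B F A])
  finally have F_iso: "split_C (\<psi> ` F) (\<psi> ` A) \<simeq> split_C {0..1} B" .
  have "split_C {0..1} B \<simeq> split_C (\<phi> ` C) (\<psi> ` A) \<otimes>\<^sub>f split_C (\<psi> ` F) (\<psi> ` A)"
    by (rule fin_iso_trans[OF fin_iso_sym[OF GV] G_split])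
  also have "\<dots> \<simeq> split_C C {} \<otimes>\<^sub>f split_C {0..1} B"
    unfolding C_eq by (rule fin_iso_prod_cong[OF C_iso F_iso])
  finally show ?thesis .
qed

text \<open>
  Without the interior of \<open>F\<close> a zero-dimensional line remains, and what has been removed contributes
  a null sequence of functions on intervals. A countable compact set \<open>C\<close> whose gaps match these
  intervals turns the null sequence into functions on one whole interval, at the expense of the
  functions on \<open>C\<close>, which the split interval can spare.
\<close>

theorem one_dim_iso_split_interval_sum:
  assumes BA: "baumgartner_axiom" and B: "omega1_dense_unit B"
    and F': "compact F" "F \<subseteq> {0..1}" "0 \<in> F" "1 \<in> F" "interior F \<noteq> {}"
    and A: "A \<subseteq> F \<inter> {0<..<1}" "A \<inter> interior F = {}" "|A| \<le>o omega1" "uncountable A"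
  shows "split_C F A \<simeq> split_C {0..1} B \<otimes>\<^sub>f split_C {0..1} {}"
proof -
  define V where "V = split_C {0..1} B"
  define N where "N = gaps (interior F)"
  define Z where "Z = c0_sum N (split_C_ends {})"
  define F0 where "F0 = F - interior F"
  interpret G: gap_filling F "interior F" A "{}"
  proof
    fix u v s :: real assume uv: "(u, v) \<in> gaps (interior F)" and s: "0 < s" "s < 1"
    then show "u + s * (v - u) \<in> A \<longleftrightarrow> s \<in> {}"
      using gapsD(4)[OF uv] affine_between[OF gapsD(1)[OF uv] s] A(2) by blast
  qed (use F'(1) interior_subset in auto)
  have "split_C F A \<simeq> split_C F0 A \<otimes>\<^sub>f Z"
    unfolding F0_def Z_def N_def by (rule G.split_C_fill_gaps)
  have int01: "interior F \<subseteq> {0<..<1}"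
    using interior_mono[OF F'(2)] by (simp add: interior_atLeastAtMost_real)
  have F0: "compact F0" "F0 \<subseteq> {0..1}" "0 \<in> F0" "1 \<in> F0" "interior F0 = {}"
  proof -
    show "compact F0" unfolding F0_def using F'(1) by (simp add: compact_diff)
    have "interior F0 \<subseteq> interior F"
      unfolding F0_def by (rule interior_mono) blast
    moreover have "interior F0 \<subseteq> F0" by (rule interior_subset)
    ultimately show "interior F0 = {}" by (auto simp: F0_def)
  qed (use F' int01 in \<open>auto simp: F0_def\<close>)
  have A0: "A \<subseteq> F0 \<inter> {0<..<1}" using A(1,2) by (auto simp: F0_def)
  have "split_C F0 A \<simeq> V"
    unfolding V_def by (rule zero_dim_iso_split_interval[OF BA B F0 A0 A(3,4)])
  have "N \<noteq> {}"
  proof -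
    obtain t where "t \<in> interior F" using F'(5) by blast
    then show ?thesis using gaps_exist[OF open_interior G.bounded_U] unfolding N_def by blast
  qed
  moreover have "countable N" unfolding N_def by (rule countable_gaps)
  ultimately obtain C :: "real set" and p where C: "compact C" "C \<subseteq> {0..1}" "0 \<in> C" "1 \<in> C" "interior C = {}"
    and p: "bij_betw p (gaps ({0<..<1} - C)) N"
    using countable_gaps_realised by metis
  interpret H: gap_filling "{0..1}" "{0<..<1} - C" "{}" "{}"
    by standard (use C(1) in \<open>auto simp: compact_imp_closed\<close>)
  have "{0..1} - ({0<..<1} - C) = C" using C(2-4) by (auto simp: less_le)
  then have "split_C {0..1} {} \<simeq> split_C C {} \<otimes>\<^sub>f c0_sum (gaps ({0<..<1} - C)) (split_C_ends {})"
    using H.split_C_fill_gaps by simp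
  also have "\<dots> \<simeq> split_C C {} \<otimes>\<^sub>f Z"
    unfolding Z_def by (rule fin_iso_prod_cong[OF fin_iso_refl c0_sum_reindex[OF p]])
  finally have I: "split_C {0..1} {} \<simeq> split_C C {} \<otimes>\<^sub>f Z" .
  have VC: "V \<simeq> split_C C {} \<otimes>\<^sub>f V"
    unfolding V_def by (rule split_interval_absorbs[OF BA B C F0 A0 A(3,4)])
  have "split_C F A \<simeq> V \<otimes>\<^sub>f Z"
    using fin_iso_trans[OF \<open>split_C F A \<simeq> split_C F0 A \<otimes>\<^sub>f Z\<close> fin_iso_prod_cong[OF \<open>split_C F0 A \<simeq> V\<close> fin_iso_refl]] .
  also have "\<dots> \<simeq> (V \<otimes>\<^sub>f split_C C {}) \<otimes>\<^sub>f Z"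
    by (rule fin_iso_prod_cong[OF fin_iso_trans[OF VC fin_iso_prod_comm] fin_iso_refl])
  also have "\<dots> \<simeq> V \<otimes>\<^sub>f (split_C C {} \<otimes>\<^sub>f Z)"
    by (rule fin_iso_prod_assoc)
  also have "\<dots> \<simeq> V \<otimes>\<^sub>f split_C {0..1} {}"
    by (rule fin_iso_prod_cong[OF fin_iso_refl fin_iso_sym[OF I]])
  finally show ?thesis by (simp add: V_def)
qed

section \<open>Classification by dimension\<close>

theorem theorem3p1:
  fixes K :: "'k set" and r :: "'k rel" and B :: "real set"
  assumes BA: "baumgartner_axiom"
    and line: "compact_line K r"
    and separable: "separable_space (order_topology K r)"
    and weight: "has_weight (order_topology K r) omega1"
    and B: "omega1_dense_in (top_of_set {0<..<1}) B"
  shows "(Cp_linearly_homeomorphic (order_topology K r) (split_interval B) \<longleftrightarrow>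
            has_covering_dim (order_topology K r) 0) \<and>
         (Cp_linearly_homeomorphic (order_topology K r) (split_interval B \<oplus>\<^sub>t top_of_set {0..1::real}) \<longleftrightarrow>
            has_covering_dim (order_topology K r) 1)"
proof -
  let ?T = "order_topology K r" and ?S = "split_interval B" and ?I = "top_of_set {0..1::real}"
  interpret line K r
    using line by unfold_locales (simp add: compact_line_def)
  have compact: "compact_space ?T" using line by (simp add: compact_line_def)
  have Bu: "omega1_dense_unit B" by (rule omega1_dense_unit[OF B])
  have B01: "B \<subseteq> {0<..<1}" using Bu by (simp add: omega1_dense_unit_def)
  interpret S: split_interval_line B by standard (rule B01)
  have "uncountable jumps" by (rule uncountable_jumps[OF weight separable])
  moreover have "jumps \<subseteq> K" using jump_mem by (auto simp: jumps_def)
  ultimately have "infinite K" using countable_finite countable_subset by blast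
  obtain \<theta> where lm: "line_map K r \<theta>" and F: "compact (\<theta> ` K)" "\<theta> ` K \<subseteq> {0..1}" "0 \<in> \<theta> ` K" "1 \<in> \<theta> ` K"
    and A01: "line_map.doubles r \<theta> \<subseteq> {0<..<1}" and A_int: "line_map.doubles r \<theta> \<inter> interior (\<theta> ` K) = {}"
    and zd: "interior (\<theta> ` K) = {} \<longleftrightarrow> zero_dim"
    using separable_compact_line_representation[OF compact separable \<open>infinite K\<close>] by blast
  interpret L: line_map K r \<theta> by (rule lm)
  have A: "L.doubles \<subseteq> \<theta> ` K \<inter> {0<..<1}" "|L.doubles| \<le>o omega1" "uncountable L.doubles"
    using L.doubles_subset A01 L.doubles_le_omega1[OF jumps_le_weight[OF weight]]
      L.uncountable_doubles[OF \<open>uncountable jumps\<close>] by auto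
  have "topspace ?T \<noteq> {}" using \<open>infinite K\<close> by auto
  note ne = covering_dim_empty[OF this]
  show ?thesis
  proof (cases zero_dim)
    case True
    have "cont_functions ?T \<simeq> split_C {0..1} B"
      using fin_iso_trans[OF L.cont_functions_iso_split_C zero_dim_iso_split_interval[OF BA Bu F _ A]] True zd
      by blast
    then have "cont_functions ?T \<simeq> cont_functions ?S"
      using fin_iso_trans fin_iso_sym[OF S.cont_functions_split_interval] by blast
    then have 1: "Cp_linearly_homeomorphic ?T ?S" by (rule Cp_linearly_homeomorphic_fin_iso)
    have dim: "covering_dim_le ?T 0" by (rule covering_dim_zero[OF compact True])
    interpret totally_separated ?T
      by standard (use zero_dim_separates[OF True] in simp)
    have "\<not> Cp_linearly_homeomorphic (?S \<oplus>\<^sub>t ?I) ?T"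
    proof (rule no_arc[of 0 1 _ Inr "case_sum (\<lambda>_. -1) (\<lambda>s. s)"])
      show "continuous_map (top_of_set {0..1}) (?S \<oplus>\<^sub>t ?I) Inr"
        unfolding continuous_map_def
      proof (intro conjI allI impI)
        fix U assume "openin (?S \<oplus>\<^sub>t ?I) U"
        then have U: "openin ?I (Inr -` U)" by (simp add: openin_disjoint_sum_topology)
        moreover have "{x \<in> topspace ?I. Inr x \<in> U} = Inr -` U"
          using openin_subset[OF U] by auto
        ultimately show "openin ?I {x \<in> topspace ?I. Inr x \<in> U}" by simp
      qed auto
      show "continuous_map (?S \<oplus>\<^sub>t ?I) euclideanreal (case_sum (\<lambda>_. -1) (\<lambda>s. s))"
        by (simp add: continuous_map_from_disjoint_sum)
    qed (auto split: sum.splits)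
    then have 2: "\<not> Cp_linearly_homeomorphic ?T (?S \<oplus>\<^sub>t ?I)"
      using Cp_linearly_homeomorphic_sym by blast
    show ?thesis using 1 2 dim ne by (simp add: has_covering_dim_def)
  next
    case False
    then have int: "interior (\<theta> ` K) \<noteq> {}" using zd by simp
    have "cont_functions ?T \<simeq> split_C {0..1} B \<otimes>\<^sub>f split_C {0..1} {}"
      using fin_iso_trans[OF L.cont_functions_iso_split_C one_dim_iso_split_interval_sum[OF BA Bu F int A(1) A_int A(2,3)]] .
    moreover have "cont_functions (?S \<oplus>\<^sub>t ?I) \<simeq> split_C {0..1} B \<otimes>\<^sub>f split_C {0..1} {}"
      unfolding cont_functions_sum
      by (rule fin_iso_prod_cong[OF S.cont_functions_split_interval cont_functions_Icc])
    ultimately have "cont_functions ?T \<simeq> cont_functions (?S \<oplus>\<^sub>t ?I)"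
      using fin_iso_trans fin_iso_sym by blast
    then have 1: "Cp_linearly_homeomorphic ?T (?S \<oplus>\<^sub>t ?I)" by (rule Cp_linearly_homeomorphic_fin_iso)
    obtain t where "t \<in> interior (\<theta> ` K)" using int by blast
    then obtain e where e: "0 < e" "cball t e \<subseteq> interior (\<theta> ` K)"
      using open_contains_cball[of "interior (\<theta> ` K)"] by auto
    then have sub: "{t - e..t + e} \<subseteq> interior (\<theta> ` K)" by (simp add: cball_eq_atLeastAtMost)
    have arc: "t - e < t + e" "{t - e..t + e} \<subseteq> \<theta> ` K" "{t - e..t + e} \<inter> L.doubles = {}"
      using e(1) sub interior_subset A_int by (simp, blast+)
    interpret Y: totally_separated ?S
    proof
      have zdS: S.zero_dim
        using omega1_dense_unit_between[OF Bu] by (intro S.zero_dim_split_interval) metis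
      show "\<exists>W. openin ?S W \<and> closedin ?S W \<and> y \<in> W \<and> y' \<notin> W"
        if "y \<in> topspace ?S" "y' \<in> topspace ?S" "y \<noteq> y'" for y y'
        using S.zero_dim_separates[OF zdS] that by (simp add: split_interval_def)
    qed
    have 2: "\<not> Cp_linearly_homeomorphic ?T ?S"
    proof (rule Y.no_arc[OF arc(1) L.continuous_lo[OF arc(2,3)] L.cont])
      show "\<theta> (L.lo s) = s" if "s \<in> {t - e..t + e}" for s
        using L.lo(2)[of s] that arc(2) by blast
    qed
    show ?thesis
      using 1 2 L.covering_dim_not_zero[OF arc] covering_dim_le_one[OF compact]
      by (simp add: has_covering_dim_def)
  qed
qed

end
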